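(* Consider the adaptive algorithm AFEM-PGMRES described in the context, run formally with $\tau<0$ so that the tolerance test never stops it. Suppose that the error estimator satisfies stability (A1), reduction (A2), and reliability (A3), and that the employed preconditioners satisfy the norm equivalence (PRE). Let $0<\theta\le1$, $C_{\rm mark}\ge1$, $u_0^0\in\mathcal X_0$, $\lambda_{\rm alg}>0$, $C_{\rm alg}>0$ (and $k_{\max}\in\mathbb N$) be arbitrary. Then $$|||u^\star-u_\ell^k|||+|||u^\star-u_\ell^\star|||+|||u_\ell^\star-u_\ell^k|||+\eta_\ell(u_\ell^\star)+\eta_\ell(u_\ell^k)\to0\qquad\text{as }|\ell,k|\to\infty,$$ where $(\ell,k)\in\mathcal Q$.
   Context: **Model problem.** $\Omega\subset\mathbb R^d$ ($d\ge1$) is a polyhedral Lipschitz domain, $\mathcal X:=H^1_0(\Omega)$, $f\in L^2(\Omega)$, $\boldsymbol f\in[L^2(\Omega)]^d$, $\boldsymbol b\in[L^\infty(\Omega)]^d$ with $\operatorname{div}\boldsymbol b\in L^\infty(\Omega)$, $c\in L^\infty(\Omega)$, $-\operatorname{div}\boldsymbol b+2c\ge0$ a.e., and $\boldsymbol K\in[L^\infty(\Omega)]^{d\times d}$ symmetric with smallest eigenvalue uniformly bounded from below by a positive constant. Set $a(v,w):=\langle\boldsymbol K\nabla v,\nabla w\rangle_{L^2(\Omega)}$, $b(v,w):=a(v,w)+\langle\boldsymbol b\cdot\nabla v,w\rangle_{L^2(\Omega)}+\langle cv,w\rangle_{L^2(\Omega)}$, $F(v):=\langle f,v\rangle_{L^2(\Omega)}+\langle\boldsymbol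 f,\nabla v\rangle_{L^2(\Omega)}$, $|||v|||:=a(v,v)^{1/2}$. There are constants $0<C_{\rm ell}\le C_{\rm bnd}$ with $|b(v,w)|\le C_{\rm bnd}|||v|||\,|||w|||$ and $b(v,v)\ge C_{\rm ell}|||v|||^2$ on $\mathcal X$. The exact solution $u^\star\in\mathcal X$ satisfies $b(u^\star,v)=F(v)$ for all $v\in\mathcal X$. **Discretization.** $\mathcal T_0$ is a conforming simplicial triangulation of $\Omega$ (admissible for newest vertex bisection, NVB), and $\boldsymbol f|_T\in[H^1(T)]^d$, $\boldsymbol K|_T\in[W^{1,\infty}(T)]^{d\times d}$ for all $T\in\mathcal T_0$. $\mathbb T(\mathcal T_H)$ is the set of triangulations obtained from $\mathcal T_H$ by finitely many NVB steps; $\mathtt{refine}(\mathcal T_H,\mathcal M_H)$ is the coarsest NVB refinement of $\mathcal T_H$ in which all elements of $\mathcal M_H\subseteq\mathcal T_H$ are refined. For fixed $p\in\mathbb N$, $\mathcal X_H\subset H^1_0(\Omega)$ is the space of globally continuous $\mathcal T_H$-piecewise polynomials of degree $\le p$ vanishing on $\partial\Omega$. $u_H^\star\in\mathcal X_H$ is the Galerkin solution: $b(u_H^\star,v_H)=F(v_H)$ for all $v_H\in\mathcal X_H$. Index $\ell$ replaces $H$ for the mesh $\mathcal T_\ell$. **Estimator.** For $T\in\mathcal T_H$, $v_H\in\mathcal X_H$: $\eta_H(T,v_H)^2:=|T|^{2/d}\|\operatorname{div}(\boldsymbol K\nabla v_H-\boldsymbol f)-\boldsymbol b\cdot\nabla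 v_H-cv_H+f\|_{L^2(T)}^2+|T|^{1/d}\|[\![(\boldsymbol K\nabla v_H-\boldsymbol f)\cdot n]\!]\|^2_{L^2(\partial T\cap\Omega)}$, where $[\![\cdot]\!]$ is the jump over facets; $\eta_H(\mathcal U_H,v_H):=(\sum_{T\in\mathcal U_H}\eta_H(T,v_H)^2)^{1/2}$ for $\mathcal U_H\subseteq\mathcal T_H$, and $\eta_H(v_H):=\eta_H(\mathcal T_H,v_H)$. The axioms are, with constants $C_{\rm stab},C_{\rm rel}>0$, $0<q_{\rm red}<1$, for all $\mathcal T_H\in\mathbb T(\mathcal T_0)$, $\mathcal T_h\in\mathbb T(\mathcal T_H)$, $v_H\in\mathcal X_H$, $v_h\in\mathcal X_h$: (A1) $|\eta_h(\mathcal T_h\cap\mathcal T_H,v_h)-\eta_H(\mathcal T_h\cap\mathcal T_H,v_H)|\le C_{\rm stab}|||v_h-v_H|||$; (A2) $\eta_h(\mathcal T_h\setminus\mathcal T_H,v_H)\le q_{\rm red}\,\eta_H(\mathcal T_H\setminus\mathcal T_h,v_H)$; (A3) $|||u^\star-u_H^\star|||\le C_{\rm rel}\,\eta_H(u_H^\star)$. **Preconditioner.** Let $\varphi_{\ell,1},\dots,\varphi_{\ell,N_\ell}$ be a basis of $\mathcal X_\ell$, $(\mathbf B_\ell)_{jk}:=b(\varphi_{\ell,k},\varphi_{\ell,j})$, $(\mathbf d_\ell)_j:=F(\varphi_{\ell,j})$. $\mathbf P_\ell\in\mathbb R^{N_\ell\times N_\ell}$ is symmetric positive definite, $(\mathbf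 x,\mathbf y)_{\mathbf P_\ell^{-1}}:=(\mathbf P_\ell^{-1}\mathbf x,\mathbf y)_2$ with induced norm $\|\cdot\|_{\mathbf P_\ell^{-1}}$. (PRE): there is $C_{\rm pre}\ge1$, independent of $\ell$, the mesh size and $p$, with $C_{\rm pre}^{-1}|||v_\ell|||\le\|\mathbf x_\ell\|_{\mathbf P_\ell^{-1}}\le C_{\rm pre}|||v_\ell|||$ for all $v_\ell=\sum_j(\mathbf x_\ell)_j\varphi_{\ell,j}\in\mathcal X_\ell$. **PGMRES (preconditioned GMRES with restart length $k_{\max}\in\mathbb N$).** Given $\mathbf x_\ell^0$, iterates are defined for $k\ge1$ as follows: with $K:=((k-1)\bmod k_{\max})+1$ and $m:=k-K$ (the index of the last restart), $\mathbf x_\ell^k$ is the unique minimizer of $\|\mathbf P_\ell(\mathbf d_\ell-\mathbf B_\ell\mathbf x)\|_{\mathbf P_\ell^{-1}}$ over $\mathbf x\in\mathbf x_\ell^m+\operatorname{span}\{(\mathbf P_\ell\mathbf B_\ell)^i\mathbf s_\ell^m:0\le i<K\}$, where $\mathbf s_\ell^k:=\mathbf P_\ell(\mathbf d_\ell-\mathbf B_\ell\mathbf x_\ell^k)$ is the preconditioned residual. Write $u_\ell^k:=\sum_j(\mathbf x_\ell^k)_j\varphi_{\ell,j}$. **Algorithm AFEM-PGMRES.** Input: $\mathcal T_0$, $0<\theta\le1$, $C_{\rm mark}\ge1$, $u_0^0\in\mathcal X_0$, $C_{\rm alg},\lambda_{\rm alg}>0$, $k_{\max}\in\mathbb N$,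 tolerance $\tau$; set $\mathsf S:=0$. Write $\mathsf H_\ell^k:=\eta_\ell(u_\ell^k)+\|\mathbf s_\ell^k\|_{\mathbf P_\ell^{-1}}$. For $\ell=0,1,2,\dots$: (i) Starting from $u_\ell^0$, perform PGMRES steps $k=1,2,\dots$ until, for the first time, $\|\mathbf s_\ell^k\|_{\mathbf P_\ell^{-1}}\le\lambda_{\rm alg}\,\eta_\ell(u_\ell^k)$; set $\underline k[\ell]:=k$ (if this never happens, $\underline k[\ell]:=\infty$ and the algorithm iterates forever on level $\ell$). Write $\underline k=\underline k[\ell]$ in $u_\ell^{\underline k}$, $\mathsf H_\ell^{\underline k}$. (ii) If $\mathsf H_\ell^{\underline k}\le\tau$, stop. Otherwise: (a) if $\ell\ge1$ and $\mathsf S>C_{\rm alg}(\mathsf H_\ell^{\underline k})^{-1}$, replace $C_{\rm alg}$ by $2C_{\rm alg}$ and $\lambda_{\rm alg}$ by $\lambda_{\rm alg}/2$; (b) replace $\mathsf S$ by $\mathsf S+(\mathsf H_\ell^{\underline k})^{-1}$. (Convention $1/0=\infty$.) (iii) Choose $\mathcal M_\ell\subseteq\mathcal T_\ell$ with $\theta\eta_\ell(u_\ell^{\underline k})^2\le\eta_\ell(\mathcal M_\ell,u_\ell^{\underline k})^2$ and $\#\mathcal M_\ell\le C_{\rm mark}\min\{\#\mathcal U:\mathcal U\subseteq\mathcal T_\ell,\ \theta\eta_\ell(u_\ell^{\underline k})^2\le\eta_\ell(\mathcal U,u_\ell^{\underline k})^2\}$. (iv) $\mathcal T_{\ell+1}:=\mathtt{refine}(\mathcal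 T_\ell,\mathcal M_\ell)$, $u_{\ell+1}^0:=u_\ell^{\underline k}$. **Index set.** $\mathcal Q$ is the set of all $(\ell,k)\in\mathbb N_0^2$ such that $u_\ell^k$ appears in the algorithm, ordered by $(\ell',k')\le(\ell,k)$ iff $u_{\ell'}^{k'}$ is defined not later than $u_\ell^k$ (lexicographic order), and $|\ell,k|:=\#\{(\ell',k')\in\mathcal Q:(\ell',k')\le(\ell,k)\}$. *)

theory Defs
  imports
    "HOL-Analysis.Analysis"
    "HOL-Library.Extended_Nat"
    "Jordan_Normal_Form.Matrix"
    "Jordan_Normal_Form.VS_Connect"
    "Jordan_Normal_Form.Gauss_Jordan_Elimination"
begin

no_notation vec_index (infixl \<open>$\<close> 100)
no_notation scalar_prod (infix \<open>\<bullet>\<close> 70)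
unbundle inner_syntax

section \<open>Function spaces\<close>

text \<open>
  Functions on an open set \<open>\<Omega>\<close> are total functions on the whole space; elements of the Lebesgue and
  Sobolev spaces are represented by arbitrary members of their almost-everywhere classes on \<open>\<Omega>\<close>.
\<close>

definition square_integrable :: "'a measure \<Rightarrow> ('a \<Rightarrow> 'b::real_normed_vector) \<Rightarrow> bool" where
  "square_integrable M f \<longleftrightarrow> f \<in> borel_measurable M \<and> integrable M (\<lambda>x. (norm (f x))\<^sup>2)"

definition ess_bounded :: "'a measure \<Rightarrow> ('a \<Rightarrow> 'b::real_normed_vector) \<Rightarrow> bool" where
  "ess_bounded M f \<longleftrightarrow> f \<in> borel_measurable M \<and> (\<exists>C. AE x in M. norm (f x) \<le> C)"

definition L2_tendsto ::
    "'a measure \<Rightarrow> (nat \<Rightarrow> 'a \<Rightarrow> 'b::real_normed_vector) \<Rightarrow> ('a \<Rightarrow> 'b) \<Rightarrow> bool" where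
  "L2_tendsto M s f \<longleftrightarrow> (\<forall>n. square_integrable M (\<lambda>x. s n x - f x)) \<and>
     (\<lambda>n. \<integral>x. (norm (s n x - f x))\<^sup>2 \<partial>M) \<longlonglongrightarrow> 0"

definition gradient :: "(real^'d \<Rightarrow> real) \<Rightarrow> real^'d \<Rightarrow> real^'d" where
  "gradient f x = (\<chi> i. frechet_derivative f (at x) (axis i 1))"

primrec Ck :: "nat \<Rightarrow> (real^'d \<Rightarrow> real) \<Rightarrow> bool" where
  "Ck 0 f \<longleftrightarrow> continuous_on UNIV f"
| "Ck (Suc k) f \<longleftrightarrow> (\<forall>x. f differentiable (at x)) \<and> (\<forall>i. Ck k (\<lambda>x. gradient f x $ i))"

definition smooth :: "(real^'d \<Rightarrow> real) \<Rightarrow> bool" where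
  "smooth f \<longleftrightarrow> (\<forall>k. Ck k f)"

definition test_function :: "(real^'d) set \<Rightarrow> (real^'d \<Rightarrow> real) \<Rightarrow> bool" where
  "test_function \<Omega> \<phi> \<longleftrightarrow> smooth \<phi> \<and> (\<exists>C. compact C \<and> C \<subseteq> \<Omega> \<and> (\<forall>x. x \<notin> C \<longrightarrow> \<phi> x = 0))"

definition locally_integrable :: "(real^'d) set \<Rightarrow> (real^'d \<Rightarrow> 'b::euclidean_space) \<Rightarrow> bool" where
  "locally_integrable \<Omega> f \<longleftrightarrow> (\<forall>C. compact C \<and> C \<subseteq> \<Omega> \<longrightarrow> integrable (lebesgue_on C) f)"

definition is_weak_gradient ::
    "(real^'d) set \<Rightarrow> (real^'d \<Rightarrow> real) \<Rightarrow> (real^'d \<Rightarrow> real^'d) \<Rightarrow> bool" where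
  "is_weak_gradient \<Omega> v g \<longleftrightarrow> locally_integrable \<Omega> v \<and> locally_integrable \<Omega> g \<and>
     (\<forall>\<phi>. test_function \<Omega> \<phi> \<longrightarrow>
        (\<integral>x. v x *\<^sub>R gradient \<phi> x \<partial>lebesgue_on \<Omega>) = - (\<integral>x. \<phi> x *\<^sub>R g x \<partial>lebesgue_on \<Omega>))"

definition is_weak_divergence ::
    "(real^'d) set \<Rightarrow> (real^'d \<Rightarrow> real^'d) \<Rightarrow> (real^'d \<Rightarrow> real) \<Rightarrow> bool" where
  "is_weak_divergence \<Omega> w g \<longleftrightarrow> locally_integrable \<Omega> w \<and> locally_integrable \<Omega> g \<and>
     (\<forall>\<phi>. test_function \<Omega> \<phi> \<longrightarrow>
        (\<integral>x. w x \<bullet> gradient \<phi> x \<partial>lebesgue_on \<Omega>) = - (\<integral>x. \<phi> x * g x \<partial>lebesgue_on \<Omega>))"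

text \<open>On an open set, weak gradients and divergences are unique up to null sets.\<close>

definition weak_gradient :: "(real^'d) set \<Rightarrow> (real^'d \<Rightarrow> real) \<Rightarrow> real^'d \<Rightarrow> real^'d" where
  "weak_gradient \<Omega> v = (SOME g. is_weak_gradient \<Omega> v g)"

definition weak_divergence :: "(real^'d) set \<Rightarrow> (real^'d \<Rightarrow> real^'d) \<Rightarrow> real^'d \<Rightarrow> real" where
  "weak_divergence \<Omega> w = (SOME g. is_weak_divergence \<Omega> w g)"

definition H1 :: "(real^'d) set \<Rightarrow> (real^'d \<Rightarrow> real) set" where
  "H1 \<Omega> = {v. square_integrable (lebesgue_on \<Omega>) v \<and>
              (\<exists>g. is_weak_gradient \<Omega> v g \<and> square_integrable (lebesgue_on \<Omega>) g)}"

definition W1inf :: "(real^'d) set \<Rightarrow> (real^'d \<Rightarrow> real) set" where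
  "W1inf \<Omega> = {v. ess_bounded (lebesgue_on \<Omega>) v \<and>
                (\<exists>g. is_weak_gradient \<Omega> v g \<and> ess_bounded (lebesgue_on \<Omega>) g)}"

text \<open>The closure of the test functions with respect to the \<open>H\<^sup>1\<close> norm.\<close>

definition H10 :: "(real^'d) set \<Rightarrow> (real^'d \<Rightarrow> real) set" where
  "H10 \<Omega> = {v \<in> H1 \<Omega>. \<exists>\<phi>. (\<forall>n. test_function \<Omega> (\<phi> n)) \<and>
              L2_tendsto (lebesgue_on \<Omega>) \<phi> v \<and>
              L2_tendsto (lebesgue_on \<Omega>) (\<lambda>n. gradient (\<phi> n)) (weak_gradient \<Omega> v)}"

section \<open>Model problem\<close>

text \<open>
  Near each boundary point the domain is the strict epigraph, in direction \<open>e\<close>, of a Lipschitz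
  function of the component orthogonal to \<open>e\<close>.
\<close>

definition lipschitz_domain :: "(real^'d) set \<Rightarrow> bool" where
  "lipschitz_domain \<Omega> \<longleftrightarrow> open \<Omega> \<and> connected \<Omega> \<and> bounded \<Omega> \<and> \<Omega> \<noteq> {} \<and>
     (\<forall>x \<in> frontier \<Omega>. \<exists>r>0. \<exists>e L. \<exists>h :: real^'d \<Rightarrow> real. norm e = 1 \<and> L-lipschitz_on UNIV h \<and>
        (\<forall>y \<in> ball x r. y \<in> \<Omega> \<longleftrightarrow> h (y - (y \<bullet> e) *\<^sub>R e) < y \<bullet> e))"

definition polyhedral :: "(real^'d) set \<Rightarrow> bool" where
  "polyhedral \<Omega> \<longleftrightarrow> (\<exists>\<P>. finite \<P> \<and> (\<forall>P \<in> \<P>. polytope P) \<and> closure \<Omega> = \<Union>\<P>)"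

record ('d::finite) pde =
  dom :: "(real^'d) set"
  diffusion :: "real^'d \<Rightarrow> real^'d^'d"
  convection :: "real^'d \<Rightarrow> real^'d"
  reaction :: "real^'d \<Rightarrow> real"
  source :: "real^'d \<Rightarrow> real"
  flux_source :: "real^'d \<Rightarrow> real^'d"

definition model_problem :: "'d::finite pde \<Rightarrow> bool" where
  "model_problem D \<longleftrightarrow>
     lipschitz_domain (dom D) \<and> polyhedral (dom D) \<and>
     square_integrable (lebesgue_on (dom D)) (source D) \<and>
     square_integrable (lebesgue_on (dom D)) (flux_source D) \<and>
     ess_bounded (lebesgue_on (dom D)) (convection D) \<and>
     ess_bounded (lebesgue_on (dom D)) (reaction D) \<and>
     (\<exists>g. is_weak_divergence (dom D) (convection D) g \<and> ess_bounded (lebesgue_on (dom D)) g \<and>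
        (AE x in lebesgue_on (dom D). - g x + 2 * reaction D x \<ge> 0)) \<and>
     ess_bounded (lebesgue_on (dom D)) (diffusion D) \<and>
     (AE x in lebesgue_on (dom D). transpose (diffusion D x) = diffusion D x) \<and>
     (\<exists>\<kappa>>0. AE x in lebesgue_on (dom D).
        \<forall>\<mu> z. z \<noteq> 0 \<and> diffusion D x *v z = \<mu> *\<^sub>R z \<longrightarrow> \<kappa> \<le> \<mu>)"

definition grad :: "'d::finite pde \<Rightarrow> (real^'d \<Rightarrow> real) \<Rightarrow> real^'d \<Rightarrow> real^'d" where
  "grad D v = weak_gradient (dom D) v"

definition aform :: "'d::finite pde \<Rightarrow> (real^'d \<Rightarrow> real) \<Rightarrow> (real^'d \<Rightarrow> real) \<Rightarrow> real" where
  "aform D v w = (\<integral>x. (diffusion D x *v grad D v x) \<bullet> grad D w x \<partial>lebesgue_on (dom D))"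

definition bform :: "'d::finite pde \<Rightarrow> (real^'d \<Rightarrow> real) \<Rightarrow> (real^'d \<Rightarrow> real) \<Rightarrow> real" where
  "bform D v w = aform D v w
     + (\<integral>x. (convection D x \<bullet> grad D v x) * w x \<partial>lebesgue_on (dom D))
     + (\<integral>x. reaction D x * v x * w x \<partial>lebesgue_on (dom D))"

definition rhs :: "'d::finite pde \<Rightarrow> (real^'d \<Rightarrow> real) \<Rightarrow> real" where
  "rhs D v = (\<integral>x. source D x * v x \<partial>lebesgue_on (dom D))
     + (\<integral>x. flux_source D x \<bullet> grad D v x \<partial>lebesgue_on (dom D))"

definition energy_norm :: "'d::finite pde \<Rightarrow> (real^'d \<Rightarrow> real) \<Rightarrow> real" where
  "energy_norm D v = sqrt (aform D v v)"

definition energy_dist :: "'d::finite pde \<Rightarrow> (real^'d \<Rightarrow> real) \<Rightarrow> (real^'d \<Rightarrow> real) \<Rightarrow> real" where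
  "energy_dist D v w = energy_norm D (\<lambda>x. v x - w x)"

section \<open>Newest vertex bisection\<close>

text \<open>
  Bisection of tagged simplices in arbitrary dimension, following Maubach and Stevenson: an element
  \<open>([z\<^sub>0, \<dots>, z\<^sub>d], \<gamma>)\<close> consists of its ordered vertices and a type \<open>\<gamma> < d\<close>; its
  refinement edge joins the first and the last vertex.
\<close>

type_synonym 'd tsimplex = "(real^'d) list \<times> nat"
type_synonym 'd mesh = "'d tsimplex set"

definition elem :: "'d::finite tsimplex \<Rightarrow> (real^'d) set" where
  "elem T = convex hull (set (fst T))"

definition is_tsimplex :: "'d::finite tsimplex \<Rightarrow> bool" where
  "is_tsimplex T \<longleftrightarrow> length (fst T) = CARD('d) + 1 \<and> distinct (fst T) \<and>
     \<not> affine_dependent (set (fst T)) \<and> snd T < CARD('d)"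

definition inner_front :: "'d::finite tsimplex \<Rightarrow> (real^'d) list" where
  "inner_front T = take (snd T) (butlast (tl (fst T)))"

definition inner_back :: "'d::finite tsimplex \<Rightarrow> (real^'d) list" where
  "inner_back T = drop (snd T) (butlast (tl (fst T)))"

definition children :: "'d::finite tsimplex \<Rightarrow> 'd mesh" where
  "children T =
     (let a = hd (fst T); z = last (fst T); m = midpoint a z; \<gamma> = Suc (snd T) mod CARD('d)
      in {(a # m # inner_front T @ inner_back T, \<gamma>),
          (z # m # inner_front T @ rev (inner_back T), \<gamma>)})"

definition reflected :: "'d::finite tsimplex \<Rightarrow> 'd tsimplex" where
  "reflected T =
     (last (fst T) # inner_front T @ rev (inner_back T) @ [hd (fst T)], snd T)"

definition neighbours :: "'d::finite tsimplex \<Rightarrow> 'd tsimplex \<Rightarrow> bool" where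
  "neighbours T T' \<longleftrightarrow> T \<noteq> T' \<and> (elem T \<inter> elem T') facet_of elem T
     \<and> (elem T \<inter> elem T') facet_of elem T'"

definition differ_in_one :: "'d::finite tsimplex \<Rightarrow> 'd tsimplex \<Rightarrow> bool" where
  "differ_in_one T T' \<longleftrightarrow> length (fst T) = length (fst T') \<and>
     card {i. i < length (fst T) \<and> fst T ! i \<noteq> fst T' ! i} = 1"

definition reflected_neighbours :: "'d::finite tsimplex \<Rightarrow> 'd tsimplex \<Rightarrow> bool" where
  "reflected_neighbours T T' \<longleftrightarrow> neighbours T T' \<and> snd T = snd T' \<and>
     (differ_in_one T T' \<or> differ_in_one (reflected T) T')"

definition ref_edge :: "'d::finite tsimplex \<Rightarrow> (real^'d) set" where
  "ref_edge T = closed_segment (hd (fst T)) (last (fst T))"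

definition matching :: "'d::finite mesh \<Rightarrow> bool" where
  "matching \<T> \<longleftrightarrow>
     (\<forall>T \<in> \<T>. \<forall>T' \<in> \<T>. snd T = snd T') \<and>
     (\<forall>T \<in> \<T>. \<forall>T' \<in> \<T>. neighbours T T' \<longrightarrow>
        (if ref_edge T \<subseteq> elem T \<inter> elem T' \<or> ref_edge T' \<subseteq> elem T \<inter> elem T'
         then reflected_neighbours T T'
         else \<forall>C \<in> children T. \<forall>C' \<in> children T'. neighbours C C' \<longrightarrow> reflected_neighbours C C'))"

definition conforming :: "'d::finite mesh \<Rightarrow> bool" where
  "conforming \<T> \<longleftrightarrow> finite \<T> \<and> (\<forall>T \<in> \<T>. is_tsimplex T) \<and> inj_on elem \<T> \<and> triangulation (elem ` \<T>)"

text \<open>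
  The matching condition on the initial mesh is needed for newest vertex bisection only from
  dimension three on; in lower dimensions every conforming initial mesh is admissible.
\<close>

definition initial_triangulation :: "(real^'d::finite) set \<Rightarrow> 'd mesh \<Rightarrow> bool" where
  "initial_triangulation \<Omega> \<T> \<longleftrightarrow> conforming \<T> \<and> (\<Union>T \<in> \<T>. elem T) = closure \<Omega> \<and>
     (3 \<le> CARD('d) \<longrightarrow> matching \<T>)"

definition bisection_step :: "'d::finite mesh \<Rightarrow> 'd mesh \<Rightarrow> bool" where
  "bisection_step \<T> \<T>' \<longleftrightarrow> (\<exists>T \<in> \<T>. \<T>' = (\<T> - {T}) \<union> children T)"

definition refinements :: "'d::finite mesh \<Rightarrow> 'd mesh set" where
  "refinements \<T> = {\<T>'. bisection_step\<^sup>*\<^sup>* \<T> \<T>' \<and> conforming \<T>'}"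

definition is_refine :: "'d::finite mesh \<Rightarrow> 'd mesh \<Rightarrow> 'd mesh \<Rightarrow> bool" where
  "is_refine \<T> \<M> \<T>' \<longleftrightarrow> \<T>' \<in> refinements \<T> \<and> \<M> \<inter> \<T>' = {} \<and>
     (\<forall>\<T>'' \<in> refinements \<T>. \<M> \<inter> \<T>'' = {} \<longrightarrow> \<T>'' \<in> refinements \<T>')"

section \<open>Discrete spaces and error estimator\<close>

definition polynomial_deg_le :: "nat \<Rightarrow> (real^'d::finite \<Rightarrow> real) \<Rightarrow> bool" where
  "polynomial_deg_le p q \<longleftrightarrow> (\<exists>c :: ('d \<Rightarrow> nat) \<Rightarrow> real. \<forall>x.
     q x = (\<Sum>\<alpha> | sum \<alpha> UNIV \<le> p. c \<alpha> * (\<Prod>i\<in>UNIV. (x $ i) ^ \<alpha> i)))"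

text \<open>
  Discrete functions are extended by zero outside the domain, so that equality of discrete functions
  is equality of functions.
\<close>

definition fe_space :: "'d::finite pde \<Rightarrow> nat \<Rightarrow> 'd mesh \<Rightarrow> (real^'d \<Rightarrow> real) set" where
  "fe_space D p \<T> = {v \<in> H10 (dom D). continuous_on (closure (dom D)) v \<and>
     (\<forall>x. x \<notin> dom D \<longrightarrow> v x = 0) \<and>
     (\<forall>T \<in> \<T>. \<exists>q. polynomial_deg_le p q \<and> (\<forall>x \<in> elem T. v x = q x))}"

definition galerkin :: "'d::finite pde \<Rightarrow> nat \<Rightarrow> 'd mesh \<Rightarrow> real^'d \<Rightarrow> real" where
  "galerkin D p \<T> = (THE u. u \<in> fe_space D p \<T> \<and> (\<forall>v \<in> fe_space D p \<T>. bform D u v = rhs D v))"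

definition data_regular :: "'d::finite pde \<Rightarrow> 'd mesh \<Rightarrow> bool" where
  "data_regular D \<T> \<longleftrightarrow> (\<forall>T \<in> \<T>.
     (\<forall>i. (\<lambda>x. flux_source D x $ i) \<in> H1 (interior (elem T))) \<and>
     (\<forall>i j. (\<lambda>x. diffusion D x $ i $ j) \<in> W1inf (interior (elem T))))"

definition outer_normal :: "(real^'d) set \<Rightarrow> (real^'d) set \<Rightarrow> real^'d" where
  "outer_normal S F = (THE n. norm n = 1 \<and> (\<forall>x \<in> F. \<forall>y \<in> F. (y - x) \<bullet> n = 0) \<and>
                              (\<forall>x \<in> F. \<forall>y \<in> S. (y - x) \<bullet> n \<le> 0))"

text \<open>
  Surface measure on a facet \<open>F\<close> with unit normal \<open>n\<close>: the surface measure of a subset of \<open>F\<close> is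
  the volume of the prism of height one over it, hence it is the image of the volume under the
  orthogonal projection of the prism onto the hyperplane of \<open>F\<close>.  In dimension one it is the unit
  point mass.
\<close>

definition facet_measure :: "(real^'d) set \<Rightarrow> real^'d \<Rightarrow> (real^'d) measure" where
  "facet_measure F n =
     distr (restrict_space lborel {x + t *\<^sub>R n | x t. x \<in> F \<and> 0 \<le> t \<and> t \<le> 1}) borel
       (\<lambda>y. y - ((y - (SOME a. a \<in> F)) \<bullet> n) *\<^sub>R n)"

text \<open>
  The trace on a facet \<open>F\<close> of \<open>S\<close> of a function in \<open>H\<^sup>1\<close> of the interior of the simplex \<open>S\<close>:
  the \<open>L\<^sup>2(F)\<close>-limit of the restrictions of smooth functions converging in \<open>H\<^sup>1\<close>.
\<close>

definition is_trace ::
    "(real^'d) set \<Rightarrow> (real^'d) set \<Rightarrow> (real^'d \<Rightarrow> real) \<Rightarrow> (real^'d \<Rightarrow> real) \<Rightarrow> bool" where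
  "is_trace S F w g \<longleftrightarrow> (\<exists>\<phi>. (\<forall>n. smooth (\<phi> n)) \<and>
     L2_tendsto (lebesgue_on (interior S)) \<phi> w \<and>
     L2_tendsto (lebesgue_on (interior S)) (\<lambda>n. gradient (\<phi> n)) (weak_gradient (interior S) w) \<and>
     L2_tendsto (facet_measure F (outer_normal S F)) \<phi> g)"

definition trace ::
    "(real^'d) set \<Rightarrow> (real^'d) set \<Rightarrow> (real^'d \<Rightarrow> real) \<Rightarrow> real^'d \<Rightarrow> real" where
  "trace S F w = (SOME g. is_trace S F w g)"

definition normal_trace ::
    "(real^'d) set \<Rightarrow> (real^'d) set \<Rightarrow> (real^'d \<Rightarrow> real^'d) \<Rightarrow> real^'d \<Rightarrow> real" where
  "normal_trace S F w x = (\<chi> i. trace S F (\<lambda>y. w y $ i) x) \<bullet> outer_normal S F"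

definition flux :: "'d::finite pde \<Rightarrow> (real^'d \<Rightarrow> real) \<Rightarrow> real^'d \<Rightarrow> real^'d" where
  "flux D v x = diffusion D x *v grad D v x - flux_source D x"

definition residual :: "'d::finite pde \<Rightarrow> (real^'d) set \<Rightarrow> (real^'d \<Rightarrow> real) \<Rightarrow> real^'d \<Rightarrow> real" where
  "residual D S v x = weak_divergence (interior S) (flux D v) x
     - convection D x \<bullet> grad D v x - reaction D x * v x + source D x"

text \<open>The outer normals of the two elements are opposite, so the sum of normal traces is the jump.\<close>

definition jump_sq ::
    "'d::finite pde \<Rightarrow> 'd tsimplex \<Rightarrow> 'd tsimplex \<Rightarrow> (real^'d \<Rightarrow> real) \<Rightarrow> real" where
  "jump_sq D T T' v =
     (let F = elem T \<inter> elem T'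
      in LINT x : F \<inter> dom D | facet_measure F (outer_normal (elem T) F).
           (normal_trace (elem T) F (flux D v) x + normal_trace (elem T') F (flux D v) x)\<^sup>2)"

definition eta_sq :: "'d::finite pde \<Rightarrow> 'd mesh \<Rightarrow> 'd tsimplex \<Rightarrow> (real^'d \<Rightarrow> real) \<Rightarrow> real" where
  "eta_sq D \<T> T v =
     measure lebesgue (elem T) powr (2 / real CARD('d)) *
       (\<integral>x. (residual D (elem T) v x)\<^sup>2 \<partial>lebesgue_on (elem T)) +
     measure lebesgue (elem T) powr (1 / real CARD('d)) *
       (\<Sum>T' | T' \<in> \<T> \<and> neighbours T T'. jump_sq D T T' v)"

definition eta :: "'d::finite pde \<Rightarrow> 'd mesh \<Rightarrow> 'd mesh \<Rightarrow> (real^'d \<Rightarrow> real) \<Rightarrow> real" where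
  "eta D \<T> \<U> v = sqrt (\<Sum>T\<in>\<U>. eta_sq D \<T> T v)"

definition stability :: "'d::finite pde \<Rightarrow> nat \<Rightarrow> 'd mesh \<Rightarrow> real \<Rightarrow> bool" where
  "stability D p \<T>\<^sub>0 Cstab \<longleftrightarrow>
     (\<forall>\<T>\<^sub>H \<in> refinements \<T>\<^sub>0. \<forall>\<T>\<^sub>h \<in> refinements \<T>\<^sub>H.
        \<forall>v\<^sub>H \<in> fe_space D p \<T>\<^sub>H. \<forall>v\<^sub>h \<in> fe_space D p \<T>\<^sub>h.
        \<bar>eta D \<T>\<^sub>h (\<T>\<^sub>h \<inter> \<T>\<^sub>H) v\<^sub>h - eta D \<T>\<^sub>H (\<T>\<^sub>h \<inter> \<T>\<^sub>H) v\<^sub>H\<bar> \<le> Cstab * energy_dist D v\<^sub>h v\<^sub>H)"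

definition reduction :: "'d::finite pde \<Rightarrow> nat \<Rightarrow> 'd mesh \<Rightarrow> real \<Rightarrow> bool" where
  "reduction D p \<T>\<^sub>0 qred \<longleftrightarrow>
     (\<forall>\<T>\<^sub>H \<in> refinements \<T>\<^sub>0. \<forall>\<T>\<^sub>h \<in> refinements \<T>\<^sub>H. \<forall>v\<^sub>H \<in> fe_space D p \<T>\<^sub>H.
        eta D \<T>\<^sub>h (\<T>\<^sub>h - \<T>\<^sub>H) v\<^sub>H \<le> qred * eta D \<T>\<^sub>H (\<T>\<^sub>H - \<T>\<^sub>h) v\<^sub>H)"

definition reliability ::
    "'d::finite pde \<Rightarrow> nat \<Rightarrow> 'd mesh \<Rightarrow> (real^'d \<Rightarrow> real) \<Rightarrow> real \<Rightarrow> bool" where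
  "reliability D p \<T>\<^sub>0 u Crel \<longleftrightarrow>
     (\<forall>\<T>\<^sub>H \<in> refinements \<T>\<^sub>0.
        energy_dist D u (galerkin D p \<T>\<^sub>H) \<le> Crel * eta D \<T>\<^sub>H \<T>\<^sub>H (galerkin D p \<T>\<^sub>H))"

section \<open>Preconditioned GMRES\<close>

definition lincomb_fun :: "(nat \<Rightarrow> 'a \<Rightarrow> real) \<Rightarrow> real Matrix.vec \<Rightarrow> 'a \<Rightarrow> real" where
  "lincomb_fun \<phi> x = (\<lambda>z. \<Sum>j<dim_vec x. vec_index x j * \<phi> j z)"

definition is_basis :: "nat \<Rightarrow> (nat \<Rightarrow> 'a \<Rightarrow> real) \<Rightarrow> ('a \<Rightarrow> real) set \<Rightarrow> bool" where
  "is_basis N \<phi> X \<longleftrightarrow> (\<forall>j<N. \<phi> j \<in> X) \<and>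
     (\<forall>v \<in> X. \<exists>x \<in> carrier_vec N. v = lincomb_fun \<phi> x) \<and>
     (\<forall>x \<in> carrier_vec N. lincomb_fun \<phi> x = (\<lambda>_. 0) \<longrightarrow> x = 0\<^sub>v N)"

definition galerkin_mat :: "'d::finite pde \<Rightarrow> nat \<Rightarrow> (nat \<Rightarrow> real^'d \<Rightarrow> real) \<Rightarrow> real Matrix.mat" where
  "galerkin_mat D N \<phi> = Matrix.mat N N (\<lambda>(j, k). bform D (\<phi> k) (\<phi> j))"

definition galerkin_rhs :: "'d::finite pde \<Rightarrow> nat \<Rightarrow> (nat \<Rightarrow> real^'d \<Rightarrow> real) \<Rightarrow> real Matrix.vec" where
  "galerkin_rhs D N \<phi> = Matrix.vec N (\<lambda>j. rhs D (\<phi> j))"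

definition spd :: "nat \<Rightarrow> real Matrix.mat \<Rightarrow> bool" where
  "spd N P \<longleftrightarrow> P \<in> carrier_mat N N \<and> transpose_mat P = P \<and>
     (\<forall>x \<in> carrier_vec N. x \<noteq> 0\<^sub>v N \<longrightarrow> 0 < scalar_prod (P *\<^sub>v x) x)"

definition pinv_norm :: "real Matrix.mat \<Rightarrow> real Matrix.vec \<Rightarrow> real" where
  "pinv_norm P x = sqrt (scalar_prod (the (mat_inverse P) *\<^sub>v x) x)"

definition prec_residual ::
    "real Matrix.mat \<Rightarrow> real Matrix.mat \<Rightarrow> real Matrix.vec \<Rightarrow> real Matrix.vec \<Rightarrow> real Matrix.vec" where
  "prec_residual P B d x = P *\<^sub>v (d - B *\<^sub>v x)"

definition krylov :: "nat \<Rightarrow> real Matrix.mat \<Rightarrow> real Matrix.vec \<Rightarrow> nat \<Rightarrow> real Matrix.vec set" where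
  "krylov N A s K =
     LinearCombinations.module.span class_ring (module_vec TYPE(real) N)
       {(A ^\<^sub>m i) *\<^sub>v s | i. i < K}"

text \<open>\<open>x k\<close> is the \<open>k\<close>-th iterate, for \<open>k \<ge> 1\<close>, of restarted preconditioned GMRES.\<close>

definition pgmres_iterate ::
    "nat \<Rightarrow> nat \<Rightarrow> real Matrix.mat \<Rightarrow> real Matrix.mat \<Rightarrow> real Matrix.vec
      \<Rightarrow> (nat \<Rightarrow> real Matrix.vec) \<Rightarrow> nat \<Rightarrow> bool" where
  "pgmres_iterate kmax N P B d x k \<longleftrightarrow>
     (let K = ((k - 1) mod kmax) + 1; m = k - K
      in is_arg_min (\<lambda>y. pinv_norm P (prec_residual P B d y))
           (\<lambda>y. \<exists>z \<in> krylov N (P * B) (prec_residual P B d (x m)) K. y = x m + z) (x k))"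

section \<open>Adaptive algorithm\<close>

text \<open>
  The data produced by a run of the algorithm; only the values on levels and indices that are
  actually reached are meaningful.
\<close>

record ('d::finite) run =
  mesh :: "nat \<Rightarrow> 'd mesh"
  marked :: "nat \<Rightarrow> 'd mesh"
  ndof :: "nat \<Rightarrow> nat"
  basis :: "nat \<Rightarrow> nat \<Rightarrow> real^'d \<Rightarrow> real"
  precond :: "nat \<Rightarrow> real Matrix.mat"
  coeffs :: "nat \<Rightarrow> nat \<Rightarrow> real Matrix.vec"

definition iterate :: "'d::finite run \<Rightarrow> nat \<Rightarrow> nat \<Rightarrow> real^'d \<Rightarrow> real" where
  "iterate R l k = lincomb_fun (basis R l) (coeffs R l k)"

definition sys_mat :: "'d::finite pde \<Rightarrow> 'd run \<Rightarrow> nat \<Rightarrow> real Matrix.mat" where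
  "sys_mat D R l = galerkin_mat D (ndof R l) (basis R l)"

definition sys_rhs :: "'d::finite pde \<Rightarrow> 'd run \<Rightarrow> nat \<Rightarrow> real Matrix.vec" where
  "sys_rhs D R l = galerkin_rhs D (ndof R l) (basis R l)"

definition res_norm :: "'d::finite pde \<Rightarrow> 'd run \<Rightarrow> nat \<Rightarrow> nat \<Rightarrow> real" where
  "res_norm D R l k = pinv_norm (precond R l)
     (prec_residual (precond R l) (sys_mat D R l) (sys_rhs D R l) (coeffs R l k))"

definition eta_it :: "'d::finite pde \<Rightarrow> 'd run \<Rightarrow> nat \<Rightarrow> nat \<Rightarrow> real" where
  "eta_it D R l k = eta D (mesh R l) (mesh R l) (iterate R l k)"

definition quasi_error :: "'d::finite pde \<Rightarrow> 'd run \<Rightarrow> nat \<Rightarrow> nat \<Rightarrow> real" where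
  "quasi_error D R l k = eta_it D R l k + res_norm D R l k"

definition stop_index :: "'d::finite pde \<Rightarrow> 'd run \<Rightarrow> real \<Rightarrow> nat \<Rightarrow> enat" where
  "stop_index D R lam l = Inf (enat ` {k. 1 \<le> k \<and> res_norm D R l k \<le> lam * eta_it D R l k})"

text \<open>
  The values of \<open>C\<^sub>a\<^sub>l\<^sub>g\<close>, \<open>\<lambda>\<^sub>a\<^sub>l\<^sub>g\<close> and \<open>S\<close> at the beginning of level \<open>l\<close>, given their initial
  values.  The sum \<open>S\<close> is extended-valued because of the convention \<open>1 / 0 = \<infinity>\<close>, which holds for
  \<open>inverse\<close> on the extended nonnegative reals.
\<close>

primrec alg_state ::
    "'d::finite pde \<Rightarrow> 'd run \<Rightarrow> real \<Rightarrow> real \<Rightarrow> nat \<Rightarrow> real \<times> real \<times> ennreal" where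
  "alg_state D R C0 lam0 0 = (C0, lam0, 0)"
| "alg_state D R C0 lam0 (Suc l) =
     (let (C, lam, S) = alg_state D R C0 lam0 l;
          h = inverse (ennreal (quasi_error D R l (the_enat (stop_index D R lam l))))
      in if 1 \<le> l \<and> S > ennreal C * h then (2 * C, lam / 2, S + h) else (C, lam, S + h))"

definition k_stop :: "'d::finite pde \<Rightarrow> 'd run \<Rightarrow> real \<Rightarrow> real \<Rightarrow> nat \<Rightarrow> enat" where
  "k_stop D R C0 lam0 l = stop_index D R (fst (snd (alg_state D R C0 lam0 l))) l"

primrec reached :: "'d::finite pde \<Rightarrow> 'd run \<Rightarrow> real \<Rightarrow> real \<Rightarrow> real \<Rightarrow> nat \<Rightarrow> bool" where
  "reached D R C0 lam0 tau 0 \<longleftrightarrow> True"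
| "reached D R C0 lam0 tau (Suc l) \<longleftrightarrow> reached D R C0 lam0 tau l \<and>
     k_stop D R C0 lam0 l \<noteq> \<infinity> \<and> \<not> quasi_error D R l (the_enat (k_stop D R C0 lam0 l)) \<le> tau"

definition index_set :: "'d::finite pde \<Rightarrow> 'd run \<Rightarrow> real \<Rightarrow> real \<Rightarrow> real \<Rightarrow> (nat \<times> nat) set" where
  "index_set D R C0 lam0 tau =
     {(l, k). reached D R C0 lam0 tau l \<and> enat k \<le> k_stop D R C0 lam0 l}"

definition step_count :: "(nat \<times> nat) set \<Rightarrow> nat \<times> nat \<Rightarrow> nat" where
  "step_count Q q = card {q' \<in> Q. fst q' < fst q \<or> fst q' = fst q \<and> snd q' \<le> snd q}"

definition doerfler_sets ::
    "'d::finite pde \<Rightarrow> 'd mesh \<Rightarrow> real \<Rightarrow> (real^'d \<Rightarrow> real) \<Rightarrow> 'd mesh set" where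
  "doerfler_sets D \<T> \<theta> v = {\<U>. \<U> \<subseteq> \<T> \<and> \<theta> * (eta D \<T> \<T> v)\<^sup>2 \<le> (eta D \<T> \<U> v)\<^sup>2}"

definition afem_pgmres ::
    "'d::finite pde \<Rightarrow> nat \<Rightarrow> 'd mesh \<Rightarrow> real \<Rightarrow> real \<Rightarrow> (real^'d \<Rightarrow> real) \<Rightarrow> real \<Rightarrow> real
      \<Rightarrow> nat \<Rightarrow> real \<Rightarrow> 'd run \<Rightarrow> bool" where
  "afem_pgmres D p \<T>\<^sub>0 \<theta> Cmark u\<^sub>0\<^sub>0 C0 lam0 kmax tau R \<longleftrightarrow>
     mesh R 0 = \<T>\<^sub>0 \<and> iterate R 0 0 = u\<^sub>0\<^sub>0 \<and>
     (\<forall>l. reached D R C0 lam0 tau l \<longrightarrow>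
        is_basis (ndof R l) (basis R l) (fe_space D p (mesh R l)) \<and>
        spd (ndof R l) (precond R l)) \<and>
     (\<forall>(l, k) \<in> index_set D R C0 lam0 tau.
        coeffs R l k \<in> carrier_vec (ndof R l) \<and>
        (1 \<le> k \<longrightarrow> pgmres_iterate kmax (ndof R l) (precond R l) (sys_mat D R l) (sys_rhs D R l)
                     (coeffs R l) k)) \<and>
     (\<forall>l. reached D R C0 lam0 tau (Suc l) \<longrightarrow>
        (let u = iterate R l (the_enat (k_stop D R C0 lam0 l));
             \<D> = doerfler_sets D (mesh R l) \<theta> u
         in marked R l \<in> \<D> \<and>
            real (card (marked R l)) \<le> Cmark * real (Min (card ` \<D>)) \<and>
            is_refine (mesh R l) (marked R l) (mesh R (Suc l)) \<and>
            iterate R (Suc l) 0 = u))"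

definition norm_equivalence :: "'d::finite pde \<Rightarrow> 'd run \<Rightarrow> nat \<Rightarrow> real \<Rightarrow> bool" where
  "norm_equivalence D R l Cpre \<longleftrightarrow> (\<forall>x \<in> carrier_vec (ndof R l).
     let v = lincomb_fun (basis R l) x
     in inverse Cpre * energy_norm D v \<le> pinv_norm (precond R l) x \<and>
        pinv_norm (precond R l) x \<le> Cpre * energy_norm D v)"

end

theory Submission
  imports Defs
begin

text \<open>
  Let \<open>H\<close> be the sum of estimator and preconditioned residual at the end of a level.  It bounds all
  error quantities, and the residual does not increase within a level, so it suffices that \<open>H\<close> tends
  to zero along the levels.

  If some level never stops, the residual contracts there and dominates the estimator.  Otherwise
  there are two cases.  If the parameter \<open>\<lambda>\<close> is halved infinitely often, then the algebraic error is
  eventually negligible compared to the estimator, and \<open>H\<close> is controlled by a perturbed contraction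
  whose perturbation, the increments of the Galerkin solutions, tends to zero.  If \<open>\<lambda>\<close> is eventually
  constant, the test of the algorithm bounds the sum of all previous reciprocals \<open>1/H\<close> by a multiple
  of the current one, so these sums diverge and \<open>H\<close> tends to zero.
\<close>

section \<open>Test functions\<close>

text \<open>The obstacle is that \<theta> and the initial \<lambda> are arbitrary: marking sees
  inexact iterates, and for a fixed \<lambda> the algebraic error may destroy the estimator
  contraction that marking provides. Only a vanishing \<lambda> makes this error absorbable; once
  \<lambda> is frozen, the information comes from the failing update test instead, and the argument
  is purely about the real sequence H.

  Convergence for |l,k| tending to infinity is reduced to a finiteness statement: for each
  \<epsilon> > 0 only finitely many indices have a quasi-error of at least \<epsilon>. This form
  covers both a last level with infinitely many steps and infinitely many finite levels. The passage
  from level ends to all steps rests on nested iteration: a level starts from the last iterate of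
  the previous one, so its initial residual is bounded by two consecutive values of H.

  The analytic groundwork is forced by \<open>weak_gradient\<close>, an arbitrary choice: linearity
  of the forms comes from identities that hold almost everywhere, hence from uniqueness of weak
  gradients and the fundamental lemma of the calculus of variations.\<close>

lemma frechet_derivative_eqI:
  "(f has_derivative f') (at x) \<Longrightarrow> frechet_derivative f (at x) = f'"
  using frechet_derivative_at by force

lemma gradient_nth: "gradient f x $ i = frechet_derivative f (at x) (axis i 1)"
  by (simp add: gradient_def)

lemma gradient_nthI: "(f has_derivative f') (at x) \<Longrightarrow> gradient f x $ i = f' (axis i 1)"
  by (simp add: gradient_nth frechet_derivative_eqI)

lemma gradient_add:
  assumes "f differentiable (at x)" "g differentiable (at x)"
  shows "gradient (\<lambda>x. f x + g x) x = gradient f x + gradient g x"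
proof -
  have "gradient (\<lambda>x. f x + g x) x $ i = (gradient f x + gradient g x) $ i" for i
    using assms by (subst gradient_nthI[OF has_derivative_add])
      (auto simp: frechet_derivative_works gradient_nth)
  thus ?thesis by (simp add: Finite_Cartesian_Product.vec_eq_iff)
qed

lemma gradient_mult:
  assumes "f differentiable (at x)" "g differentiable (at x)"
  shows "gradient (\<lambda>x. f x * g x) x = f x *\<^sub>R gradient g x + g x *\<^sub>R gradient f x"
proof -
  have "gradient (\<lambda>x. f x * g x) x $ i = (f x *\<^sub>R gradient g x + g x *\<^sub>R gradient f x) $ i" for i
    using assms by (subst gradient_nthI[OF has_derivative_mult])
      (auto simp: frechet_derivative_works gradient_nth)
  thus ?thesis by (simp add: Finite_Cartesian_Product.vec_eq_iff)
qed

lemma gradient_scale: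
  assumes "f differentiable (at x)"
  shows "gradient (\<lambda>x. c * f x) x = c *\<^sub>R gradient f x"
proof -
  have "gradient (\<lambda>x. c * f x) x $ i = (c *\<^sub>R gradient f x) $ i" for i
    using assms by (subst gradient_nthI[OF has_derivative_mult_right])
      (auto simp: frechet_derivative_works gradient_nth)
  thus ?thesis by (simp add: Finite_Cartesian_Product.vec_eq_iff)
qed

lemma Ck_Suc_imp: "Ck (Suc k) f \<Longrightarrow> Ck k f"
proof (induction k arbitrary: f)
  case 0
  then show ?case
    by (auto intro!: continuous_at_imp_continuous_on differentiable_imp_continuous_within)
next
  case (Suc k)
  then show ?case by (metis Ck.simps(2))
qed

lemma Ck_add: "Ck k f \<Longrightarrow> Ck k g \<Longrightarrow> Ck k (\<lambda>x. f x + g x)"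
proof (induction k arbitrary: f g)
  case (Suc k)
  then show ?case by (auto simp: gradient_add)
qed (auto intro: continuous_intros)

lemma Ck_mult: "Ck k f \<Longrightarrow> Ck k g \<Longrightarrow> Ck k (\<lambda>x. f x * g x)"
proof (induction k arbitrary: f g)
  case (Suc k)
  have "Ck k f" "Ck k g" using Suc.prems Ck_Suc_imp by blast+
  with Suc show ?case by (auto simp: gradient_mult intro!: Ck_add)
qed (auto intro: continuous_intros)

lemma Ck_const: "Ck k (\<lambda>_ :: real^'d. c)"
proof (induction k arbitrary: c)
  case (Suc k)
  have "gradient (\<lambda>_. c) x $ i = 0" for x :: "real^'d" and i
    by (subst gradient_nthI[OF has_derivative_const]) simp
  with Suc show ?case by simp
qed auto

lemma Ck_prod: "(\<And>i. i \<in> I \<Longrightarrow> Ck k (f i)) \<Longrightarrow> Ck k (\<lambda>x. \<Prod>i\<in>I. f i x)"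
  by (induction I rule: infinite_finite_induct) (auto intro: Ck_mult Ck_const)

section \<open>Smooth functions supported in a box\<close>

definition exp_pole :: "nat \<Rightarrow> real \<Rightarrow> real" where
  "exp_pole j t = (if 0 < t then exp (- inverse t) * inverse t ^ j else 0)"

text \<open>Substituting s = 1/t turns this into the decay of s^j / exp s at infinity.\<close>

lemma exp_pole_tendsto_0: "(exp_pole j \<longlongrightarrow> 0) (at_right 0)"
proof -
  have "((\<lambda>s. s ^ j / exp s) \<longlongrightarrow> 0) (at_top :: real filter)"
    by (rule tendsto_power_div_exp_0)
  hence "((\<lambda>t. inverse t ^ j / exp (inverse t)) \<longlongrightarrow> 0) (at_right (0::real))"
    by (rule filterlim_compose[OF _ filterlim_inverse_at_top_right])
  then show ?thesis
    by (rule Lim_transform_eventually)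
      (auto simp: exp_pole_def eventually_at_filter exp_minus field_simps)
qed

lemma exp_pole_deriv:
  "(exp_pole j has_real_derivative (exp_pole (j + 2) t - real j * exp_pole (Suc j) t)) (at t)"
proof (cases "t = 0")
  case True
  \<comment> \<open>From the right, dividing by h raises the pole order by one, so the difference
    quotient at 0 is \<open>exp_pole (Suc j)\<close>. From the left it is zero.\<close>
  have "((\<lambda>h. (exp_pole j (0 + h) - exp_pole j 0) / h) \<longlongrightarrow> 0) (at_right 0)"
    by (rule Lim_transform_eventually[OF exp_pole_tendsto_0[of "Suc j"]])
      (auto simp: exp_pole_def eventually_at_filter field_simps)
  moreover have "((\<lambda>h. (exp_pole j (0 + h) - exp_pole j 0) / h) \<longlongrightarrow> 0) (at_left 0)"
    by (rule Lim_transform_eventually[OF tendsto_const])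
      (auto simp: exp_pole_def eventually_at_filter)
  ultimately show ?thesis
    using True by (simp add: has_field_derivative_def DERIV_def filterlim_split_at exp_pole_def
        flip: has_field_derivative_def)
next
  case False
  show ?thesis
  proof (cases "0 < t")
    case True
    have "((\<lambda>t. exp (- inverse t) * inverse t ^ j) has_real_derivative
        (exp_pole (j + 2) t - real j * exp_pole (Suc j) t)) (at t)"
      using True apply (auto intro!: derivative_eq_intros simp: exp_pole_def)
      apply (cases j)
      apply (auto simp: field_simps power2_eq_square)
      done
    then show ?thesis
      by (rule has_field_derivative_transform_within_open[where S="{0<..}"])
        (use True in \<open>auto simp: exp_pole_def\<close>)
  next
    case neg: False
    have "((\<lambda>t. 0) has_real_derivative
        (exp_pole (j + 2) t - real j * exp_pole (Suc j) t)) (at t)"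
      using neg by (auto simp: exp_pole_def)
    then show ?thesis
      by (rule has_field_derivative_transform_within_open[where S="{..<0}"])
        (use False neg in \<open>auto simp: exp_pole_def\<close>)
  qed
qed

text \<open>Arbitrary pole orders close the induction: a partial derivative is a combination of the
  same functions with orders \<open>j + 1\<close> and \<open>j + 2\<close>. The case
  \<open>j = 0\<close> is the classical flat function used for bumps.\<close>

lemma Ck_exp_pole: "Ck k (\<lambda>x::real^'d. exp_pole j (c * x $ m + e))"
proof (induction k arbitrary: j)
  case 0
  have "continuous_on UNIV (exp_pole j)"
    by (meson DERIV_isCont continuous_at_imp_continuous_on exp_pole_deriv)
  hence "continuous_on UNIV (exp_pole j \<circ> (\<lambda>x::real^'d. c * x $ m + e))"
    by (intro continuous_on_compose continuous_intros) (auto intro: continuous_on_subset)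
  thus ?case by (simp add: o_def)
next
  case (Suc k)
  let ?d = "\<lambda>t. exp_pole (j + 2) t - real j * exp_pole (Suc j) t"
  have d: "((\<lambda>x::real^'d. exp_pole j (c * x $ m + e)) has_derivative
      (\<lambda>y. ?d (c * x $ m + e) * (c * y $ m))) (at x)" for x
  proof -
    have *: "((\<lambda>x::real^'d. c * x $ m + e) has_derivative (\<lambda>y. c * y $ m)) (at x)"
      by (auto intro!: derivative_eq_intros bounded_linear_imp_has_derivative bounded_linear_vec_nth)
    have "((exp_pole j) has_derivative (*) (?d (c * x $ m + e))) (at (c * x $ m + e))"
      using exp_pole_deriv[of j "c * x $ m + e"] unfolding has_field_derivative_def .
    from has_derivative_compose[OF * this] show ?thesis by (simp add: mult.commute)
  qed
  have "Ck k (\<lambda>x::real^'d. ?d (c * x $ m + e) * (c * axis i 1 $ m))" for i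
  proof -
    have "Ck k (\<lambda>x::real^'d. (exp_pole (j + 2) (c * x $ m + e) + (- real j) * exp_pole (Suc j) (c * x $ m + e)) * (c * axis i 1 $ m))"
      by (intro Ck_mult Ck_add Ck_const Suc)
    thus ?thesis by simp
  qed
  with d show ?case by (auto simp: gradient_nthI[OF d] differentiable_def)
qed


text \<open>The factor \<open>c\<close> sharpens the edges: for \<open>c\<close> tending to infinity
  the bump tends pointwise to the indicator of the open box, with values in [0, 1]
  throughout.\<close>

definition bump :: "real^'d \<Rightarrow> real^'d \<Rightarrow> real \<Rightarrow> real^'d \<Rightarrow> real" where
  "bump a b c x = (\<Prod>i\<in>UNIV. exp_pole 0 (c * (x $ i - a $ i)) * exp_pole 0 (c * (b $ i - x $ i)))"

lemma smooth_bump: "smooth (bump a b c)"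
proof -
  have "Ck k (\<lambda>x. bump a b c x)" for k
    unfolding bump_def
    using Ck_exp_pole[of k 0 c _ "- c * a $ _"] Ck_exp_pole[of k 0 "- c" _ "c * b $ _"]
    by (intro Ck_prod Ck_mult) (simp_all add: algebra_simps)
  thus ?thesis by (simp add: smooth_def)
qed

lemma exp_pole_0_bounds: "0 \<le> exp_pole 0 t" "exp_pole 0 t \<le> 1"
  by (auto simp: exp_pole_def)

lemma bump_bounds: "0 \<le> bump a b c x" "bump a b c x \<le> 1"
  unfolding bump_def
  by (auto intro!: prod_nonneg prod_le_1 mult_nonneg_nonneg mult_le_one exp_pole_0_bounds)

lemma bump_eq_0:
  assumes "0 < c" "x \<notin> box a b"
  shows "bump a b c x = 0"
proof -
  obtain i where "\<not> a $ i < x $ i \<or> \<not> x $ i < b $ i"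
    using assms(2) by (auto simp: mem_box_cart)
  hence "exp_pole 0 (c * (x $ i - a $ i)) = 0 \<or> exp_pole 0 (c * (b $ i - x $ i)) = 0"
    using assms(1) by (auto simp: exp_pole_def zero_less_mult_iff)
  thus ?thesis by (auto simp: bump_def prod_zero_iff)
qed

lemma exp_pole_0_tendsto_1:
  assumes "0 < t"
  shows "(\<lambda>n. exp_pole 0 (real (Suc n) * t)) \<longlonglongrightarrow> 1"
proof -
  have "(\<lambda>n. exp (- (inverse (real (Suc n)) * inverse t))) \<longlonglongrightarrow> exp (- (0 * inverse t))"
    by (intro tendsto_intros LIMSEQ_inverse_real_of_nat)
  thus ?thesis using assms by (simp add: exp_pole_def)
qed

lemma bump_tendsto:
  "(\<lambda>n. bump a b (real (Suc n)) x) \<longlonglongrightarrow> indicator (box a b) x"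
proof (cases "x \<in> box a b")
  case True
  have "(\<lambda>n. bump a b (real (Suc n)) x) \<longlonglongrightarrow> (\<Prod>i\<in>(UNIV :: 'a set). 1 * 1)"
    unfolding bump_def
    using True by (intro tendsto_prod tendsto_mult exp_pole_0_tendsto_1) (auto simp: mem_box_cart)
  then show ?thesis using True by simp
qed (simp add: bump_eq_0)

lemma test_function_bump:
  assumes "0 < c" "cbox a b \<subseteq> \<Omega>"
  shows "test_function \<Omega> (bump a b c)"
  unfolding test_function_def
proof (intro conjI exI[of _ "cbox a b"] allI impI)
  show "bump a b c x = 0" if "x \<notin> cbox a b" for x
    using that box_subset_cbox[of a b] by (intro bump_eq_0 assms(1)) blast
qed (use assms(2) smooth_bump in auto)

lemma smooth_continuous: "smooth f \<Longrightarrow> continuous_on UNIV f"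
  unfolding smooth_def by (metis Ck.simps(1))

lemma smooth_differentiable: "smooth f \<Longrightarrow> f differentiable (at x)"
  unfolding smooth_def by (metis Ck.simps(2))

lemma smooth_gradient_continuous:
  assumes "smooth f"
  shows "continuous_on UNIV (gradient f)"
proof -
  have "Ck (Suc 0) f" using assms by (simp only: smooth_def)
  hence "continuous_on UNIV (\<lambda>x. gradient f x $ i)" for i by simp
  hence "continuous_on UNIV (\<lambda>x. \<chi> i. gradient f x $ i)" by (intro continuous_on_vec_lambda)
  thus ?thesis by simp
qed

section \<open>The fundamental lemma of the calculus of variations\<close>

lemma AE_eq_0_if_box_integrals:
  fixes F :: "'a::euclidean_space \<Rightarrow> real"
  assumes F: "integrable lborel F"
    and box: "\<And>a b. (\<integral>x. indicator (box a b) x * F x \<partial>lborel) = 0"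
  shows "AE x in lborel. F x = 0"
proof -
  have [measurable]: "F \<in> borel_measurable borel"
    using borel_measurable_integrable[OF F] by simp
  let ?M = "density lborel (\<lambda>x. ennreal (F x))" and ?N = "density lborel (\<lambda>x. ennreal (- F x))"
  have fin: "(\<integral>\<^sup>+x. ennreal (indicator A x * F x) \<partial>lborel) < \<infinity>"
    "(\<integral>\<^sup>+x. ennreal (- (indicator A x * F x)) \<partial>lborel) < \<infinity>"
    "integrable lborel (\<lambda>x. indicator A x * F x)" if "A \<in> sets borel" for A
  proof -
    show *: "integrable lborel (\<lambda>x. indicator A x * F x)"
      using integrable_mult_indicator[OF _ F, of A] that by simp
    show "(\<integral>\<^sup>+x. ennreal (indicator A x * F x) \<partial>lborel) < \<infinity>"
    "(\<integral>\<^sup>+x. ennreal (- (indicator A x * F x)) \<partial>lborel) < \<infinity>"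
      using real_integrable_def[THEN iffD1, OF *] by (auto simp: top.not_eq_extremum)
  qed
  have eM: "emeasure ?M A = (\<integral>\<^sup>+x. ennreal (indicator A x * F x) \<partial>lborel)"
    and eN: "emeasure ?N A = (\<integral>\<^sup>+x. ennreal (- (indicator A x * F x)) \<partial>lborel)"
    if "A \<in> sets borel" for A
    using that by (auto simp: emeasure_density intro!: nn_integral_cong split: split_indicator)
  \<comment> \<open>The densities are the positive and negative parts of \<open>F\<close>, since
    \<open>ennreal\<close> truncates at zero. The two finite measures agree on open boxes, an
    intersection-stable generator of the Borel sets.\<close>
  have "?M = ?N"
  proof (rule measure_eqI_generator_eq[where E = "range (\<lambda>(a, b). box a b)" and \<Omega> = UNIV
        and A = "\<lambda>n. box (- (real n *\<^sub>R One)) (real n *\<^sub>R One)"])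
    show "Int_stable (range (\<lambda>(a, b). box a b :: 'a set))"
      by (auto simp: Int_stable_def box_Int_box)
    show "emeasure ?M X = emeasure ?N X" if "X \<in> range (\<lambda>(a, b). box a b)" for X
    proof -
      obtain a b where X: "X = box a b" using \<open>X \<in> _\<close> by auto
      have *: "X \<in> sets borel" by (simp add: X)
      have "enn2real (\<integral>\<^sup>+x. ennreal (indicator X x * F x) \<partial>lborel)
          = enn2real (\<integral>\<^sup>+x. ennreal (- (indicator X x * F x)) \<partial>lborel)"
        using real_lebesgue_integral_def[OF fin(3)[OF *]] box[of a b] by (simp add: X)
      thus ?thesis using fin[OF *] unfolding eM[OF *] eN[OF *]
        by (metis ennreal_enn2real infinity_ennreal_def)
    qed
    show "sets ?M = sigma_sets UNIV (range (\<lambda>(a, b). box a b))"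
      "sets ?N = sigma_sets UNIV (range (\<lambda>(a, b). box a b))"
      by (simp_all add: borel_eq_box)
    show "range (\<lambda>n. box (- (real n *\<^sub>R One)) (real n *\<^sub>R One :: 'a)) \<subseteq> range (\<lambda>(a, b). box a b)"
      by auto
    show "(\<Union>n. box (- (real n *\<^sub>R One)) (real n *\<^sub>R One :: 'a)) = UNIV"
      using UN_box_eq_UNIV by (simp add: scaleR_scaleR)
    show "emeasure ?M (box (- (real n *\<^sub>R One)) (real n *\<^sub>R One)) \<noteq> \<infinity>" for n
      using fin(1)[of "box (- (real n *\<^sub>R One)) (real n *\<^sub>R One)"] by (subst eM) auto
  qed auto
  hence "AE x in lborel. ennreal (F x) = ennreal (- F x)"
    by (subst (asm) sigma_finite_measure.density_unique_iff[OF sigma_finite_lborel]) auto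
  thus ?thesis
    by eventually_elim (metis ennreal_eq_0_iff ennreal_neg linorder_le_cases neg_le_0_iff_le order_antisym)
qed

text \<open>Domination gives integrability over \<open>C\<close>, and vanishing outside
  \<open>C\<close> extends it to \<Omega>, where \<open>f\<close> itself may fail to be integrable.
  Products of \<open>f\<close> with test functions or their gradients are the intended
  \<open>h\<close>.\<close>

lemma locally_integrable_dominated:
  fixes f :: "real^'d \<Rightarrow> 'b::euclidean_space" and h :: "real^'d \<Rightarrow> 'c::euclidean_space"
  assumes "open \<Omega>" "locally_integrable \<Omega> f" "compact C" "C \<subseteq> \<Omega>"
    and "h \<in> borel_measurable (lebesgue_on C)"
    and "\<And>x. x \<in> C \<Longrightarrow> norm (h x) \<le> B * norm (f x)"
    and "\<And>x. x \<notin> C \<Longrightarrow> h x = 0"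
  shows "integrable (lebesgue_on \<Omega>) h"
proof -
  have C: "C \<in> sets lebesgue" and O: "\<Omega> \<in> sets lebesgue"
    using assms(1,3) by (auto intro: lmeasurable_compact fmeasurableD)
  have "integrable (lebesgue_on C) f" using assms by (auto simp: locally_integrable_def)
  hence "integrable (lebesgue_on C) (\<lambda>x. B *\<^sub>R norm (f x))"
    by auto
  hence "integrable (lebesgue_on C) h"
    by (rule Bochner_Integration.integrable_bound)
      (use assms in \<open>auto intro!: AE_I2 order.trans[OF _ abs_ge_self]\<close>)
  hence "integrable lebesgue (\<lambda>x. indicator C x *\<^sub>R h x)"
    using C by (subst (asm) integrable_restrict_space) auto
  also have "(\<lambda>x. indicator C x *\<^sub>R h x) = (\<lambda>x. indicator \<Omega> x *\<^sub>R h x)"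
    using assms by (auto simp: fun_eq_iff indicator_def)
  finally show ?thesis
    using O by (subst integrable_restrict_space) auto
qed

lemma continuous_lebesgue_on_measurable:
  fixes f :: "real^'d \<Rightarrow> 'c::euclidean_space"
  assumes "continuous_on UNIV f"
  shows "f \<in> borel_measurable (lebesgue_on S)"
proof -
  have "f \<in> borel_measurable lborel"
    using borel_measurable_continuous_onI[OF assms] by simp
  thus ?thesis by (intro measurable_restrict_space1 measurable_completion)
qed

lemma test_function_gradient_support:
  assumes "compact C" "\<And>x. x \<notin> C \<Longrightarrow> \<phi> x = 0" "x \<notin> C"
  shows "gradient \<phi> x = 0"
proof -
  have "open (- C)" using compact_imp_closed[OF assms(1)] by (simp add: open_Compl)
  have "((\<lambda>_. 0 :: real) has_derivative (\<lambda>_. 0)) (at x)" by simp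
  hence "(\<phi> has_derivative (\<lambda>_. 0)) (at x)"
    by (rule has_derivative_transform_within_open[OF _ \<open>open (- C)\<close>]) (use assms in auto)
  thus ?thesis by (simp add: Finite_Cartesian_Product.vec_eq_iff gradient_nthI)
qed

lemma test_function_integrable:
  fixes f :: "real^'d \<Rightarrow> 'b::euclidean_space"
  assumes "open \<Omega>" "locally_integrable \<Omega> f" "test_function \<Omega> \<phi>"
  shows "integrable (lebesgue_on \<Omega>) (\<lambda>x. \<phi> x *\<^sub>R f x)"
proof -
  obtain C where C: "compact C" "C \<subseteq> \<Omega>" "\<And>x. x \<notin> C \<Longrightarrow> \<phi> x = 0"
    using assms(3) by (auto simp: test_function_def)
  have cont: "continuous_on UNIV \<phi>"
    using assms(3) by (simp add: test_function_def smooth_continuous)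
  then obtain B where B: "\<And>x. x \<in> C \<Longrightarrow> norm (\<phi> x) \<le> B"
    using compact_imp_bounded[OF compact_continuous_image[OF _ C(1)], of \<phi>]
    by (auto simp: bounded_iff intro: continuous_on_subset)
  have "f \<in> borel_measurable (lebesgue_on C)"
    using assms(2) C by (auto simp: locally_integrable_def)
  show ?thesis
    by (rule locally_integrable_dominated[OF assms(1,2) C(1,2), where B=B])
      (use B C \<open>f \<in> _\<close> continuous_lebesgue_on_measurable[OF cont] in
        \<open>auto intro: borel_measurable_scaleR mult_right_mono\<close>)
qed

lemma test_function_gradient_integrable:
  fixes f :: "real^'d \<Rightarrow> real"
  assumes "open \<Omega>" "locally_integrable \<Omega> f" "test_function \<Omega> \<phi>"
  shows "integrable (lebesgue_on \<Omega>) (\<lambda>x. f x *\<^sub>R gradient \<phi> x)"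
proof -
  obtain C where C: "compact C" "C \<subseteq> \<Omega>" "\<And>x. x \<notin> C \<Longrightarrow> \<phi> x = 0"
    using assms(3) by (auto simp: test_function_def)
  have cont: "continuous_on UNIV (gradient \<phi>)"
    using assms(3) by (simp add: test_function_def smooth_gradient_continuous)
  then obtain B where B: "\<And>x. x \<in> C \<Longrightarrow> norm (gradient \<phi> x) \<le> B"
    using compact_imp_bounded[OF compact_continuous_image[OF _ C(1)], of "gradient \<phi>"]
    by (auto simp: bounded_iff intro: continuous_on_subset)
  have "f \<in> borel_measurable (lebesgue_on C)"
    using assms(2) C by (auto simp: locally_integrable_def)
  show ?thesis
    by (rule locally_integrable_dominated[OF assms(1,2) C(1,2), where B=B])
      (use B C \<open>f \<in> _\<close> continuous_lebesgue_on_measurable[OF cont] in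
        \<open>auto intro: borel_measurable_scaleR mult_left_mono
          simp: test_function_gradient_support[OF C(1)] mult.commute[of B]\<close>)
qed

text \<open>Bumps approximate the indicator of any open box with closure in \<Omega>, so
  \<open>f\<close> has zero integral over each such box. Hence \<open>f\<close> vanishes almost
  everywhere on each of them, and countably many closed boxes cover \<Omega>.\<close>

lemma fundamental_lemma_real:
  fixes f :: "real^'d \<Rightarrow> real"
  assumes "open \<Omega>" "locally_integrable \<Omega> f"
    and zero: "\<And>\<phi>. test_function \<Omega> \<phi> \<Longrightarrow> (\<integral>x. \<phi> x * f x \<partial>lebesgue_on \<Omega>) = 0"
  shows "AE x in lebesgue_on \<Omega>. f x = 0"
proof -
  have O: "\<Omega> \<in> sets lebesgue" using assms(1) by auto
  have fm: "f \<in> borel_measurable (lebesgue_on (cbox a b))" if "cbox a b \<subseteq> \<Omega>" for a b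
    using assms(2) that compact_cbox[of a b] unfolding locally_integrable_def
    by (blast intro: borel_measurable_integrable)
  have int: "integrable lebesgue (\<lambda>x. indicator (box a b) x * f x)"
    and box0: "(\<integral>x. indicator (box a b) x * f x \<partial>lebesgue) = 0" if ab: "cbox a b \<subseteq> \<Omega>" for a b
  proof -
    have dom: "integrable (lebesgue_on \<Omega>) h" if "h \<in> borel_measurable (lebesgue_on (cbox a b))"
      "\<And>x. norm (h x) \<le> indicator (cbox a b) x * norm (f x)" for h :: "real^'d \<Rightarrow> real"
    proof (rule locally_integrable_dominated[OF assms(1,2) compact_cbox ab that(1), where B=1])
      show "norm (h x) \<le> 1 * norm (f x)" if "x \<in> cbox a b" for x using \<open>\<And>x. norm (h x) \<le> _\<close>[of x] that by simp
      show "h x = 0" if "x \<notin> cbox a b" for x using \<open>\<And>x. norm (h x) \<le> _\<close>[of x] that by simp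
    qed
    have sub: "box a b \<subseteq> cbox a b" by (rule box_subset_cbox)
    have i1: "integrable (lebesgue_on \<Omega>) (\<lambda>x. indicator (box a b) x * f x)"
      using sub by (intro dom borel_measurable_times fm ab borel_measurable_indicator)
        (auto simp: indicator_def sets_restrict_space_iff)
    have i2: "integrable (lebesgue_on \<Omega>) (\<lambda>x. indicator (cbox a b) x * norm (f x))"
      using fm[OF ab] by (intro dom borel_measurable_times borel_measurable_norm borel_measurable_indicator)
        (auto simp: indicator_def sets_restrict_space_iff)
    have "(\<lambda>n. \<integral>x. bump a b (real (Suc n)) x * f x \<partial>lebesgue_on \<Omega>)
        \<longlonglongrightarrow> (\<integral>x. indicator (box a b) x * f x \<partial>lebesgue_on \<Omega>)"
    proof (rule integral_dominated_convergence[OF _ _ i2])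
      show "(\<lambda>x. indicator (box a b) x * f x) \<in> borel_measurable (lebesgue_on \<Omega>)"
        using i1 by auto
      show "(\<lambda>x. bump a b (real (Suc n)) x * f x) \<in> borel_measurable (lebesgue_on \<Omega>)" for n
        using test_function_integrable[OF assms(1,2) test_function_bump[OF _ ab]] by force
      show "AE x in lebesgue_on \<Omega>. (\<lambda>n. bump a b (real (Suc n)) x * f x)
           \<longlonglongrightarrow> indicator (box a b) x * f x"
        by (intro AE_I2 tendsto_intros bump_tendsto)
      show "AE x in lebesgue_on \<Omega>. norm (bump a b (real (Suc n)) x * f x)
          \<le> indicator (cbox a b) x * norm (f x)" for n
      proof (intro AE_I2)
        fix x
        show "norm (bump a b (real (Suc n)) x * f x) \<le> indicator (cbox a b) x * norm (f x)"
        proof (cases "x \<in> box a b")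
          case True
          hence "x \<in> cbox a b" using sub by auto
          thus ?thesis using bump_bounds[of a b "real (Suc n)" x] by (simp add: abs_mult mult_left_le_one_le)
        qed (simp add: bump_eq_0)
      qed
    qed
    moreover have "(\<integral>x. bump a b (real (Suc n)) x * f x \<partial>lebesgue_on \<Omega>) = 0" for n
      by (intro zero test_function_bump ab) auto
    ultimately have "(\<integral>x. indicator (box a b) x * f x \<partial>lebesgue_on \<Omega>) = 0"
      by (simp add: LIMSEQ_const_iff)
    moreover have eq: "(\<lambda>x. indicator \<Omega> x *\<^sub>R (indicator (box a b) x * f x)) = (\<lambda>x. indicator (box a b) x * f x)"
      using sub ab by (auto simp: fun_eq_iff indicator_def)
    ultimately show "(\<integral>x. indicator (box a b) x * f x \<partial>lebesgue) = 0"
      using O by (subst (asm) integral_restrict_space) auto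
    show "integrable lebesgue (\<lambda>x. indicator (box a b) x * f x)"
      using i1 O eq by (subst (asm) integrable_restrict_space) auto
  qed
  have AE_box: "AE x in lebesgue. x \<in> box p q \<longrightarrow> f x = 0" if pq: "cbox p q \<subseteq> \<Omega>" for p q
  proof -
    let ?F = "\<lambda>x. indicator (box p q) x * f x"
    \<comment> \<open>The box criterion speaks about Borel functions, so the Lebesgue measurable
      restriction of \<open>f\<close> is replaced by a Borel representative.\<close>
    obtain F where F[measurable]: "F \<in> borel_measurable lborel" and AE: "AE x in lborel. ?F x = F x"
      using completion_ex_borel_measurable_real[OF borel_measurable_integrable[OF int[OF pq]]] by blast
    have AE': "AE x in lebesgue. ?F x = F x" using AE by (rule AE_completion)
    have "integrable lebesgue F"
      using int[OF pq] AE' F by (subst integrable_cong_AE[symmetric, of ?F]) (auto intro!: measurable_completion)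
    hence iF: "integrable lborel F" by (simp add: integrable_completion)
    have "(\<integral>x. indicator (box a b) x * F x \<partial>lborel) = 0" for a b
    proof (cases "box a b \<inter> box p q = {}")
      case True
      have "(\<integral>x. indicator (box a b) x * F x \<partial>lborel) = (\<integral>x. 0 \<partial>(lborel :: (real^'d) measure))"
        by (rule integral_cong_AE) (use AE True in \<open>auto simp: indicator_def disjoint_iff\<close>)
      then show ?thesis by simp
    next
      case False
      obtain c d where cd: "box a b \<inter> box p q = box c d"
        using box_Int_box[of a b p q] by blast
      \<comment> \<open>The intersection is a nonempty open box inside \<open>box p q\<close>; its
        closed box is its closure and thus still lies in \<Omega>, where \<open>box0\<close>
        applies.\<close>
      have "cbox c d = closure (box c d)" using False cd by simp
      also have "\<dots> \<subseteq> cbox p q" unfolding cd[symmetric]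
        by (metis Int_lower2 box_subset_cbox closed_cbox closure_minimal order.trans)
      finally have sub: "cbox c d \<subseteq> \<Omega>" using pq by simp
      have ae: "AE x in lebesgue. indicator (box a b) x * F x = indicator (box c d) x * f x"
        using AE' by eventually_elim (auto simp: cd[symmetric] indicator_def)
      have "(\<integral>x. indicator (box a b) x * F x \<partial>lborel) = (\<integral>x. indicator (box a b) x * F x \<partial>lebesgue)"
        by (rule integral_completion[symmetric]) auto
      also have "\<dots> = (\<integral>x. indicator (box c d) x * f x \<partial>lebesgue)"
        by (rule integral_cong_AE)
          (use ae borel_measurable_integrable[OF int[OF sub]] in \<open>auto intro!: measurable_completion\<close>)
      also have "\<dots> = 0" by (rule box0[OF sub])
      finally show ?thesis .
    qed
    from AE_eq_0_if_box_integrals[OF iF this] have "AE x in lebesgue. F x = 0" by (rule AE_completion)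
    with AE' show ?thesis by eventually_elim (auto simp: indicator_def split: if_splits)
  qed
  obtain \<D> where D: "countable \<D>" "\<D> \<subseteq> Pow \<Omega>" "\<And>X. X \<in> \<D> \<Longrightarrow> \<exists>a b. X = cbox a b" "\<Union>\<D> = \<Omega>"
    using open_countable_Union_open_cbox[OF assms(1)] by metis
  have "AE x in lebesgue. x \<in> X \<longrightarrow> f x = 0" if X: "X \<in> \<D>" for X
  proof -
    obtain a b where ab: "X = cbox a b" using D(3)[OF X] by blast
    \<comment> \<open>The cover consists of closed boxes while vanishing is known on open ones; the
      faces form a null set.\<close>
    have "cbox a b - box a b \<in> null_sets lebesgue"
      using negligible_frontier_interval[of a b] by (simp only: negligible_iff_null_sets)
    hence "AE x in lebesgue. x \<notin> cbox a b - box a b" by (rule AE_not_in)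
    moreover have "AE x in lebesgue. x \<in> box a b \<longrightarrow> f x = 0"
      by (rule AE_box) (use D(2) X in \<open>auto simp: ab\<close>)
    ultimately show ?thesis by eventually_elim (auto simp: ab)
  qed
  hence "AE x in lebesgue. \<forall>X\<in>\<D>. x \<in> X \<longrightarrow> f x = 0"
    unfolding AE_ball_countable[OF D(1)] by blast
  hence "AE x in lebesgue. x \<in> \<Union>\<D> \<longrightarrow> f x = 0"
    by eventually_elim blast
  thus ?thesis using O by (simp add: AE_restrict_space_iff D(4))
qed

section \<open>Weak gradients and the energy space\<close>

lemma fundamental_lemma:
  fixes g :: "real^'d \<Rightarrow> real^'d"
  assumes "open \<Omega>" "locally_integrable \<Omega> g"
    and zero: "\<And>\<phi>. test_function \<Omega> \<phi> \<Longrightarrow> (\<integral>x. \<phi> x *\<^sub>R g x \<partial>lebesgue_on \<Omega>) = 0"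
  shows "AE x in lebesgue_on \<Omega>. g x = 0"
proof -
  have "AE x in lebesgue_on \<Omega>. g x $ i = 0" for i
  proof (rule fundamental_lemma_real[OF assms(1)])
    show "locally_integrable \<Omega> (\<lambda>x. g x $ i)"
      using assms(2) by (auto simp: locally_integrable_def
          intro: integrable_bounded_linear[OF bounded_linear_vec_nth])
    fix \<phi> assume \<phi>: "test_function \<Omega> \<phi>"
    have "(\<integral>x. (\<phi> x *\<^sub>R g x) $ i \<partial>lebesgue_on \<Omega>) = (\<integral>x. \<phi> x *\<^sub>R g x \<partial>lebesgue_on \<Omega>) $ i"
      by (rule integral_bounded_linear[OF bounded_linear_vec_nth])
        (rule test_function_integrable[OF assms(1,2) \<phi>])
    thus "(\<integral>x. \<phi> x * g x $ i \<partial>lebesgue_on \<Omega>) = 0" by (simp add: zero[OF \<phi>])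
  qed
  hence "AE x in lebesgue_on \<Omega>. \<forall>i\<in>UNIV. g x $ i = 0"
    by (intro AE_finite_allI) auto
  thus ?thesis by eventually_elim (simp add: Finite_Cartesian_Product.vec_eq_iff)
qed

lemma locally_integrable_lincomb:
  assumes "locally_integrable \<Omega> f" "locally_integrable \<Omega> g"
  shows "locally_integrable \<Omega> (\<lambda>x. s *\<^sub>R f x + t *\<^sub>R g x)"
  using assms by (auto simp: locally_integrable_def)

lemma weak_gradient_unique:
  assumes "open \<Omega>" "is_weak_gradient \<Omega> v g" "is_weak_gradient \<Omega> v h"
  shows "AE x in lebesgue_on \<Omega>. g x = h x"
proof -
  have loc: "locally_integrable \<Omega> g" "locally_integrable \<Omega> h"
    using assms(2,3) by (auto simp: is_weak_gradient_def)
  have "AE x in lebesgue_on \<Omega>. 1 *\<^sub>R g x + (- 1) *\<^sub>R h x = 0"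
  proof (rule fundamental_lemma[OF assms(1) locally_integrable_lincomb[OF loc]])
    fix \<phi> assume \<phi>: "test_function \<Omega> \<phi>"
    have "(\<integral>x. \<phi> x *\<^sub>R g x \<partial>lebesgue_on \<Omega>) = (\<integral>x. \<phi> x *\<^sub>R h x \<partial>lebesgue_on \<Omega>)"
    proof -
      have "(\<integral>x. v x *\<^sub>R gradient \<phi> x \<partial>lebesgue_on \<Omega>) = - (\<integral>x. \<phi> x *\<^sub>R f x \<partial>lebesgue_on \<Omega>)"
        if "is_weak_gradient \<Omega> v f" for f
        using that \<phi> by (simp add: is_weak_gradient_def)
      from this[OF assms(2)] this[OF assms(3)] show ?thesis by simp
    qed
    moreover have "(\<integral>x. \<phi> x *\<^sub>R g x - \<phi> x *\<^sub>R h x \<partial>lebesgue_on \<Omega>)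
        = (\<integral>x. \<phi> x *\<^sub>R g x \<partial>lebesgue_on \<Omega>) - (\<integral>x. \<phi> x *\<^sub>R h x \<partial>lebesgue_on \<Omega>)"
      by (intro Bochner_Integration.integral_diff test_function_integrable assms loc \<phi>)
    ultimately show "(\<integral>x. \<phi> x *\<^sub>R (1 *\<^sub>R g x + (- 1) *\<^sub>R h x) \<partial>lebesgue_on \<Omega>) = 0"
      by (simp add: scaleR_diff_right)
  qed
  thus ?thesis by eventually_elim simp
qed

text \<open>\<open>weak_gradient\<close> is a choice among almost everywhere equal functions; this
  is the way to replace it by an explicit weak gradient.\<close>

lemma weak_gradient_AE_eq:
  assumes "open \<Omega>" "is_weak_gradient \<Omega> v g"
  shows "AE x in lebesgue_on \<Omega>. weak_gradient \<Omega> v x = g x"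
  unfolding weak_gradient_def
  by (intro weak_gradient_unique[OF assms(1) someI[of _ g] assms(2)] assms(2))

lemma is_weak_gradient_weak_gradient:
  "is_weak_gradient \<Omega> v g \<Longrightarrow> is_weak_gradient \<Omega> v (weak_gradient \<Omega> v)"
  unfolding weak_gradient_def by (rule someI[where P="is_weak_gradient \<Omega> v"])

lemma integral_lincomb:
  fixes f g :: "'a \<Rightarrow> 'b::euclidean_space"
  assumes "integrable M f" "integrable M g"
  shows "(\<integral>x. s *\<^sub>R f x + t *\<^sub>R g x \<partial>M) = s *\<^sub>R (\<integral>x. f x \<partial>M) + t *\<^sub>R (\<integral>x. g x \<partial>M)"
  using assms by (subst Bochner_Integration.integral_add) auto

lemma is_weak_gradient_lincomb:
  assumes "open \<Omega>" "is_weak_gradient \<Omega> v g" "is_weak_gradient \<Omega> w h"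
  shows "is_weak_gradient \<Omega> (\<lambda>x. s * v x + t * w x) (\<lambda>x. s *\<^sub>R g x + t *\<^sub>R h x)"
  unfolding is_weak_gradient_def
proof (intro conjI allI impI)
  have loc: "locally_integrable \<Omega> v" "locally_integrable \<Omega> w"
     "locally_integrable \<Omega> g" "locally_integrable \<Omega> h"
    using assms(2,3) by (auto simp: is_weak_gradient_def)
  show "locally_integrable \<Omega> (\<lambda>x. s * v x + t * w x)"
    using locally_integrable_lincomb[OF loc(1,2)] by simp
  show "locally_integrable \<Omega> (\<lambda>x. s *\<^sub>R g x + t *\<^sub>R h x)"
    by (rule locally_integrable_lincomb[OF loc(3,4)])
  fix \<phi> assume \<phi>: "test_function \<Omega> \<phi>"
  note i1 = test_function_gradient_integrable[OF assms(1) loc(1) \<phi>]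
    test_function_gradient_integrable[OF assms(1) loc(2) \<phi>]
  note i2 = test_function_integrable[OF assms(1) loc(3) \<phi>]
    test_function_integrable[OF assms(1) loc(4) \<phi>]
  have "(\<integral>x. (s * v x + t * w x) *\<^sub>R gradient \<phi> x \<partial>lebesgue_on \<Omega>)
      = (\<integral>x. s *\<^sub>R (v x *\<^sub>R gradient \<phi> x) + t *\<^sub>R (w x *\<^sub>R gradient \<phi> x) \<partial>lebesgue_on \<Omega>)"
    by (simp add: algebra_simps)
  also have "\<dots> = s *\<^sub>R (\<integral>x. v x *\<^sub>R gradient \<phi> x \<partial>lebesgue_on \<Omega>)
      + t *\<^sub>R (\<integral>x. w x *\<^sub>R gradient \<phi> x \<partial>lebesgue_on \<Omega>)"
    by (rule integral_lincomb[OF i1])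
  also have "\<dots> = - (s *\<^sub>R (\<integral>x. \<phi> x *\<^sub>R g x \<partial>lebesgue_on \<Omega>) + t *\<^sub>R (\<integral>x. \<phi> x *\<^sub>R h x \<partial>lebesgue_on \<Omega>))"
    using assms(2,3) \<phi> by (simp add: is_weak_gradient_def)
  also have "\<dots> = - (\<integral>x. s *\<^sub>R (\<phi> x *\<^sub>R g x) + t *\<^sub>R (\<phi> x *\<^sub>R h x) \<partial>lebesgue_on \<Omega>)"
    by (simp only: integral_lincomb[OF i2])
  also have "\<dots> = - (\<integral>x. \<phi> x *\<^sub>R (s *\<^sub>R g x + t *\<^sub>R h x) \<partial>lebesgue_on \<Omega>)"
    by (simp add: algebra_simps)
  finally show "(\<integral>x. (s * v x + t * w x) *\<^sub>R gradient \<phi> x \<partial>lebesgue_on \<Omega>)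
      = - (\<integral>x. \<phi> x *\<^sub>R (s *\<^sub>R g x + t *\<^sub>R h x) \<partial>lebesgue_on \<Omega>)" .
qed

section \<open>Square-integrable functions, L2 limits and changes on null sets\<close>

lemma norm_lincomb_sq_le:
  fixes a b :: "'b::real_normed_vector"
  shows "(norm (s *\<^sub>R a + t *\<^sub>R b))\<^sup>2 \<le> 2 * s\<^sup>2 * (norm a)\<^sup>2 + 2 * t\<^sup>2 * (norm b)\<^sup>2"
proof -
  have "norm (s *\<^sub>R a + t *\<^sub>R b) \<le> \<bar>s\<bar> * norm a + \<bar>t\<bar> * norm b"
    using norm_triangle_ineq[of "s *\<^sub>R a" "t *\<^sub>R b"] by simp
  hence "(norm (s *\<^sub>R a + t *\<^sub>R b))\<^sup>2 \<le> (\<bar>s\<bar> * norm a + \<bar>t\<bar> * norm b)\<^sup>2"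
    by (simp add: power_mono)
  also have "\<dots> \<le> 2 * (\<bar>s\<bar> * norm a)\<^sup>2 + 2 * (\<bar>t\<bar> * norm b)\<^sup>2"
    using zero_le_power2[of "\<bar>s\<bar> * norm a - \<bar>t\<bar> * norm b"] by (simp add: power2_sum power2_diff)
  finally show ?thesis by (simp add: power_mult_distrib)
qed

lemma square_integrable_lincomb:
  fixes f g :: "'a \<Rightarrow> 'b::euclidean_space"
  assumes "square_integrable M f" "square_integrable M g"
  shows "square_integrable M (\<lambda>x. s *\<^sub>R f x + t *\<^sub>R g x)"
  unfolding square_integrable_def
proof
  show m: "(\<lambda>x. s *\<^sub>R f x + t *\<^sub>R g x) \<in> borel_measurable M"
    using assms by (auto simp: square_integrable_def)
  have "integrable M (\<lambda>x. 2 * s\<^sup>2 * (norm (f x))\<^sup>2 + 2 * t\<^sup>2 * (norm (g x))\<^sup>2)"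
    using assms by (auto simp: square_integrable_def)
  thus "integrable M (\<lambda>x. (norm (s *\<^sub>R f x + t *\<^sub>R g x))\<^sup>2)"
    by (rule Bochner_Integration.integrable_bound)
      (use m norm_lincomb_sq_le[of s _ t] in \<open>auto intro!: AE_I2 order.trans[OF _ abs_ge_self]\<close>)
qed

lemma L2_tendsto_lincomb:
  fixes f g :: "'a \<Rightarrow> 'b::euclidean_space"
  assumes "L2_tendsto M F f" "L2_tendsto M G g"
  shows "L2_tendsto M (\<lambda>n x. s *\<^sub>R F n x + t *\<^sub>R G n x) (\<lambda>x. s *\<^sub>R f x + t *\<^sub>R g x)"
proof -
  have eq: "s *\<^sub>R F n x + t *\<^sub>R G n x - (s *\<^sub>R f x + t *\<^sub>R g x) = s *\<^sub>R (F n x - f x) + t *\<^sub>R (G n x - g x)"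
    for n x by (simp add: algebra_simps)
  have si: "square_integrable M (\<lambda>x. F n x - f x)" "square_integrable M (\<lambda>x. G n x - g x)" for n
    using assms by (auto simp: L2_tendsto_def)
  have si2: "square_integrable M (\<lambda>x. s *\<^sub>R (F n x - f x) + t *\<^sub>R (G n x - g x))" for n
    by (intro square_integrable_lincomb si)
  have le: "(\<integral>x. (norm (s *\<^sub>R (F n x - f x) + t *\<^sub>R (G n x - g x)))\<^sup>2 \<partial>M)
      \<le> 2 * s\<^sup>2 * (\<integral>x. (norm (F n x - f x))\<^sup>2 \<partial>M) + 2 * t\<^sup>2 * (\<integral>x. (norm (G n x - g x))\<^sup>2 \<partial>M)" for n
  proof -
    have "(\<integral>x. (norm (s *\<^sub>R (F n x - f x) + t *\<^sub>R (G n x - g x)))\<^sup>2 \<partial>M)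
      \<le> (\<integral>x. 2 * s\<^sup>2 * (norm (F n x - f x))\<^sup>2 + 2 * t\<^sup>2 * (norm (G n x - g x))\<^sup>2 \<partial>M)"
      using si[of n] si2[of n] by (intro integral_mono norm_lincomb_sq_le) (auto simp: square_integrable_def)
    also have "\<dots> = 2 * s\<^sup>2 * (\<integral>x. (norm (F n x - f x))\<^sup>2 \<partial>M) + 2 * t\<^sup>2 * (\<integral>x. (norm (G n x - g x))\<^sup>2 \<partial>M)"
      using si[of n] by (subst Bochner_Integration.integral_add) (auto simp: square_integrable_def)
    finally show ?thesis .
  qed
  have lim: "(\<lambda>n. 2 * s\<^sup>2 * (\<integral>x. (norm (F n x - f x))\<^sup>2 \<partial>M) + 2 * t\<^sup>2 * (\<integral>x. (norm (G n x - g x))\<^sup>2 \<partial>M))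
      \<longlonglongrightarrow> 2 * s\<^sup>2 * 0 + 2 * t\<^sup>2 * 0"
    using assms by (intro tendsto_intros) (auto simp: L2_tendsto_def)
  have "(\<lambda>n. \<integral>x. (norm (s *\<^sub>R (F n x - f x) + t *\<^sub>R (G n x - g x)))\<^sup>2 \<partial>M) \<longlonglongrightarrow> 0"
    by (rule tendsto_sandwich[OF _ _ tendsto_const]) (use le lim in auto)
  thus ?thesis using si2 by (simp add: L2_tendsto_def eq)
qed

text \<open>This is completeness of Lebesgue measure. It makes the chosen
  \<open>weak_gradient\<close> measurable, which is known only to agree almost everywhere with a
  measurable function.\<close>

lemma AE_eq_measurable_lebesgue_on:
  fixes f g :: "'a::euclidean_space \<Rightarrow> 'b::euclidean_space"
  assumes "S \<in> sets lebesgue" "f \<in> borel_measurable (lebesgue_on S)"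
    and "AE x in lebesgue_on S. f x = g x"
  shows "g \<in> borel_measurable (lebesgue_on S)"
proof -
  have "AE x in lebesgue. x \<in> S \<longrightarrow> f x = g x"
    using assms(1,3) by (simp add: AE_restrict_space_iff)
  hence "AE x in lebesgue. (if x \<in> S then f x else 0) = (if x \<in> S then g x else 0)"
    by eventually_elim auto
  moreover have "(\<lambda>x. if x \<in> S then f x else 0) \<in> borel_measurable lebesgue"
    using assms(1,2) by (simp add: borel_measurable_if)
  ultimately have "(\<lambda>x. if x \<in> S then g x else 0) \<in> borel_measurable lebesgue"
    by (rule borel_measurable_AE[rotated])
  thus ?thesis using assms(1) by (simp add: borel_measurable_if)
qed

lemma square_integrable_cong_AE:
  fixes f g :: "'a::euclidean_space \<Rightarrow> 'b::euclidean_space"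
  assumes "S \<in> sets lebesgue" "square_integrable (lebesgue_on S) f"
    and ae: "AE x in lebesgue_on S. f x = g x"
  shows "square_integrable (lebesgue_on S) g"
proof -
  have f: "f \<in> borel_measurable (lebesgue_on S)" using assms by (simp add: square_integrable_def)
  have g: "g \<in> borel_measurable (lebesgue_on S)"
    by (rule AE_eq_measurable_lebesgue_on[OF assms(1) f ae])
  have "integrable (lebesgue_on S) (\<lambda>x. (norm (f x))\<^sup>2) \<longleftrightarrow> integrable (lebesgue_on S) (\<lambda>x. (norm (g x))\<^sup>2)"
    by (rule integrable_cong_AE) (use f g ae in auto)
  thus ?thesis using assms g by (simp add: square_integrable_def)
qed

lemma L2_tendsto_cong_AE:
  fixes f g :: "'a::euclidean_space \<Rightarrow> 'b::euclidean_space"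
  assumes "S \<in> sets lebesgue" "L2_tendsto (lebesgue_on S) F f"
    and ae: "AE x in lebesgue_on S. f x = g x"
  shows "L2_tendsto (lebesgue_on S) F g"
proof -
  have si: "square_integrable (lebesgue_on S) (\<lambda>x. F n x - f x)" for n
    using assms by (simp add: L2_tendsto_def)
  have ae': "AE x in lebesgue_on S. F n x - f x = F n x - g x" for n
    using ae by eventually_elim simp
  have si': "square_integrable (lebesgue_on S) (\<lambda>x. F n x - g x)" for n
    by (rule square_integrable_cong_AE[OF assms(1) si ae'])
  have "(\<integral>x. (norm (F n x - g x))\<^sup>2 \<partial>lebesgue_on S) = (\<integral>x. (norm (F n x - f x))\<^sup>2 \<partial>lebesgue_on S)" for n
    by (rule integral_cong_AE) (use si[of n] si'[of n] ae in \<open>auto simp: square_integrable_def\<close>)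
  thus ?thesis using assms(2) si' by (simp add: L2_tendsto_def)
qed

lemma test_function_lincomb:
  assumes "test_function \<Omega> \<phi>" "test_function \<Omega> \<psi>"
  shows "test_function \<Omega> (\<lambda>x. s * \<phi> x + t * \<psi> x)"
proof -
  obtain A B where "compact A" "A \<subseteq> \<Omega>" "\<forall>x. x \<notin> A \<longrightarrow> \<phi> x = 0" "compact B" "B \<subseteq> \<Omega>" "\<forall>x. x \<notin> B \<longrightarrow> \<psi> x = 0"
    using assms by (auto simp: test_function_def)
  hence "compact (A \<union> B) \<and> A \<union> B \<subseteq> \<Omega> \<and> (\<forall>x. x \<notin> A \<union> B \<longrightarrow> s * \<phi> x + t * \<psi> x = 0)"
    by (auto intro: compact_Un)
  moreover have "smooth (\<lambda>x. s * \<phi> x + t * \<psi> x)"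
    using assms by (simp add: test_function_def smooth_def Ck_add Ck_mult Ck_const)
  ultimately show ?thesis unfolding test_function_def by blast
qed

lemma gradient_lincomb:
  assumes "smooth \<phi>" "smooth \<psi>"
  shows "gradient (\<lambda>x. s * \<phi> x + t * \<psi> x) x = s *\<^sub>R gradient \<phi> x + t *\<^sub>R gradient \<psi> x"
  using assms by (subst gradient_add) (auto simp: gradient_scale smooth_differentiable)

lemma H10_is_weak_gradient: "v \<in> H10 \<Omega> \<Longrightarrow> is_weak_gradient \<Omega> v (weak_gradient \<Omega> v)"
  by (auto simp: H10_def H1_def intro: is_weak_gradient_weak_gradient)

lemma H10_square_integrable: "v \<in> H10 \<Omega> \<Longrightarrow> square_integrable (lebesgue_on \<Omega>) v"
  by (auto simp: H10_def H1_def)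

lemma H10_weak_gradient_square_integrable:
  assumes "open \<Omega>" "v \<in> H10 \<Omega>"
  shows "square_integrable (lebesgue_on \<Omega>) (weak_gradient \<Omega> v)"
proof -
  obtain g where g: "is_weak_gradient \<Omega> v g" "square_integrable (lebesgue_on \<Omega>) g"
    using assms(2) by (auto simp: H10_def H1_def)
  have "AE x in lebesgue_on \<Omega>. g x = weak_gradient \<Omega> v x"
    using weak_gradient_AE_eq[OF assms(1) g(1)] by eventually_elim simp
  moreover have "\<Omega> \<in> sets lebesgue" using assms(1) by simp
  ultimately show ?thesis using square_integrable_cong_AE[OF _ g(2)] by blast
qed

lemma weak_gradient_lincomb:
  assumes "open \<Omega>" "v \<in> H10 \<Omega>" "w \<in> H10 \<Omega>"
  shows "AE x in lebesgue_on \<Omega>. weak_gradient \<Omega> (\<lambda>x. s * v x + t * w x) x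
    = s *\<^sub>R weak_gradient \<Omega> v x + t *\<^sub>R weak_gradient \<Omega> w x"
  by (rule weak_gradient_AE_eq[OF assms(1) is_weak_gradient_lincomb[OF assms(1)]])
    (use assms H10_is_weak_gradient in auto)

text \<open>Combine the two approximating sequences. Their gradients converge to the combined weak
  gradients, and this limit may be exchanged for the chosen gradient of the combination because it
  differs on a null set only.\<close>

lemma H10_lincomb:
  assumes "open \<Omega>" "v \<in> H10 \<Omega>" "w \<in> H10 \<Omega>"
  shows "(\<lambda>x. s * v x + t * w x) \<in> H10 \<Omega>"
proof -
  let ?G = "\<lambda>x. s *\<^sub>R weak_gradient \<Omega> v x + t *\<^sub>R weak_gradient \<Omega> w x"
  obtain \<phi> where \<phi>: "\<And>n. test_function \<Omega> (\<phi> n)" "L2_tendsto (lebesgue_on \<Omega>) \<phi> v"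
      "L2_tendsto (lebesgue_on \<Omega>) (\<lambda>n. gradient (\<phi> n)) (weak_gradient \<Omega> v)"
    using assms(2) by (auto simp: H10_def)
  obtain \<psi> where \<psi>: "\<And>n. test_function \<Omega> (\<psi> n)" "L2_tendsto (lebesgue_on \<Omega>) \<psi> w"
      "L2_tendsto (lebesgue_on \<Omega>) (\<lambda>n. gradient (\<psi> n)) (weak_gradient \<Omega> w)"
    using assms(3) by (auto simp: H10_def)
  have G: "is_weak_gradient \<Omega> (\<lambda>x. s * v x + t * w x) ?G"
    by (intro is_weak_gradient_lincomb H10_is_weak_gradient assms)
  have "(\<lambda>x. s * v x + t * w x) \<in> H1 \<Omega>"
    using G square_integrable_lincomb[OF H10_square_integrable[OF assms(2)] H10_square_integrable[OF assms(3)]]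
      square_integrable_lincomb[OF H10_weak_gradient_square_integrable[OF assms(1,2)]
         H10_weak_gradient_square_integrable[OF assms(1,3)]]
    by (auto simp: H1_def)
  moreover have "L2_tendsto (lebesgue_on \<Omega>) (\<lambda>n x. s * \<phi> n x + t * \<psi> n x) (\<lambda>x. s * v x + t * w x)"
    using L2_tendsto_lincomb[OF \<phi>(2) \<psi>(2)] by simp
  moreover have "L2_tendsto (lebesgue_on \<Omega>) (\<lambda>n. gradient (\<lambda>x. s * \<phi> n x + t * \<psi> n x))
      (weak_gradient \<Omega> (\<lambda>x. s * v x + t * w x))"
  proof (rule L2_tendsto_cong_AE)
    have "(\<lambda>n. gradient (\<lambda>x. s * \<phi> n x + t * \<psi> n x))
        = (\<lambda>n x. s *\<^sub>R gradient (\<phi> n) x + t *\<^sub>R gradient (\<psi> n) x)"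
      using \<phi>(1) \<psi>(1) by (intro ext gradient_lincomb) (auto simp: test_function_def)
    thus "L2_tendsto (lebesgue_on \<Omega>) (\<lambda>n. gradient (\<lambda>x. s * \<phi> n x + t * \<psi> n x)) ?G"
      using L2_tendsto_lincomb[OF \<phi>(3) \<psi>(3)] by simp
    show "AE x in lebesgue_on \<Omega>. ?G x = weak_gradient \<Omega> (\<lambda>x. s * v x + t * w x) x"
      using weak_gradient_lincomb[OF assms, of s t] by eventually_elim simp
  qed (use assms in auto)
  ultimately show ?thesis
    unfolding H10_def
    by (intro CollectI conjI exI[of _ "\<lambda>n x. s * \<phi> n x + t * \<psi> n x"])
      (auto intro: test_function_lincomb \<phi>(1) \<psi>(1))
qed

lemma H10_zero:
  assumes "open \<Omega>"
  shows "(\<lambda>_. 0) \<in> H10 \<Omega>"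
proof -
  have t: "test_function \<Omega> (\<lambda>_. 0)"
    by (auto simp: test_function_def smooth_def Ck_const intro: exI[of _ "{}"])
  have g: "gradient (\<lambda>_. 0) x = 0" for x :: "real^'a"
    by (simp add: Finite_Cartesian_Product.vec_eq_iff gradient_nthI[OF has_derivative_const])
  have G: "is_weak_gradient \<Omega> (\<lambda>_. 0) (\<lambda>_. 0)"
    by (simp add: is_weak_gradient_def locally_integrable_def)
  have "L2_tendsto (lebesgue_on \<Omega>) (\<lambda>n. gradient (\<lambda>_. 0)) (weak_gradient \<Omega> (\<lambda>_. 0))"
  proof (rule L2_tendsto_cong_AE)
    show "AE x in lebesgue_on \<Omega>. 0 = weak_gradient \<Omega> (\<lambda>_. 0) x"
      using weak_gradient_AE_eq[OF assms G] by eventually_elim simp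
    show "L2_tendsto (lebesgue_on \<Omega>) (\<lambda>n. gradient (\<lambda>_. 0)) (\<lambda>_. 0)"
      by (simp add: L2_tendsto_def square_integrable_def g)
  qed (use assms in auto)
  with t G show ?thesis
    by (auto simp: H10_def H1_def square_integrable_def L2_tendsto_def
        intro!: exI[of _ "\<lambda>n _. 0"])
qed

section \<open>The bilinear forms of the model problem\<close>

text \<open>The common source of the Cauchy-Schwarz inequalities for the energy form and for the
  preconditioner. The sign of \<open>r\<close> is itself a consequence of nonnegativity.\<close>

lemma discriminant_le:
  fixes p q r :: real
  assumes "\<And>t. 0 \<le> p + 2 * t * q + t\<^sup>2 * r"
  shows "q\<^sup>2 \<le> p * r"
proof -
  consider "r = 0" | "r \<noteq> 0" by blast
  thus ?thesis
  proof cases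
    case 1
    have "q = 0"
    proof (rule ccontr)
      assume ne: "q \<noteq> 0"
      \<comment> \<open>At this point the linear polynomial takes the value -1.\<close>
      have "0 \<le> p + 2 * (- (p + 1) / (2 * q)) * q + (- (p + 1) / (2 * q))\<^sup>2 * r" by (rule assms)
      thus False using 1 ne by (simp add: field_simps)
    qed
    thus ?thesis using 1 by simp
  next
    case 2
    \<comment> \<open>Evaluation at the vertex of the parabola.\<close>
    have "0 \<le> p + 2 * (- q / r) * q + (- q / r)\<^sup>2 * r" by (rule assms)
    also have "\<dots> = (p * r - q\<^sup>2) / r" using 2 by (simp add: field_simps power2_eq_square)
    finally have "0 \<le> (p * r - q\<^sup>2) / r" .
    moreover have "0 \<le> r"
    proof (rule ccontr)
      assume "\<not> 0 \<le> r"
      hence r: "r < 0" by simp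
      \<comment> \<open>Chosen so that t is at least 1 and t (-r) exceeds |p| + 2 |q|; then the
        quadratic term outweighs the other two and the value is negative.\<close>
      define t where "t = (\<bar>p\<bar> + 2 * \<bar>q\<bar> + 1) / (- r) + 1"
      have t1: "1 \<le> t" using r by (simp add: t_def field_simps)
      have "t * (- r) = \<bar>p\<bar> + 2 * \<bar>q\<bar> + 1 + (- r)" using r by (simp add: t_def field_simps)
      hence tr: "\<bar>p\<bar> + 2 * \<bar>q\<bar> < t * (- r)" using r by argo
      have "p \<le> t * \<bar>p\<bar>" using t1 mult_right_mono[OF t1, of "\<bar>p\<bar>"] by argo
      moreover have "2 * t * q \<le> t * (2 * \<bar>q\<bar>)" using t1 by (simp add: mult_left_mono)
      moreover have "t * (\<bar>p\<bar> + 2 * \<bar>q\<bar>) < t * (t * (- r))" using mult_strict_left_mono[OF tr, of t] t1 by simp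
      ultimately have "p + 2 * t * q + t\<^sup>2 * r < 0"
        by (simp add: power2_eq_square algebra_simps)
      with assms[of t] show False by simp
    qed
    ultimately show ?thesis using 2 by (simp add: zero_le_divide_iff)
  qed
qed

text \<open>The minimiser of the Rayleigh quotient on the unit sphere is an eigenvector.\<close>

lemma symmetric_matrix_psd_if_eigenvalues_nonneg:
  fixes A :: "real^'n^'n"
  assumes sym: "transpose A = A"
    and eig: "\<And>\<mu> z. z \<noteq> 0 \<Longrightarrow> A *v z = \<mu> *\<^sub>R z \<Longrightarrow> 0 \<le> \<mu>"
  shows "0 \<le> (A *v z) \<bullet> z"
proof -
  have A_sym: "(A *v x) \<bullet> y = (A *v y) \<bullet> x" for x y
    by (metis dot_lmul_matrix inner_commute sym transpose_matrix_vector)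
  have cont: "continuous_on S (\<lambda>z. (A *v z) \<bullet> z)" for S
    by (intro continuous_intros linear_continuous_on matrix_vector_mul_bounded_linear)
  have "sphere 0 1 \<noteq> ({} :: (real^'n) set)" by simp
  then obtain z0 where z0: "norm z0 = 1" "\<And>y. norm y = 1 \<Longrightarrow> (A *v z0) \<bullet> z0 \<le> (A *v y) \<bullet> y"
    using continuous_attains_inf[OF compact_sphere _ cont, of 0 1] by auto
  define \<mu> where "\<mu> = (A *v z0) \<bullet> z0"
  have ge: "\<mu> * (y \<bullet> y) \<le> (A *v y) \<bullet> y" for y
  proof (cases "y = 0")
    case False
    define e where "e = inverse (norm y) *\<^sub>R y"
    have e: "norm e = 1" "y = norm y *\<^sub>R e" using False by (simp_all add: e_def)
    have "\<mu> * (norm y)\<^sup>2 \<le> ((A *v e) \<bullet> e) * (norm y)\<^sup>2"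
      using z0(2)[OF e(1)] by (intro mult_right_mono) (auto simp: \<mu>_def)
    also have "\<dots> = (A *v (norm y *\<^sub>R e)) \<bullet> (norm y *\<^sub>R e)"
      by (simp add: matrix_vector_mult_scaleR power2_eq_square)
    also have "\<dots> = (A *v y) \<bullet> y" by (simp only: e(2)[symmetric])
    finally show ?thesis by (simp add: power2_norm_eq_inner)
  qed simp
  \<comment> \<open>The form of \<open>A\<close> minus \<mu> times the identity is nonnegative and
    vanishes at \<open>z0\<close>. The discriminant inequality with constant term 0 then makes
    \<open>A *v z0 - \<mu> *\<^sub>R z0\<close> orthogonal to every \<open>y\<close>.\<close>
  have "((A *v z0) \<bullet> y - \<mu> * (z0 \<bullet> y))\<^sup>2 \<le> 0 * ((A *v y) \<bullet> y - \<mu> * (y \<bullet> y))" for y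
  proof (rule discriminant_le)
    fix t
    have "0 \<le> (A *v (z0 + t *\<^sub>R y)) \<bullet> (z0 + t *\<^sub>R y) - \<mu> * ((z0 + t *\<^sub>R y) \<bullet> (z0 + t *\<^sub>R y))"
      using ge[of "z0 + t *\<^sub>R y"] by simp
    also have "\<dots> = 2 * t * ((A *v z0) \<bullet> y - \<mu> * (z0 \<bullet> y)) + t\<^sup>2 * ((A *v y) \<bullet> y - \<mu> * (y \<bullet> y))
        + (\<mu> - \<mu> * (z0 \<bullet> z0))"
      using A_sym[of y z0]
      by (simp add: matrix_vector_right_distrib matrix_vector_mult_scaleR inner_simps \<mu>_def
          inner_commute[of y z0] power2_eq_square algebra_simps)
    finally show "0 \<le> 0 + 2 * t * ((A *v z0) \<bullet> y - \<mu> * (z0 \<bullet> y)) + t\<^sup>2 * ((A *v y) \<bullet> y - \<mu> * (y \<bullet> y))"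
      using z0(1) by (simp add: dot_square_norm)
  qed
  hence "(A *v z0 - \<mu> *\<^sub>R z0) \<bullet> y = 0" for y by (simp add: inner_diff_left)
  hence "A *v z0 - \<mu> *\<^sub>R z0 = 0" using inner_eq_zero_iff by blast
  hence "0 \<le> \<mu>" using eig[of z0 \<mu>] z0(1) by force
  hence "0 \<le> \<mu> * (z \<bullet> z)" by simp
  thus ?thesis using ge[of z] by simp
qed

section \<open>Integrability of products of bounded and square-integrable functions\<close>

lemma borel_measurable_vec_nth:
  fixes f :: "'a \<Rightarrow> ('b::euclidean_space)^'n"
  assumes "f \<in> borel_measurable M"
  shows "(\<lambda>x. f x $ i) \<in> borel_measurable M"
  by (rule borel_measurable_continuous_on[OF _ assms]) (intro continuous_intros)

lemma square_integrable_vec_nth: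
  fixes f :: "'a \<Rightarrow> real^'n"
  assumes "square_integrable M f"
  shows "square_integrable M (\<lambda>x. f x $ i)"
proof -
  have m: "(\<lambda>x. f x $ i) \<in> borel_measurable M"
    using assms borel_measurable_vec_nth by (auto simp: square_integrable_def)
  have le: "(f x $ i)\<^sup>2 \<le> (norm (f x))\<^sup>2" for x
    using Finite_Cartesian_Product.norm_nth_le[of "f x" i]
    by (metis abs_norm_cancel abs_le_square_iff real_norm_def)
  have "integrable M (\<lambda>x. (norm (f x))\<^sup>2)" using assms by (simp add: square_integrable_def)
  hence "integrable M (\<lambda>x. (norm (f x $ i))\<^sup>2)"
    by (rule Bochner_Integration.integrable_bound)
      (use m le in auto)
  with m show ?thesis by (simp add: square_integrable_def)
qed

lemma ess_bounded_vec_nth: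
  fixes f :: "'a \<Rightarrow> ('b::euclidean_space)^'n"
  assumes "ess_bounded M f"
  shows "ess_bounded M (\<lambda>x. f x $ i)"
proof -
  obtain C where C: "AE x in M. norm (f x) \<le> C" using assms by (auto simp: ess_bounded_def)
  have "AE x in M. norm (f x $ i) \<le> C"
    using C by eventually_elim (meson Finite_Cartesian_Product.norm_nth_le order_trans)
  thus ?thesis using assms borel_measurable_vec_nth by (auto simp: ess_bounded_def)
qed

text \<open>A constant times f^2 + g^2 dominates the product. The vector and matrix versions below
  reduce to this one by components.\<close>

lemma integrable_bounded_mult_L2:
  fixes c f g :: "'a \<Rightarrow> real"
  assumes "ess_bounded M c" "square_integrable M f" "square_integrable M g"
  shows "integrable M (\<lambda>x. c x * f x * g x)"
proof -
  obtain C where C: "AE x in M. \<bar>c x\<bar> \<le> C" using assms by (auto simp: ess_bounded_def)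
  have "integrable M (\<lambda>x. C * ((f x)\<^sup>2 + (g x)\<^sup>2))"
    using assms by (auto simp: square_integrable_def)
  thus ?thesis
  proof (rule Bochner_Integration.integrable_bound)
    show "(\<lambda>x. c x * f x * g x) \<in> borel_measurable M"
      using assms by (auto simp: square_integrable_def ess_bounded_def)
    show "AE x in M. norm (c x * f x * g x) \<le> norm (C * ((f x)\<^sup>2 + (g x)\<^sup>2))"
      using C
    proof eventually_elim
      case (elim x)
      have "\<bar>f x\<bar> * \<bar>g x\<bar> \<le> (f x)\<^sup>2 + (g x)\<^sup>2"
      proof -
        have "\<bar>f x\<bar> * \<bar>g x\<bar> \<le> 2 * \<bar>f x\<bar> * \<bar>g x\<bar>" by simp
        also have "\<dots> \<le> \<bar>f x\<bar>\<^sup>2 + \<bar>g x\<bar>\<^sup>2" by (rule sum_squares_bound)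
        finally show ?thesis by simp
      qed
      hence "\<bar>c x\<bar> * (\<bar>f x\<bar> * \<bar>g x\<bar>) \<le> C * ((f x)\<^sup>2 + (g x)\<^sup>2)"
        using elim by (intro mult_mono) auto
      moreover have "\<bar>C\<bar> = C" using elim by linarith
      ultimately show ?case by (simp add: abs_mult mult.assoc)
    qed
  qed
qed

lemma integrable_bounded_inner_mult_L2:
  fixes f g :: "'a \<Rightarrow> real^'n"
  assumes "ess_bounded M f" "square_integrable M g" "square_integrable M w"
  shows "integrable M (\<lambda>x. (f x \<bullet> g x) * w x)"
proof -
  have "integrable M (\<lambda>x. \<Sum>i\<in>UNIV. f x $ i * g x $ i * w x)"
    by (intro Bochner_Integration.integrable_sum integrable_bounded_mult_L2 ess_bounded_vec_nth
        square_integrable_vec_nth assms)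
  thus ?thesis by (simp add: inner_vec_def sum_distrib_right)
qed

lemma integrable_matrix_inner_L2:
  fixes f g :: "'a \<Rightarrow> real^'n" and A :: "'a \<Rightarrow> real^'n^'n"
  assumes "ess_bounded M A" "square_integrable M f" "square_integrable M g"
  shows "integrable M (\<lambda>x. (A x *v f x) \<bullet> g x)"
proof -
  have "integrable M (\<lambda>x. \<Sum>i\<in>UNIV. \<Sum>j\<in>UNIV. A x $ i $ j * f x $ j * g x $ i)"
    by (intro Bochner_Integration.integrable_sum integrable_bounded_mult_L2 ess_bounded_vec_nth
        square_integrable_vec_nth assms)
  thus ?thesis by (simp add: inner_vec_def matrix_vector_mult_def sum_distrib_right)
qed

lemma integral_lincomb_AE:
  fixes f g :: "'a \<Rightarrow> real"
  assumes "integrable M f" "integrable M g" "integrable M h"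
    and "AE x in M. h x = s * f x + t * g x"
  shows "(\<integral>x. h x \<partial>M) = s * (\<integral>x. f x \<partial>M) + t * (\<integral>x. g x \<partial>M)"
proof -
  have "(\<integral>x. h x \<partial>M) = (\<integral>x. s *\<^sub>R f x + t *\<^sub>R g x \<partial>M)"
    by (rule integral_cong_AE) (use assms in auto)
  thus ?thesis using integral_lincomb[OF assms(1,2), of s t] by simp
qed

section \<open>Bilinearity, symmetry and nonnegativity of the forms\<close>

context
  fixes D :: "'d::finite pde"
  assumes mp: "model_problem D"
begin

lemma open_dom: "open (dom D)"
  using mp by (simp add: model_problem_def lipschitz_domain_def)

lemma model_L2:
  assumes "v \<in> H10 (dom D)"
  shows "square_integrable (lebesgue_on (dom D)) v" "square_integrable (lebesgue_on (dom D)) (grad D v)"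
  using assms H10_square_integrable H10_weak_gradient_square_integrable[OF open_dom]
  by (auto simp: grad_def)

lemma model_coefficients:
  shows "ess_bounded (lebesgue_on (dom D)) (diffusion D)"
    "ess_bounded (lebesgue_on (dom D)) (convection D)"
    "ess_bounded (lebesgue_on (dom D)) (reaction D)"
    "square_integrable (lebesgue_on (dom D)) (source D)"
    "square_integrable (lebesgue_on (dom D)) (flux_source D)"
  using mp by (auto simp: model_problem_def)

lemma grad_lincomb:
  assumes "v \<in> H10 (dom D)" "w \<in> H10 (dom D)"
  shows "AE x in lebesgue_on (dom D). grad D (\<lambda>x. s * v x + t * w x) x = s *\<^sub>R grad D v x + t *\<^sub>R grad D w x"
  unfolding grad_def by (rule weak_gradient_lincomb[OF open_dom assms])

lemma model_lincomb: 
  "v \<in> H10 (dom D) \<Longrightarrow> w \<in> H10 (dom D) \<Longrightarrow> (\<lambda>x. s * v x + t * w x) \<in> H10 (dom D)"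
  by (rule H10_lincomb[OF open_dom])

lemma aform_lincomb_left:
  assumes "v \<in> H10 (dom D)" "w \<in> H10 (dom D)" "z \<in> H10 (dom D)"
  shows "aform D (\<lambda>x. s * v x + t * w x) z = s * aform D v z + t * aform D w z"
  unfolding aform_def
proof (rule integral_lincomb_AE)
  show "AE x in lebesgue_on (dom D). (diffusion D x *v grad D (\<lambda>x. s * v x + t * w x) x) \<bullet> grad D z x
    = s * ((diffusion D x *v grad D v x) \<bullet> grad D z x) + t * ((diffusion D x *v grad D w x) \<bullet> grad D z x)"
    using grad_lincomb[OF assms(1,2), of s t]
    by eventually_elim (simp add: matrix_vector_right_distrib matrix_vector_mult_scaleR inner_add_left)
qed (intro integrable_matrix_inner_L2 model_coefficients model_L2 model_lincomb assms)+

lemma aform_commute: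
  assumes "v \<in> H10 (dom D)" "w \<in> H10 (dom D)"
  shows "aform D v w = aform D w v"
  unfolding aform_def
proof (rule integral_cong_AE)
  have "AE x in lebesgue_on (dom D). transpose (diffusion D x) = diffusion D x"
    using mp by (simp add: model_problem_def)
  thus "AE x in lebesgue_on (dom D).
      (diffusion D x *v grad D v x) \<bullet> grad D w x = (diffusion D x *v grad D w x) \<bullet> grad D v x"
    by eventually_elim (metis dot_lmul_matrix inner_commute transpose_matrix_vector)
qed (intro borel_measurable_integrable integrable_matrix_inner_L2 model_coefficients model_L2 assms)+

text \<open>The model problem bounds the eigenvalues of the diffusion matrix; symmetry turns this
  into a pointwise sign of the integrand.\<close>

lemma aform_nonneg:
  assumes "v \<in> H10 (dom D)"
  shows "0 \<le> aform D v v"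
  unfolding aform_def
proof (rule integral_nonneg_AE)
  obtain \<kappa> where "\<kappa> > 0" and \<kappa>: "AE x in lebesgue_on (dom D).
      \<forall>\<mu> z. z \<noteq> 0 \<and> diffusion D x *v z = \<mu> *\<^sub>R z \<longrightarrow> \<kappa> \<le> \<mu>"
    using mp by (auto simp: model_problem_def)
  have "AE x in lebesgue_on (dom D). transpose (diffusion D x) = diffusion D x"
    using mp by (simp add: model_problem_def)
  with \<kappa> show "AE x in lebesgue_on (dom D). 0 \<le> (diffusion D x *v grad D v x) \<bullet> grad D v x"
  proof eventually_elim
    case (elim x)
    show ?case
      by (rule symmetric_matrix_psd_if_eigenvalues_nonneg)
        (use elim \<open>\<kappa> > 0\<close> in \<open>auto intro: order_trans[of 0 \<kappa>]\<close>)
  qed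
qed

lemma bform_lincomb_left:
  assumes "v \<in> H10 (dom D)" "w \<in> H10 (dom D)" "z \<in> H10 (dom D)"
  shows "bform D (\<lambda>x. s * v x + t * w x) z = s * bform D v z + t * bform D w z"
proof -
  let ?M = "lebesgue_on (dom D)"
  have "(\<integral>x. (convection D x \<bullet> grad D (\<lambda>x. s * v x + t * w x) x) * z x \<partial>?M)
      = s * (\<integral>x. (convection D x \<bullet> grad D v x) * z x \<partial>?M) + t * (\<integral>x. (convection D x \<bullet> grad D w x) * z x \<partial>?M)"
  proof (rule integral_lincomb_AE)
    show "AE x in ?M. (convection D x \<bullet> grad D (\<lambda>x. s * v x + t * w x) x) * z x
      = s * ((convection D x \<bullet> grad D v x) * z x) + t * ((convection D x \<bullet> grad D w x) * z x)"
      using grad_lincomb[OF assms(1,2), of s t] by eventually_elim (simp add: inner_simps algebra_simps)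
  qed (intro integrable_bounded_inner_mult_L2 model_coefficients model_L2 model_lincomb assms)+
  moreover have "(\<integral>x. reaction D x * (s * v x + t * w x) * z x \<partial>?M)
      = s * (\<integral>x. reaction D x * v x * z x \<partial>?M) + t * (\<integral>x. reaction D x * w x * z x \<partial>?M)"
  proof (rule integral_lincomb_AE)
    show "integrable ?M (\<lambda>x. reaction D x * (s * v x + t * w x) * z x)"
      by (intro integrable_bounded_mult_L2 model_coefficients model_L2 model_lincomb assms)
    show "AE x in ?M. reaction D x * (s * v x + t * w x) * z x = s * (reaction D x * v x * z x) + t * (reaction D x * w x * z x)"
      by (rule AE_I2) (simp add: algebra_simps)
  qed (intro integrable_bounded_mult_L2 model_coefficients model_L2 assms)+
  ultimately show ?thesis
    by (simp add: bform_def aform_lincomb_left assms algebra_simps)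
qed

lemma aform_lincomb_right:
  assumes "v \<in> H10 (dom D)" "w \<in> H10 (dom D)" "z \<in> H10 (dom D)"
  shows "aform D z (\<lambda>x. s * v x + t * w x) = s * aform D z v + t * aform D z w"
  by (simp add: aform_commute[of z] assms model_lincomb aform_lincomb_left)

lemma bform_lincomb_right:
  assumes "v \<in> H10 (dom D)" "w \<in> H10 (dom D)" "z \<in> H10 (dom D)"
  shows "bform D z (\<lambda>x. s * v x + t * w x) = s * bform D z v + t * bform D z w"
proof -
  let ?M = "lebesgue_on (dom D)"
  have "(\<integral>x. (convection D x \<bullet> grad D z x) * (s * v x + t * w x) \<partial>?M)
      = s * (\<integral>x. (convection D x \<bullet> grad D z x) * v x \<partial>?M) + t * (\<integral>x. (convection D x \<bullet> grad D z x) * w x \<partial>?M)"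
  proof (rule integral_lincomb_AE)
    show "integrable ?M (\<lambda>x. (convection D x \<bullet> grad D z x) * (s * v x + t * w x))"
      by (intro integrable_bounded_inner_mult_L2 model_coefficients model_L2 model_lincomb assms)
    show "AE x in ?M. (convection D x \<bullet> grad D z x) * (s * v x + t * w x)
      = s * ((convection D x \<bullet> grad D z x) * v x) + t * ((convection D x \<bullet> grad D z x) * w x)"
      by (rule AE_I2) (simp add: algebra_simps)
  qed (intro integrable_bounded_inner_mult_L2 model_coefficients model_L2 assms)+
  moreover have "(\<integral>x. reaction D x * z x * (s * v x + t * w x) \<partial>?M)
      = s * (\<integral>x. reaction D x * z x * v x \<partial>?M) + t * (\<integral>x. reaction D x * z x * w x \<partial>?M)"
  proof (rule integral_lincomb_AE)
    show "integrable ?M (\<lambda>x. reaction D x * z x * (s * v x + t * w x))"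
      by (intro integrable_bounded_mult_L2 model_coefficients model_L2 model_lincomb assms)
    show "AE x in ?M. reaction D x * z x * (s * v x + t * w x) = s * (reaction D x * z x * v x) + t * (reaction D x * z x * w x)"
      by (rule AE_I2) (simp add: algebra_simps)
  qed (intro integrable_bounded_mult_L2 model_coefficients model_L2 assms)+
  ultimately show ?thesis
    by (simp add: bform_def aform_lincomb_right assms algebra_simps)
qed

end

section \<open>Galerkin approximation in nested subspaces\<close>

text \<open>The form \<open>a\<close> is only positive semidefinite: functions that agree almost
  everywhere are not identified, so \<open>nrm\<close> is a seminorm on \<open>V\<close>.\<close>

locale elliptic_form =
  fixes V :: "('a \<Rightarrow> real) set"
    and a b :: "('a \<Rightarrow> real) \<Rightarrow> ('a \<Rightarrow> real) \<Rightarrow> real"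
    and Cell Cbnd :: real
  assumes zero_mem: "(\<lambda>_. 0) \<in> V"
    and lincomb_mem: "v \<in> V \<Longrightarrow> w \<in> V \<Longrightarrow> (\<lambda>x. s * v x + t * w x) \<in> V"
    and a_left: "v \<in> V \<Longrightarrow> w \<in> V \<Longrightarrow> z \<in> V \<Longrightarrow> a (\<lambda>x. s * v x + t * w x) z = s * a v z + t * a w z"
    and a_commute: "v \<in> V \<Longrightarrow> w \<in> V \<Longrightarrow> a v w = a w v"
    and a_nonneg: "v \<in> V \<Longrightarrow> 0 \<le> a v v"
    and b_left: "v \<in> V \<Longrightarrow> w \<in> V \<Longrightarrow> z \<in> V \<Longrightarrow> b (\<lambda>x. s * v x + t * w x) z = s * b v z + t * b w z"
    and b_right: "v \<in> V \<Longrightarrow> w \<in> V \<Longrightarrow> z \<in> V \<Longrightarrow> b z (\<lambda>x. s * v x + t * w x) = s * b z v + t * b z w"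
    and b_bounded: "v \<in> V \<Longrightarrow> w \<in> V \<Longrightarrow> \<bar>b v w\<bar> \<le> Cbnd * sqrt (a v v) * sqrt (a w w)"
    and b_elliptic: "v \<in> V \<Longrightarrow> Cell * a v v \<le> b v v"
    and Cell_pos: "0 < Cell"
    and Cell_le: "Cell \<le> Cbnd"
begin

abbreviation nrm :: "('a \<Rightarrow> real) \<Rightarrow> real" where "nrm v \<equiv> sqrt (a v v)"

abbreviation dst :: "('a \<Rightarrow> real) \<Rightarrow> ('a \<Rightarrow> real) \<Rightarrow> real" where "dst v w \<equiv> nrm (\<lambda>x. v x - w x)"

definition subspace_V :: "('a \<Rightarrow> real) set \<Rightarrow> bool" where
  "subspace_V X \<longleftrightarrow> X \<subseteq> V \<and> (\<lambda>_. 0) \<in> X \<and>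
     (\<forall>v\<in>X. \<forall>w\<in>X. \<forall>s t. (\<lambda>x. s * v x + t * w x) \<in> X)"

lemma Cbnd_pos: "0 < Cbnd"
  using Cell_pos Cell_le by linarith

lemma a_right:
  "v \<in> V \<Longrightarrow> w \<in> V \<Longrightarrow> z \<in> V \<Longrightarrow> a z (\<lambda>x. s * v x + t * w x) = s * a z v + t * a z w"
  by (simp add: a_commute[of z] lincomb_mem a_left)

lemma diff_mem: "v \<in> V \<Longrightarrow> w \<in> V \<Longrightarrow> (\<lambda>x. v x - w x) \<in> V"
  using lincomb_mem[of v w 1 "- 1"] by simp

lemma b_diff_left: "v \<in> V \<Longrightarrow> w \<in> V \<Longrightarrow> z \<in> V \<Longrightarrow> b (\<lambda>x. v x - w x) z = b v z - b w z"
  using b_left[of v w z 1 "- 1"] by simp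

lemma a_lincomb_lincomb:
  assumes "v \<in> V" "w \<in> V"
  shows "a (\<lambda>x. s * v x + t * w x) (\<lambda>x. s * v x + t * w x)
    = s\<^sup>2 * a v v + 2 * s * t * a v w + t\<^sup>2 * a w w"
  using assms a_commute[of w v]
  by (simp add: a_left a_right lincomb_mem power2_eq_square algebra_simps)

lemma a_Cauchy_Schwarz:
  assumes "v \<in> V" "w \<in> V"
  shows "\<bar>a v w\<bar> \<le> nrm v * nrm w"
proof -
  have "(a v w)\<^sup>2 \<le> a v v * a w w"
    by (rule discriminant_le)
      (use a_nonneg[OF lincomb_mem[OF assms, of 1]] a_lincomb_lincomb[OF assms, of 1] in simp)
  hence "sqrt ((a v w)\<^sup>2) \<le> sqrt (a v v * a w w)" by (rule real_sqrt_le_mono)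
  thus ?thesis by (simp add: real_sqrt_mult)
qed

lemma nrm_nonneg: "v \<in> V \<Longrightarrow> 0 \<le> nrm v"
  by (simp add: a_nonneg)

lemma nrm_sq: "v \<in> V \<Longrightarrow> (nrm v)\<^sup>2 = a v v"
  by (simp add: a_nonneg)

lemma nrm_lincomb_le:
  assumes "v \<in> V" "w \<in> V"
  shows "nrm (\<lambda>x. s * v x + t * w x) \<le> \<bar>s\<bar> * nrm v + \<bar>t\<bar> * nrm w"
proof (rule real_le_lsqrt)
  have "s * t * a v w \<le> \<bar>s\<bar> * \<bar>t\<bar> * \<bar>a v w\<bar>" by (metis abs_ge_self abs_mult)
  also have "\<dots> \<le> \<bar>s\<bar> * \<bar>t\<bar> * (nrm v * nrm w)"
    by (intro mult_left_mono a_Cauchy_Schwarz assms) auto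
  finally have "s * t * a v w \<le> \<bar>s\<bar> * \<bar>t\<bar> * (nrm v * nrm w)" .
  moreover have "(\<bar>s\<bar> * nrm v + \<bar>t\<bar> * nrm w)\<^sup>2 = s\<^sup>2 * a v v + 2 * (\<bar>s\<bar> * \<bar>t\<bar> * (nrm v * nrm w)) + t\<^sup>2 * a w w"
    using nrm_sq[OF assms(1)] nrm_sq[OF assms(2)] by (simp add: power2_sum power_mult_distrib)
  ultimately show "a (\<lambda>x. s * v x + t * w x) (\<lambda>x. s * v x + t * w x) \<le> (\<bar>s\<bar> * nrm v + \<bar>t\<bar> * nrm w)\<^sup>2"
    by (simp add: a_lincomb_lincomb assms)
qed (use assms a_nonneg lincomb_mem in auto)

lemma dst_triangle:
  assumes "u \<in> V" "v \<in> V" "w \<in> V"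
  shows "dst u w \<le> dst u v + dst v w"
  using nrm_lincomb_le[OF diff_mem[OF assms(1,2)] diff_mem[OF assms(2,3)], of 1 1] by simp

lemma dst_commute:
  assumes "u \<in> V" "v \<in> V"
  shows "dst u v = dst v u"
proof (rule antisym)
  have "dst v u \<le> dst u v" if "u \<in> V" "v \<in> V" for u v
    using nrm_lincomb_le[OF diff_mem[OF that] zero_mem, of "- 1" 0] by simp
  thus "dst u v \<le> dst v u" "dst v u \<le> dst u v" using assms by auto
qed

lemma dst_nonneg: "u \<in> V \<Longrightarrow> v \<in> V \<Longrightarrow> 0 \<le> dst u v"
  by (intro nrm_nonneg diff_mem)

text \<open>Ellipticity bounds Cell times the square of \<open>nrm e\<close>, and one factor
  \<open>nrm e\<close> cancels; if it is zero the bound is trivial. All a priori and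
  quasi-optimality estimates below end with this step.\<close>

lemma elliptic_bound:
  assumes "e \<in> V" "b e e \<le> r * nrm e" "0 \<le> r"
  shows "nrm e \<le> r / Cell"
proof -
  have "Cell * (nrm e)\<^sup>2 \<le> r * nrm e"
    using b_elliptic[OF assms(1)] nrm_sq[OF assms(1)] assms(2) by simp
  hence "nrm e * (Cell * nrm e) \<le> nrm e * r" by (simp add: power2_eq_square algebra_simps)
  show ?thesis
  proof (cases "nrm e = 0")
    case False
    hence "nrm e > 0" using nrm_nonneg[OF assms(1)] by linarith
    with \<open>nrm e * (Cell * nrm e) \<le> nrm e * r\<close> have "Cell * nrm e \<le> r" by simp
    thus ?thesis using Cell_pos by (simp add: field_simps)
  qed (use assms(3) Cell_pos in simp)
qed

lemma a_parallelogram: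
  assumes "v \<in> V" "w \<in> V"
  shows "a (\<lambda>x. v x - w x) (\<lambda>x. v x - w x)
    = 2 * a v v + 2 * a w w - 4 * a (\<lambda>x. 1/2 * v x + 1/2 * w x) (\<lambda>x. 1/2 * v x + 1/2 * w x)"
  using a_lincomb_lincomb[OF assms, of 1 "- 1"] a_lincomb_lincomb[OF assms, of "1/2" "1/2"]
  by (simp add: power2_eq_square)

text \<open>
  No completeness of \<open>V\<close> is needed: elements of nearly minimal norm in the decreasing convex sets
  \<open>S m\<close> of functions that satisfy the Galerkin equations tested with \<open>X m\<close> form a Cauchy sequence
  by the parallelogram law, and the Galerkin solutions stay close to it by ellipticity.
\<close>

lemma galerkin_increments_tendsto_0:
  fixes X :: "nat \<Rightarrow> ('a \<Rightarrow> real) set"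
  assumes sub: "\<And>n. subspace_V (X n)" and mono: "\<And>n. X n \<subseteq> X (Suc n)"
    and u: "\<And>n. u n \<in> X n" and us: "us \<in> V"
    and gal: "\<And>n v. v \<in> X n \<Longrightarrow> b (u n) v = b us v"
  shows "(\<lambda>n. dst (u (Suc n)) (u n)) \<longlonglongrightarrow> 0"
proof -
  have XV: "v \<in> V" if "v \<in> X n" for v n
    using sub[of n] that unfolding subspace_V_def by blast
  have Xmono: "X m \<subseteq> X n" if "m \<le> n" for m n
    using mono that by (rule lift_Suc_mono_le)
  have Xlin: "(\<lambda>x. s * v x + t * w x) \<in> X n" if "v \<in> X n" "w \<in> X n" for v w s t n
    using sub[of n] that unfolding subspace_V_def by blast
  \<comment> \<open>The sets shrink as \<open>m\<close> grows, yet \<open>S m\<close> contains every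
    \<open>u n\<close> with \<open>m \<le> n\<close>. Hence the infima \<nu> of the energy
    increase.\<close>
  define S where "S m = {z \<in> (\<Union>n. X n). \<forall>v\<in>X m. b z v = b us v}" for m
  have SV: "z \<in> V" if "z \<in> S m" for z m using that XV by (auto simp: S_def)
  have S_mono: "S n \<subseteq> S m" if "m \<le> n" for m n using Xmono[OF that] by (auto simp: S_def)
  have uS: "u n \<in> S m" if "m \<le> n" for m n
    using u[of n] gal[of _ n] Xmono[OF that] by (auto simp: S_def)
  have S_mid: "(\<lambda>x. 1/2 * z x + 1/2 * w x) \<in> S m" if z: "z \<in> S m" and w: "w \<in> S m" for z w m
  proof -
    obtain i j where "z \<in> X i" "w \<in> X j" using z w by (auto simp: S_def)
    hence "z \<in> X (max i j)" "w \<in> X (max i j)" using Xmono[of i "max i j"] Xmono[of j "max i j"] by auto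
    hence "(\<lambda>x. 1/2 * z x + 1/2 * w x) \<in> X (max i j)" by (rule Xlin)
    moreover have "b (\<lambda>x. 1/2 * z x + 1/2 * w x) v = b us v" if "v \<in> X m" for v
      using z w that by (subst b_left) (auto simp: SV XV S_def)
    ultimately show ?thesis unfolding S_def by blast
  qed
  define \<nu> where "\<nu> m = (INF z\<in>S m. a z z)" for m
  have bdd: "bdd_below ((\<lambda>z. a z z) ` S m)" for m
    by (rule bdd_belowI2[where m=0]) (use SV a_nonneg in auto)
  have \<nu>_le: "\<nu> m \<le> a z z" if "z \<in> S m" for z m
    unfolding \<nu>_def by (rule cINF_lower[OF bdd that])
  have "incseq \<nu>"
  proof (intro monoI)
    fix m n :: nat assume "m \<le> n"
    show "\<nu> m \<le> \<nu> n"
      unfolding \<nu>_def using uS[of n n] by (intro cINF_superset_mono bdd S_mono \<open>m \<le> n\<close>) auto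
  qed
  \<comment> \<open>The energy of \<open>u m\<close> bounds the infimum, and the a priori estimate
    for \<open>u m\<close> does not depend on \<open>m\<close>.\<close>
  moreover have "\<nu> m \<le> (Cbnd * nrm us / Cell)\<^sup>2" for m
  proof -
    have um: "u m \<in> V" using u XV by blast
    have "b (u m) (u m) = b us (u m)" using gal u by blast
    also have "\<dots> \<le> Cbnd * nrm us * nrm (u m)" using b_bounded[OF us um] by simp
    finally have "nrm (u m) \<le> Cbnd * nrm us / Cell"
      by (intro elliptic_bound um) (auto intro!: mult_nonneg_nonneg nrm_nonneg us less_imp_le[OF Cbnd_pos])
    hence "(nrm (u m))\<^sup>2 \<le> (Cbnd * nrm us / Cell)\<^sup>2" by (intro power_mono nrm_nonneg um)
    thus ?thesis using \<nu>_le[OF uS[of m m]] nrm_sq[OF um] by simp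
  qed
  ultimately obtain L where L: "\<nu> \<longlonglongrightarrow> L" "\<And>m. \<nu> m \<le> L"
    using incseq_convergent by blast
  \<comment> \<open>Slack for infima that need not be attained; any positive decreasing null
    sequence would do.\<close>
  define h :: "nat \<Rightarrow> real" where "h m = 1 / Suc m" for m
  have h: "0 < h m" "m \<le> k \<Longrightarrow> h k \<le> h m" for m k by (auto simp: h_def frac_le)
  have "\<exists>z\<in>S m. a z z < \<nu> m + h m" for m
  proof -
    have "\<nu> m < \<nu> m + h m" using h by simp
    thus ?thesis unfolding \<nu>_def by (subst (asm) cINF_less_iff[OF _ bdd]) (use uS in auto)
  qed
  then obtain z where z: "\<And>m. z m \<in> S m" "\<And>m. a (z m) (z m) < \<nu> m + h m" by metis
  have zV: "z m \<in> V" for m using z SV by blast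
  \<comment> \<open>The midpoint of \<open>z k\<close> and \<open>z m\<close> stays in
    \<open>S m\<close>, so its energy is at least \<open>\<nu> m\<close>; the parallelogram law then
    leaves only the gap between \<nu> and its limit, plus the slack.\<close>
  have close: "(dst (z k) (z m))\<^sup>2 \<le> 4 * (L - \<nu> m) + 4 * h m" if "m \<le> k" for m k
  proof -
    have zk: "z k \<in> S m" using z(1) S_mono[OF that] by blast
    have "a (\<lambda>x. z k x - z m x) (\<lambda>x. z k x - z m x) \<le> 2 * a (z k) (z k) + 2 * a (z m) (z m) - 4 * \<nu> m"
      unfolding a_parallelogram[OF zV zV] using \<nu>_le[OF S_mid[OF zk z(1)[of m]]] by simp
    also have "\<dots> \<le> 2 * (L + h m) + 2 * (L + h m) - 4 * \<nu> m"
    proof -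
      have "a (z k) (z k) \<le> L + h m"
        using add_mono[OF L(2)[of k] h(2)[OF that]] z(2)[of k] by (meson less_imp_le order_trans)
      moreover have "a (z m) (z m) \<le> L + h m"
        using add_right_mono[OF L(2)[of m], of "h m"] z(2)[of m] by (meson less_imp_le order_trans)
      ultimately show ?thesis by simp
    qed
    finally show ?thesis using nrm_sq[OF diff_mem[OF zV[of k] zV[of m]]] by (simp add: algebra_simps)
  qed
  have near: "dst (u n) (z m) \<le> (Cbnd / Cell) * sqrt (4 * (L - \<nu> m) + 4 * h m)"
    if n: "m \<le> n" "z m \<in> X n" for m n
  proof -
    have un: "u n \<in> V" using u XV by blast
    have "(\<lambda>x. 1 * u n x + (- 1) * z m x) \<in> X n" by (intro Xlin u n)
    hence e: "(\<lambda>x. u n x - z m x) \<in> X n" by simp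
    note eV = XV[OF e]
    \<comment> \<open>Tested with a function of \<open>X n\<close>, both \<open>u n\<close> and
      \<open>z n\<close> reproduce \<open>us\<close>, so \<open>z n\<close> may replace
      \<open>u n\<close> in the first argument.\<close>
    have "b (\<lambda>x. u n x - z m x) (\<lambda>x. u n x - z m x) = b (\<lambda>x. z n x - z m x) (\<lambda>x. u n x - z m x)"
      using gal[OF e] z(1)[of n] e by (simp add: b_diff_left un zV eV S_def)
    also have "\<dots> \<le> Cbnd * dst (z n) (z m) * dst (u n) (z m)"
      using b_bounded[OF diff_mem[OF zV zV] eV, of n m] by simp
    finally have "dst (u n) (z m) \<le> Cbnd * dst (z n) (z m) / Cell"
      by (intro elliptic_bound eV) (auto intro!: mult_nonneg_nonneg dst_nonneg zV less_imp_le[OF Cbnd_pos])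
    also have "\<dots> \<le> (Cbnd / Cell) * sqrt (4 * (L - \<nu> m) + 4 * h m)"
    proof -
      have "dst (z n) (z m) \<le> sqrt (4 * (L - \<nu> m) + 4 * h m)"
        using close[OF n(1)] by (rule real_le_rsqrt)
      thus ?thesis using Cell_pos Cbnd_pos by (simp add: divide_right_mono)
    qed
    finally show ?thesis .
  qed
  show ?thesis
  proof (rule LIMSEQ_I)
    fix e :: real assume e: "0 < e"
    have "(\<lambda>m. (Cbnd / Cell) * sqrt (4 * (L - \<nu> m) + 4 * h m)) \<longlonglongrightarrow> (Cbnd / Cell) * sqrt (4 * (L - L) + 4 * 0)"
      unfolding h_def by (intro tendsto_intros L LIMSEQ_Suc[OF lim_1_over_n])
    hence "\<forall>\<^sub>F m in sequentially. (Cbnd / Cell) * sqrt (4 * (L - \<nu> m) + 4 * h m) < e / 2"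
      by (rule order_tendstoD) (use e in auto)
    \<comment> \<open>First fix \<open>m\<close> for the accuracy, then an index \<open>j\<close>
      with \<open>z m\<close> in \<open>X j\<close>. Beyond both, \<open>u n\<close> and
      \<open>u (Suc n)\<close> are close to the same element \<open>z m\<close>.\<close>
    then obtain m where m: "(Cbnd / Cell) * sqrt (4 * (L - \<nu> m) + 4 * h m) < e / 2"
      by (auto simp: eventually_sequentially)
    obtain j where j: "z m \<in> X j" using z(1)[of m] by (auto simp: S_def)
    have "norm (dst (u (Suc n)) (u n) - 0) < e" if n: "max m j \<le> n" for n
    proof -
      have "dst (u n) (z m) < e / 2" "dst (u (Suc n)) (z m) < e / 2"
      proof -
        have "z m \<in> X n" "z m \<in> X (Suc n)" using j n Xmono[of j n] Xmono[of j "Suc n"] by auto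
        thus "dst (u n) (z m) < e / 2" "dst (u (Suc n)) (z m) < e / 2"
          using order.strict_trans1[OF near m] n by auto
      qed
      moreover have un: "u n \<in> V" "u (Suc n) \<in> V" using u XV by blast+
      ultimately have "dst (u (Suc n)) (u n) < e"
        using dst_triangle[OF un(2) zV[of m] un(1)] dst_commute[OF un(1) zV[of m]] by linarith
      thus ?thesis using dst_nonneg[OF un(2,1)] by simp
    qed
    thus "\<exists>no. \<forall>n\<ge>no. norm (dst (u (Suc n)) (u n) - 0) < e" by blast
  qed
qed

end

section \<open>Finite element spaces and the error estimator\<close>

lemma elliptic_form_model:
  assumes "model_problem D" "0 < Cell" "Cell \<le> Cbnd"
    and "\<And>v w. v \<in> H10 (dom D) \<Longrightarrow> w \<in> H10 (dom D) \<Longrightarrow>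
           \<bar>bform D v w\<bar> \<le> Cbnd * energy_norm D v * energy_norm D w"
    and "\<And>v. v \<in> H10 (dom D) \<Longrightarrow> bform D v v \<ge> Cell * (energy_norm D v)\<^sup>2"
  shows "elliptic_form (H10 (dom D)) (aform D) (bform D) Cell Cbnd"
proof
  fix v w z and s t :: real
  assume v: "v \<in> H10 (dom D)"
  show "0 \<le> aform D v v" by (rule aform_nonneg[OF assms(1) v])
  thus "Cell * aform D v v \<le> bform D v v"
    using assms(5)[OF v] by (simp add: energy_norm_def)
  assume w: "w \<in> H10 (dom D)"
  show "(\<lambda>x. s * v x + t * w x) \<in> H10 (dom D)" by (rule model_lincomb[OF assms(1) v w])
  show "aform D v w = aform D w v" by (rule aform_commute[OF assms(1) v w])
  show "\<bar>bform D v w\<bar> \<le> Cbnd * sqrt (aform D v v) * sqrt (aform D w w)"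
    using assms(4)[OF v w] by (simp add: energy_norm_def)
  assume z: "z \<in> H10 (dom D)"
  show "aform D (\<lambda>x. s * v x + t * w x) z = s * aform D v z + t * aform D w z"
    "bform D (\<lambda>x. s * v x + t * w x) z = s * bform D v z + t * bform D w z"
    "bform D z (\<lambda>x. s * v x + t * w x) = s * bform D z v + t * bform D z w"
    by (rule aform_lincomb_left[OF assms(1) v w z] bform_lincomb_left[OF assms(1) v w z]
        bform_lincomb_right[OF assms(1) v w z])+
qed (use assms H10_zero[OF open_dom[OF assms(1)]] in auto)

lemma polynomial_deg_le_lincomb:
  assumes "polynomial_deg_le p q" "polynomial_deg_le p r"
  shows "polynomial_deg_le p (\<lambda>x. s * q x + t * r x)"
proof -
  from assms(1)[unfolded polynomial_deg_le_def] obtain c where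
    c: "\<forall>x. q x = (\<Sum>\<alpha> | sum \<alpha> UNIV \<le> p. c \<alpha> * (\<Prod>i\<in>UNIV. (x $ i) ^ \<alpha> i))" ..
  from assms(2)[unfolded polynomial_deg_le_def] obtain d where
    d: "\<forall>x. r x = (\<Sum>\<alpha> | sum \<alpha> UNIV \<le> p. d \<alpha> * (\<Prod>i\<in>UNIV. (x $ i) ^ \<alpha> i))" ..
  from c d have *: "s * q x + t * r x
      = (\<Sum>\<alpha> | sum \<alpha> UNIV \<le> p. (s * c \<alpha> + t * d \<alpha>) * (\<Prod>i\<in>UNIV. (x $ i) ^ \<alpha> i))" for x
    by (simp add: distrib_right sum.distrib sum_distrib_left mult.assoc)
  show ?thesis unfolding polynomial_deg_le_def
    by (intro exI[of _ "\<lambda>\<alpha>. s * c \<alpha> + t * d \<alpha>"] allI *)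
qed

lemma polynomial_deg_le_zero: "polynomial_deg_le p (\<lambda>_. 0)"
  unfolding polynomial_deg_le_def by (rule exI[of _ "\<lambda>_. 0"]) simp

lemma fe_space_subset: "fe_space D p \<T> \<subseteq> H10 (dom D)"
  by (auto simp: fe_space_def)

lemma fe_space_lincomb:
  assumes "model_problem D" "v \<in> fe_space D p \<T>" "w \<in> fe_space D p \<T>"
  shows "(\<lambda>x. s * v x + t * w x) \<in> fe_space D p \<T>"
proof -
  have "\<exists>q. polynomial_deg_le p q \<and> (\<forall>x \<in> elem T. s * v x + t * w x = q x)" if T: "T \<in> \<T>" for T
  proof -
    obtain q r where "polynomial_deg_le p q" "\<forall>x \<in> elem T. v x = q x"
      "polynomial_deg_le p r" "\<forall>x \<in> elem T. w x = r x"
      using assms(2,3) T unfolding fe_space_def by blast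
    thus ?thesis using polynomial_deg_le_lincomb[of p q r s t] by auto
  qed
  moreover have "(\<lambda>x. s * v x + t * w x) \<in> H10 (dom D)"
    using assms fe_space_subset by (intro model_lincomb) auto
  ultimately show ?thesis
    using assms(2,3) by (auto simp: fe_space_def intro!: continuous_intros)
qed

lemma fe_space_zero:
  assumes "model_problem D"
  shows "(\<lambda>_. 0) \<in> fe_space D p \<T>"
  using H10_zero[OF open_dom[OF assms]] polynomial_deg_le_zero by (auto simp: fe_space_def)

section \<open>Nestedness of the discrete spaces under bisection\<close>

lemma children_elem_subset:
  assumes "fst T \<noteq> []" "C \<in> children T"
  shows "fst C \<noteq> []" "elem C \<subseteq> elem T"
proof -
  let ?a = "hd (fst T)" and ?z = "last (fst T)"
  have inner: "set (butlast (tl (fst T))) \<subseteq> set (fst T)"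
    by (meson in_set_butlastD list.set_sel(2) assms(1) subsetI)
  have front: "set (inner_front T) \<subseteq> set (fst T)" and rear: "set (inner_back T) \<subseteq> set (fst T)"
    using inner set_take_subset set_drop_subset unfolding inner_front_def inner_back_def by fast+
  have az: "?a \<in> elem T" "?z \<in> elem T"
    using assms(1) by (auto simp: elem_def intro: hull_inc)
  hence mid: "midpoint ?a ?z \<in> elem T"
    unfolding elem_def
    by (meson closed_segment_subset convex_convex_hull midpoint_in_closed_segment subsetD)
  have "set (fst C) \<subseteq> {?a, ?z, midpoint ?a ?z} \<union> set (inner_front T) \<union> set (inner_back T)"
    using assms(2) by (auto simp: children_def Let_def)
  also have "\<dots> \<subseteq> elem T"
    using front rear az mid hull_subset[of "set (fst T)" convex] by (auto simp: elem_def)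
  finally show "elem C \<subseteq> elem T"
    unfolding elem_def by (intro hull_minimal) auto
  show "fst C \<noteq> []" using assms(2) by (auto simp: children_def Let_def)
qed

lemma bisections_elem_subset:
  assumes "bisection_step\<^sup>*\<^sup>* \<T> \<T>'" "\<forall>T\<in>\<T>. fst T \<noteq> []"
  shows "\<forall>C\<in>\<T>'. fst C \<noteq> [] \<and> (\<exists>T\<in>\<T>. elem C \<subseteq> elem T)"
  using assms(1)
proof (induction rule: rtranclp_induct)
  case base
  then show ?case using assms(2) by auto
next
  case (step \<S> \<S>')
  obtain S where S: "S \<in> \<S>" "\<S>' = (\<S> - {S}) \<union> children S"
    using step.hyps(2) unfolding bisection_step_def by blast
  show ?case
  proof
    fix C assume "C \<in> \<S>'"
    with S consider "C \<in> \<S>" | "C \<in> children S" by blast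
    thus "fst C \<noteq> [] \<and> (\<exists>T\<in>\<T>. elem C \<subseteq> elem T)"
    proof cases
      case 2
      have "fst S \<noteq> []" using step.IH S(1) by blast
      with children_elem_subset[OF this 2] show ?thesis using step.IH S(1) by blast
    qed (use step.IH in blast)
  qed
qed

text \<open>Only the piecewise polynomial condition depends on the mesh, and every new element lies
  inside an old one, whose polynomial it inherits.\<close>

lemma fe_space_mono:
  assumes "conforming \<T>" "\<T>' \<in> refinements \<T>"
  shows "fe_space D p \<T> \<subseteq> fe_space D p \<T>'"
proof
  fix v assume v: "v \<in> fe_space D p \<T>"
  have ne: "\<forall>T\<in>\<T>. fst T \<noteq> []" using assms(1) by (auto simp: conforming_def is_tsimplex_def)
  have "bisection_step\<^sup>*\<^sup>* \<T> \<T>'" using assms(2) by (simp add: refinements_def)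
  from bisections_elem_subset[OF this ne] have sub: "\<forall>C\<in>\<T>'. \<exists>T\<in>\<T>. elem C \<subseteq> elem T"
    by blast
  have "\<exists>q. polynomial_deg_le p q \<and> (\<forall>x\<in>elem C. v x = q x)" if C: "C \<in> \<T>'" for C
  proof -
    obtain T where "T \<in> \<T>" "elem C \<subseteq> elem T" using sub C by blast
    moreover from this obtain q where "polynomial_deg_le p q" "\<forall>x\<in>elem T. v x = q x"
      using v unfolding fe_space_def by blast
    ultimately show ?thesis by blast
  qed
  thus "v \<in> fe_space D p \<T>'" using v by (auto simp: fe_space_def)
qed

lemma refinements_refl: "conforming \<T> \<Longrightarrow> \<T> \<in> refinements \<T>"
  by (simp add: refinements_def)

lemma refinements_trans: "\<T>' \<in> refinements \<T> \<Longrightarrow> \<T>'' \<in> refinements \<T>' \<Longrightarrow> \<T>'' \<in> refinements \<T>"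
  by (auto simp: refinements_def)

lemma refinements_conforming: "\<T>' \<in> refinements \<T> \<Longrightarrow> conforming \<T>'"
  by (simp add: refinements_def)

section \<open>Properties of the error estimator\<close>

lemma eta_sq_nonneg: "0 \<le> eta_sq D \<T> T v"
proof -
  have "0 \<le> jump_sq D T T' v" for T'
    unfolding jump_sq_def Let_def set_lebesgue_integral_def
    by (intro Bochner_Integration.integral_nonneg) (auto simp: indicator_def)
  thus ?thesis unfolding eta_sq_def by (intro add_nonneg_nonneg mult_nonneg_nonneg sum_nonneg) auto
qed

lemma eta_nonneg: "0 \<le> eta D \<T> \<U> v"
  by (simp add: eta_def sum_nonneg eta_sq_nonneg)

lemma eta_power2: "(eta D \<T> \<U> v)\<^sup>2 = (\<Sum>T\<in>\<U>. eta_sq D \<T> T v)"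
  by (simp add: eta_def sum_nonneg eta_sq_nonneg)

lemma eta_power2_split:
  assumes "finite \<T>"
  shows "(eta D \<T> \<T> v)\<^sup>2 = (eta D \<T> (\<T> \<inter> \<S>) v)\<^sup>2 + (eta D \<T> (\<T> - \<S>) v)\<^sup>2"
  unfolding eta_power2 by (rule sum.Int_Diff[OF assms])

text \<open>Only the refined elements gain a factor, and by the marking criterion they carry a fixed share of the estimator.\<close>

lemma estimator_reduction:
  assumes "model_problem D" "stability D p \<T>\<^sub>0 Cstab" "reduction D p \<T>\<^sub>0 qred" "0 < qred" "qred < 1"
    and H: "\<T>\<^sub>H \<in> refinements \<T>\<^sub>0" and h: "\<T>\<^sub>h \<in> refinements \<T>\<^sub>H" and v: "v \<in> fe_space D p \<T>\<^sub>H"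
    and M: "\<M> \<subseteq> \<T>\<^sub>H" "\<M> \<inter> \<T>\<^sub>h = {}"
    and mark: "\<theta> * (eta D \<T>\<^sub>H \<T>\<^sub>H v)\<^sup>2 \<le> (eta D \<T>\<^sub>H \<M> v)\<^sup>2"
  shows "(eta D \<T>\<^sub>h \<T>\<^sub>h v)\<^sup>2 \<le> (1 - (1 - qred\<^sup>2) * \<theta>) * (eta D \<T>\<^sub>H \<T>\<^sub>H v)\<^sup>2"
proof -
  have fin: "finite \<T>\<^sub>H" "finite \<T>\<^sub>h"
    using H h by (auto dest!: refinements_conforming simp: conforming_def)
  have vh: "v \<in> fe_space D p \<T>\<^sub>h" using fe_space_mono[OF refinements_conforming[OF H] h] v by blast
  \<comment> \<open>With the same function on both meshes the right-hand side of (A1) vanishes, so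
    the two estimators agree exactly on the unrefined elements.\<close>
  have "aform D (\<lambda>_. 0) (\<lambda>_. 0) = 0"
    using aform_lincomb_left[OF assms(1) H10_zero H10_zero H10_zero, of 0 0] open_dom[OF assms(1)] by simp
  hence "energy_dist D v v = 0" by (simp add: energy_dist_def energy_norm_def)
  moreover have "\<bar>eta D \<T>\<^sub>h (\<T>\<^sub>h \<inter> \<T>\<^sub>H) v - eta D \<T>\<^sub>H (\<T>\<^sub>h \<inter> \<T>\<^sub>H) v\<bar> \<le> Cstab * energy_dist D v v"
    using assms(2) H h v vh unfolding stability_def by blast
  ultimately have same: "eta D \<T>\<^sub>h (\<T>\<^sub>h \<inter> \<T>\<^sub>H) v = eta D \<T>\<^sub>H (\<T>\<^sub>H \<inter> \<T>\<^sub>h) v" by (simp add: Int_commute)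
  have "eta D \<T>\<^sub>h (\<T>\<^sub>h - \<T>\<^sub>H) v \<le> qred * eta D \<T>\<^sub>H (\<T>\<^sub>H - \<T>\<^sub>h) v"
    using assms(3) H h v unfolding reduction_def by blast
  from power_mono[OF this eta_nonneg, of 2] have red: "(eta D \<T>\<^sub>h (\<T>\<^sub>h - \<T>\<^sub>H) v)\<^sup>2 \<le> qred\<^sup>2 * (eta D \<T>\<^sub>H (\<T>\<^sub>H - \<T>\<^sub>h) v)\<^sup>2"
    by (simp only: power_mult_distrib)
  \<comment> \<open>Marked elements are all refined, so the refined elements satisfy the marking
    criterion too.\<close>
  have "(eta D \<T>\<^sub>H \<M> v)\<^sup>2 \<le> (eta D \<T>\<^sub>H (\<T>\<^sub>H - \<T>\<^sub>h) v)\<^sup>2"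
    unfolding eta_power2 using fin M by (intro sum_mono2 eta_sq_nonneg) auto
  hence mark': "\<theta> * (eta D \<T>\<^sub>H \<T>\<^sub>H v)\<^sup>2 \<le> (eta D \<T>\<^sub>H (\<T>\<^sub>H - \<T>\<^sub>h) v)\<^sup>2"
    using mark by (rule order_trans[rotated])
  have q: "0 \<le> 1 - qred\<^sup>2" using assms(4,5) by (simp add: power_le_one)
  have "(eta D \<T>\<^sub>h \<T>\<^sub>h v)\<^sup>2 \<le> (eta D \<T>\<^sub>H (\<T>\<^sub>H \<inter> \<T>\<^sub>h) v)\<^sup>2 + qred\<^sup>2 * (eta D \<T>\<^sub>H (\<T>\<^sub>H - \<T>\<^sub>h) v)\<^sup>2"
    using red by (simp add: eta_power2_split[OF fin(2), where \<S>="\<T>\<^sub>H"] same)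
  also have "\<dots> = (eta D \<T>\<^sub>H \<T>\<^sub>H v)\<^sup>2 - (1 - qred\<^sup>2) * (eta D \<T>\<^sub>H (\<T>\<^sub>H - \<T>\<^sub>h) v)\<^sup>2"
    by (simp add: eta_power2_split[OF fin(1), where \<S>="\<T>\<^sub>h"] algebra_simps)
  also have "\<dots> \<le> (eta D \<T>\<^sub>H \<T>\<^sub>H v)\<^sup>2 - (1 - qred\<^sup>2) * (\<theta> * (eta D \<T>\<^sub>H \<T>\<^sub>H v)\<^sup>2)"
    by (intro diff_left_mono mult_left_mono mark' q)
  finally show ?thesis by (simp add: algebra_simps)
qed

section \<open>Preconditioned GMRES\<close>

definition pinner :: "real Matrix.mat \<Rightarrow> real Matrix.vec \<Rightarrow> real Matrix.vec \<Rightarrow> real" where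
  "pinner P x y = scalar_prod (the (mat_inverse P) *\<^sub>v x) y"

lemma pinv_norm_eq_sqrt_pinner: "pinv_norm P x = sqrt (pinner P x x)"
  by (simp add: pinv_norm_def pinner_def)

text \<open>A kernel vector would make its own quadratic form vanish. Symmetry is not assumed, so
  this serves the preconditioner, whose \<open>the (mat_inverse P)\<close> thereby becomes
  meaningful, as well as the nonsymmetric Galerkin matrix.\<close>

lemma positive_definite_solvable:
  fixes B :: "real Matrix.mat"
  assumes B: "B \<in> carrier_mat N N"
    and pos: "\<And>x. x \<in> carrier_vec N \<Longrightarrow> x \<noteq> 0\<^sub>v N \<Longrightarrow> 0 < scalar_prod (B *\<^sub>v x) x"
  obtains C where "mat_inverse B = Some C" "B * C = 1\<^sub>m N" "C * B = 1\<^sub>m N" "C \<in> carrier_mat N N"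
proof -
  have "det B \<noteq> 0"
    unfolding det_0_iff_vec_prod_zero_field[OF B]
  proof
    assume "\<exists>v. v \<in> carrier_vec N \<and> v \<noteq> 0\<^sub>v N \<and> B *\<^sub>v v = 0\<^sub>v N"
    then obtain v where v: "v \<in> carrier_vec N" "v \<noteq> 0\<^sub>v N" "B *\<^sub>v v = 0\<^sub>v N" by blast
    from pos[OF v(1,2)] show False using v by simp
  qed
  hence "B \<in> Units (ring_mat TYPE(real) N ())" by (rule det_non_zero_imp_unit[OF B])
  hence "mat_inverse B \<noteq> None" using mat_inverse(1)[OF B, where b="()"] by blast
  then obtain C where "mat_inverse B = Some C" by auto
  with mat_inverse(2)[OF B this] that show ?thesis by blast
qed

section \<open>The inner product of the inverse preconditioner\<close>

context
  fixes N :: nat and P :: "real Matrix.mat"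
  assumes spd: "spd N P"
begin

lemma spd_carrier: "P \<in> carrier_mat N N"
  using spd by (simp add: spd_def)

lemma spd_symmetric:
  assumes "x \<in> carrier_vec N" "y \<in> carrier_vec N"
  shows "scalar_prod (P *\<^sub>v x) y = scalar_prod x (P *\<^sub>v y)"
  using transpose_vec_mult_scalar[OF spd_carrier assms(2,1)] spd by (simp add: spd_def)

lemma spd_inverse:
  obtains Q where "the (mat_inverse P) = Q" "P * Q = 1\<^sub>m N" "Q * P = 1\<^sub>m N" "Q \<in> carrier_mat N N"
proof -
  obtain C where "mat_inverse P = Some C" "P * C = 1\<^sub>m N" "C * P = 1\<^sub>m N" "C \<in> carrier_mat N N"
    by (rule positive_definite_solvable[OF spd_carrier]) (use spd in \<open>auto simp: spd_def\<close>)
  thus ?thesis using that by simp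
qed

lemma pinner_left:
  assumes "x \<in> carrier_vec N" "y \<in> carrier_vec N"
  shows "pinner P (P *\<^sub>v x) y = scalar_prod x y"
proof -
  obtain Q where Q: "the (mat_inverse P) = Q" "P * Q = 1\<^sub>m N" "Q * P = 1\<^sub>m N" "Q \<in> carrier_mat N N"
    by (rule spd_inverse)
  have "Q *\<^sub>v (P *\<^sub>v x) = (Q * P) *\<^sub>v x" using Q(4) spd_carrier assms(1) by simp
  thus ?thesis using assms(1) by (simp add: pinner_def Q(1,3))
qed

text \<open>Writing vectors as images under \<open>P\<close> and cancelling with
  \<open>pinner_left\<close> transfers symmetry and positivity from \<open>P\<close> to its
  inverse.\<close>

lemma spd_preimage:
  assumes "x \<in> carrier_vec N"
  obtains u where "u \<in> carrier_vec N" "x = P *\<^sub>v u"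
proof -
  obtain Q where Q: "the (mat_inverse P) = Q" "P * Q = 1\<^sub>m N" "Q * P = 1\<^sub>m N" "Q \<in> carrier_mat N N"
    by (rule spd_inverse)
  have "P *\<^sub>v (Q *\<^sub>v x) = (P * Q) *\<^sub>v x" using Q(4) spd_carrier assms(1) by simp
  hence "x = P *\<^sub>v (Q *\<^sub>v x)" using Q(2) assms by simp
  thus ?thesis using that[of "Q *\<^sub>v x"] Q(4) assms by simp
qed

lemma pinner_commute:
  assumes "x \<in> carrier_vec N" "y \<in> carrier_vec N"
  shows "pinner P x y = pinner P y x"
proof -
  obtain u where u: "u \<in> carrier_vec N" "x = P *\<^sub>v u" by (rule spd_preimage[OF assms(1)])
  obtain v where v: "v \<in> carrier_vec N" "y = P *\<^sub>v v" by (rule spd_preimage[OF assms(2)])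
  have "pinner P x y = scalar_prod u y" using pinner_left[OF u(1) assms(2)] u(2) by simp
  also have "\<dots> = scalar_prod x v" using spd_symmetric[OF u(1) v(1)] u(2) v(2) by simp
  also have "\<dots> = scalar_prod v x" by (rule comm_scalar_prod[OF assms(1) v(1)])
  also have "\<dots> = pinner P y x" using pinner_left[OF v(1) assms(1)] v(2) by simp
  finally show ?thesis .
qed

lemma pinner_pos:
  assumes "x \<in> carrier_vec N" "x \<noteq> 0\<^sub>v N"
  shows "0 < pinner P x x"
proof -
  obtain u where u: "u \<in> carrier_vec N" "x = P *\<^sub>v u" by (rule spd_preimage[OF assms(1)])
  have "u \<noteq> 0\<^sub>v N" using u(2) assms(2) spd_carrier by auto
  hence "0 < scalar_prod x u" using spd u by (simp add: spd_def)
  also have "\<dots> = scalar_prod u x" by (rule comm_scalar_prod[OF assms(1) u(1)])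
  also have "\<dots> = pinner P x x" using pinner_left[OF u(1) assms(1)] u(2) by simp
  finally show ?thesis .
qed

lemma pinner_zero: "pinner P (0\<^sub>v N) (0\<^sub>v N) = 0"
proof -
  obtain Q where Q: "the (mat_inverse P) = Q" "Q \<in> carrier_mat N N" by (rule spd_inverse)
  thus ?thesis by (simp add: pinner_def)
qed

lemma pinner_nonneg: "x \<in> carrier_vec N \<Longrightarrow> 0 \<le> pinner P x x"
  using pinner_pos[of x] pinner_zero by (cases "x = 0\<^sub>v N") auto

lemma pinv_norm_nonneg: "x \<in> carrier_vec N \<Longrightarrow> 0 \<le> pinv_norm P x"
  by (simp add: pinv_norm_eq_sqrt_pinner pinner_nonneg)

lemma pinv_norm_sq: "x \<in> carrier_vec N \<Longrightarrow> (pinv_norm P x)\<^sup>2 = pinner P x x"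
  by (simp add: pinv_norm_eq_sqrt_pinner pinner_nonneg)

lemma pinv_norm_eq_0: "x \<in> carrier_vec N \<Longrightarrow> pinv_norm P x \<le> 0 \<Longrightarrow> x = 0\<^sub>v N"
  using pinner_pos[of x] by (fastforce simp: pinv_norm_eq_sqrt_pinner)

lemma pinner_add_left:
  assumes "x \<in> carrier_vec N" "y \<in> carrier_vec N" "z \<in> carrier_vec N"
  shows "pinner P (x + t \<cdot>\<^sub>v y) z = pinner P x z + t * pinner P y z"
proof -
  obtain Q where Q: "the (mat_inverse P) = Q" "Q \<in> carrier_mat N N" by (rule spd_inverse)
  have "Q *\<^sub>v (x + t \<cdot>\<^sub>v y) = Q *\<^sub>v x + t \<cdot>\<^sub>v (Q *\<^sub>v y)"
    using Q(2) assms by (simp add: mult_add_distrib_mat_vec[of _ N N] mult_mat_vec[of _ N N])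
  thus ?thesis using Q assms
    by (simp add: pinner_def add_scalar_prod_distrib[of _ N])
qed

lemma pinner_expand:
  assumes "x \<in> carrier_vec N" "y \<in> carrier_vec N"
  shows "pinner P (x + t \<cdot>\<^sub>v y) (x + t \<cdot>\<^sub>v y) = pinner P x x + 2 * t * pinner P x y + t\<^sup>2 * pinner P y y"
proof -
  have c: "x + t \<cdot>\<^sub>v y \<in> carrier_vec N" using assms by simp
  have "pinner P (x + t \<cdot>\<^sub>v y) (x + t \<cdot>\<^sub>v y)
      = pinner P (x + t \<cdot>\<^sub>v y) x + t * pinner P (x + t \<cdot>\<^sub>v y) y"
    using pinner_add_left[OF assms c] by (simp add: pinner_commute[OF c] assms)
  also have "\<dots> = pinner P x x + 2 * t * pinner P x y + t\<^sup>2 * pinner P y y"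
    using pinner_commute[OF assms]
    by (simp add: pinner_add_left assms power2_eq_square algebra_simps)
  finally show ?thesis .
qed

lemma pinner_Cauchy_Schwarz:
  assumes "x \<in> carrier_vec N" "y \<in> carrier_vec N"
  shows "\<bar>pinner P x y\<bar> \<le> pinv_norm P x * pinv_norm P y"
proof -
  have "(pinner P x y)\<^sup>2 \<le> pinner P x x * pinner P y y"
    by (rule discriminant_le)
      (use pinner_nonneg[of "x + _ \<cdot>\<^sub>v y"] assms in \<open>simp add: pinner_expand\<close>)
  hence "sqrt ((pinner P x y)\<^sup>2) \<le> sqrt (pinner P x x * pinner P y y)" by (rule real_sqrt_le_mono)
  thus ?thesis by (simp add: real_sqrt_mult pinv_norm_eq_sqrt_pinner)
qed

end

section \<open>Krylov spaces\<close>

lemma krylov_props: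
  fixes A :: "real Matrix.mat"
  assumes A: "A \<in> carrier_mat N N" and s: "s \<in> carrier_vec N"
  shows krylov_carrier: "krylov N A s K \<subseteq> carrier_vec N"
    and krylov_start: "s \<in> krylov N A s (Suc K)"
    and krylov_add: "v \<in> krylov N A s K \<Longrightarrow> w \<in> krylov N A s K \<Longrightarrow> v + w \<in> krylov N A s K"
    and krylov_smult: "v \<in> krylov N A s K \<Longrightarrow> t \<cdot>\<^sub>v v \<in> krylov N A s K"
    and krylov_zero: "0\<^sub>v N \<in> krylov N A s K"
    and krylov_mono: "K \<le> L \<Longrightarrow> krylov N A s K \<subseteq> krylov N A s L"
    and krylov_mult: "v \<in> krylov N A s K \<Longrightarrow> A *\<^sub>v v \<in> krylov N A s (Suc K)"
proof -
  interpret vec_space "TYPE(real)" N .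
  define G where "G K = {(A ^\<^sub>m i) *\<^sub>v s | i. i < K}" for K
  have kr: "krylov N A s K = span (G K)" for K by (simp add: krylov_def G_def)
  have G: "G K \<subseteq> carrier_vec N" for K
    using mult_mat_vec_carrier[OF pow_carrier_mat[OF A] s] by (auto simp: G_def)
  have sub: "submodule class_ring (span (G K)) V" for K by (rule span_is_submodule[OF G])
  show carr: "krylov N A s K \<subseteq> carrier_vec N" for K
    unfolding kr by (rule span_is_subset2[OF G])
  have "(A ^\<^sub>m 0) *\<^sub>v s = s" using A s by simp
  hence "s \<in> G (Suc K)" for K unfolding G_def by (intro CollectI exI[of _ 0]) simp
  thus "s \<in> krylov N A s (Suc K)" unfolding kr using in_own_span[OF G] by blast
  show add: "v + w \<in> krylov N A s K" if "v \<in> krylov N A s K" "w \<in> krylov N A s K" for v w K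
    using that unfolding kr by (rule span_add1[OF G])
  show smult: "t \<cdot>\<^sub>v v \<in> krylov N A s K" if "v \<in> krylov N A s K" for v t K
    using that unfolding kr by (rule smult_in_span[OF G])
  show zero: "0\<^sub>v N \<in> krylov N A s K" for K unfolding kr by (rule span_zero)
  show "krylov N A s K \<subseteq> krylov N A s L" if "K \<le> L"
    unfolding kr by (rule span_is_monotone) (use that in \<open>auto simp: G_def\<close>)
  have comm: "A *\<^sub>v ((A ^\<^sub>m i) *\<^sub>v s) = (A ^\<^sub>m Suc i) *\<^sub>v s" for i
  proof -
    \<comment> \<open>The recursion for matrix powers multiplies by \<open>A\<close> from the right,
      whereas here \<open>A\<close> is applied on the left.\<close>
    have "A * A ^\<^sub>m i = A ^\<^sub>m i * A"
    proof (induction i)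
      case (Suc i)
      have "A * A ^\<^sub>m Suc i = (A * A ^\<^sub>m i) * A"
        using A by (simp add: assoc_mult_mat[of _ N N _ N _ N])
      thus ?case by (simp add: Suc)
    qed (use A in simp)
    thus ?thesis using assoc_mult_mat_vec[OF A pow_carrier_mat[OF A] s, of i] by simp
  qed
  have A0: "A *\<^sub>v 0\<^sub>v N = 0\<^sub>v N" using A by auto
  \<comment> \<open>The vectors that \<open>A\<close> maps into the larger Krylov space form a
    submodule; it suffices that this submodule contains the generators.\<close>
  let ?U = "{v \<in> carrier_vec N. A *\<^sub>v v \<in> krylov N A s (Suc K)}"
  have "span (G K) \<subseteq> ?U"
  proof (rule span_is_subset)
    show "G K \<subseteq> ?U"
    proof
      fix v assume "v \<in> G K"
      then obtain i where i: "i < K" "v = (A ^\<^sub>m i) *\<^sub>v s" by (auto simp: G_def)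
      hence "A *\<^sub>v v \<in> G (Suc K)"
        unfolding i(2) comm G_def by (intro CollectI exI[of _ "Suc i"] conjI refl) simp
      moreover have "v \<in> carrier_vec N" using \<open>v \<in> G K\<close> G by blast
      ultimately show "v \<in> ?U" unfolding kr using in_own_span[OF G] by blast
    qed
    show "submodule class_ring ?U V"
      by (rule submodule.intro) (use A A0 zero add smult module_axioms in
        \<open>auto simp: mult_add_distrib_mat_vec[of _ N N] mult_mat_vec[of _ N N]\<close>)
  qed
  thus "A *\<^sub>v v \<in> krylov N A s (Suc K)" if "v \<in> krylov N A s K"
    using that unfolding kr by blast
qed

text \<open>Elman's field-of-values bound: if (Ax, x) is at least c |x|^2 and |Ax| at most C |x|,
  the best damped residual step reduces the norm by sqrt (1 - c^2 / C^2). Here A = P B, c = Cell /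
  Cpre^2 and C = Cbnd Cpre^2.\<close>

definition pgmres_rate :: "real \<Rightarrow> real \<Rightarrow> real \<Rightarrow> real" where
  "pgmres_rate Cell Cbnd Cpre = sqrt (1 - (Cell / Cpre\<^sup>2)\<^sup>2 / (Cbnd * Cpre\<^sup>2)\<^sup>2)"

text \<open>The load functional is represented as b(us, .), which the exact solution permits;
  Galerkin orthogonality is then built into the discrete problem.\<close>

locale pgmres_level = elliptic_form V a b Cell Cbnd
  for V :: "('a \<Rightarrow> real) set" and a b Cell Cbnd +
  fixes X :: "('a \<Rightarrow> real) set" and us :: "'a \<Rightarrow> real" and N :: nat
    and \<phi> :: "nat \<Rightarrow> 'a \<Rightarrow> real" and P :: "real Matrix.mat" and Cpre :: real
  assumes X_sub: "subspace_V X" and us_mem: "us \<in> V"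
    and basis: "is_basis N \<phi> X" and spd: "spd N P" and Cpre_ge: "1 \<le> Cpre"
    and equiv_lower: "x \<in> carrier_vec N \<Longrightarrow> inverse Cpre * nrm (lincomb_fun \<phi> x) \<le> pinv_norm P x"
    and equiv_upper: "x \<in> carrier_vec N \<Longrightarrow> pinv_norm P x \<le> Cpre * nrm (lincomb_fun \<phi> x)"
begin

section \<open>The Galerkin system and its residual on one level\<close>

definition B :: "real Matrix.mat" where "B = Matrix.mat N N (\<lambda>(j, k). b (\<phi> k) (\<phi> j))"

definition d :: "real Matrix.vec" where "d = Matrix.vec N (\<lambda>j. b us (\<phi> j))"

abbreviation lc :: "real Matrix.vec \<Rightarrow> 'a \<Rightarrow> real" where "lc \<equiv> lincomb_fun \<phi>"

abbreviation res :: "real Matrix.vec \<Rightarrow> real Matrix.vec" where "res \<equiv> prec_residual P B d"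

lemma X_V: "v \<in> X \<Longrightarrow> v \<in> V"
  using X_sub unfolding subspace_V_def by blast

lemma X_lincomb: "v \<in> X \<Longrightarrow> w \<in> X \<Longrightarrow> (\<lambda>x. s * v x + t * w x) \<in> X"
  using X_sub unfolding subspace_V_def by blast

lemma X_diff: "v \<in> X \<Longrightarrow> w \<in> X \<Longrightarrow> (\<lambda>x. v x - w x) \<in> X"
  using X_lincomb[of v w 1 "- 1"] by simp

lemma basis_mem: "j < N \<Longrightarrow> \<phi> j \<in> X"
  using basis by (simp add: is_basis_def)

lemma B_carrier: "B \<in> carrier_mat N N"
  by (simp add: B_def)

lemma d_carrier: "d \<in> carrier_vec N"
  by (simp add: d_def)

text \<open>Membership and both linearity statements go through one induction, because linearity of
  \<open>b\<close> may be applied only to partial sums already known to lie in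
  \<open>X\<close>.\<close>

lemma sum_basis:
  assumes "n \<le> N"
  shows "(\<lambda>z. \<Sum>j<n. c j * \<phi> j z) \<in> X
    \<and> (\<forall>w\<in>V. b (\<lambda>z. \<Sum>j<n. c j * \<phi> j z) w = (\<Sum>j<n. c j * b (\<phi> j) w)
          \<and> b w (\<lambda>z. \<Sum>j<n. c j * \<phi> j z) = (\<Sum>j<n. c j * b w (\<phi> j)))"
  using assms
proof (induction n)
  case 0
  have "b (\<lambda>_. 0) w = 0" "b w (\<lambda>_. 0) = 0" if "w \<in> V" for w
    using b_left[OF zero_mem zero_mem that, of 0 0] b_right[OF zero_mem zero_mem that, of 0 0] by simp_all
  then show ?case using X_sub by (simp add: subspace_V_def)
next
  case (Suc n)
  let ?S = "\<lambda>z. \<Sum>j<n. c j * \<phi> j z"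
  have S: "?S \<in> X" and \<phi>: "\<phi> n \<in> X" using Suc basis_mem by auto
  have "(\<lambda>z. \<Sum>j<Suc n. c j * \<phi> j z) = (\<lambda>z. 1 * ?S z + c n * \<phi> n z)" by simp
  moreover have "(\<lambda>z. 1 * ?S z + c n * \<phi> n z) \<in> X" by (rule X_lincomb[OF S \<phi>])
  ultimately show ?case
    using Suc b_left[OF X_V[OF S] X_V[OF \<phi>], of _ 1 "c n"] b_right[OF X_V[OF S] X_V[OF \<phi>], of _ 1 "c n"]
    by simp
qed

lemma lc_eq: "x \<in> carrier_vec N \<Longrightarrow> lc x = (\<lambda>z. \<Sum>j<N. vec_index x j * \<phi> j z)"
  by (auto simp: lincomb_fun_def)

lemma lc_mem: "x \<in> carrier_vec N \<Longrightarrow> lc x \<in> X"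
  using sum_basis[of N "vec_index x"] by (simp add: lc_eq)

lemma lc_surj: "v \<in> X \<Longrightarrow> \<exists>x\<in>carrier_vec N. v = lc x"
  using basis by (auto simp: is_basis_def)

lemma B_form:
  assumes x: "x \<in> carrier_vec N" and y: "y \<in> carrier_vec N"
  shows "scalar_prod (B *\<^sub>v x) y = b (lc x) (lc y)"
proof -
  have Bi: "vec_index (B *\<^sub>v x) i = b (lc x) (\<phi> i)" if "i < N" for i
  proof -
    have "vec_index (B *\<^sub>v x) i = (\<Sum>j<N. b (\<phi> j) (\<phi> i) * vec_index x j)"
      using that x by (simp add: B_def scalar_prod_def atLeast0LessThan)
    also have "\<dots> = b (lc x) (\<phi> i)"
      using sum_basis[of N "vec_index x"] X_V[OF basis_mem[OF that]] x by (simp add: lc_eq mult.commute)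
    finally show ?thesis .
  qed
  have "scalar_prod (B *\<^sub>v x) y = (\<Sum>i<N. vec_index y i * b (lc x) (\<phi> i))"
    using y Bi by (simp add: scalar_prod_def atLeast0LessThan mult.commute)
  also have "\<dots> = b (lc x) (lc y)"
    using sum_basis[of N "vec_index y"] X_V[OF lc_mem[OF x]] y by (simp add: lc_eq)
  finally show ?thesis .
qed

lemma d_form:
  assumes y: "y \<in> carrier_vec N"
  shows "scalar_prod d y = b us (lc y)"
proof -
  have "scalar_prod d y = (\<Sum>i<N. vec_index y i * b us (\<phi> i))"
    using y by (simp add: scalar_prod_def d_def atLeast0LessThan mult.commute)
  also have "\<dots> = b us (lc y)"
    using sum_basis[of N "vec_index y"] us_mem y by (simp add: lc_eq)
  finally show ?thesis .
qed

lemma nrm_lc_le: "x \<in> carrier_vec N \<Longrightarrow> nrm (lc x) \<le> Cpre * pinv_norm P x"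
  using equiv_lower[of x] Cpre_ge by (simp add: field_simps)

lemma nrm_lc_eq_0: 
  assumes "x \<in> carrier_vec N" "nrm (lc x) = 0"
  shows "x = 0\<^sub>v N"
  using equiv_upper[OF assms(1)] assms(2) by (intro pinv_norm_eq_0[OF spd assms(1)]) simp

text \<open>On \<open>X\<close> the seminorm is definite: the upper norm equivalence carries
  definiteness over from the coefficient norm.\<close>

lemma nrm_eq_0:
  assumes "v \<in> X" "nrm v = 0"
  shows "v = (\<lambda>_. 0)"
proof -
  obtain x where x: "x \<in> carrier_vec N" "v = lc x" using lc_surj[OF assms(1)] by blast
  hence "x = 0\<^sub>v N" using nrm_lc_eq_0 assms(2) by blast
  thus ?thesis using x by (auto simp: lc_eq)
qed

lemma B_positive:
  assumes "x \<in> carrier_vec N" "x \<noteq> 0\<^sub>v N"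
  shows "0 < scalar_prod (B *\<^sub>v x) x"
proof -
  have V: "lc x \<in> V" by (rule X_V[OF lc_mem[OF assms(1)]])
  have "a (lc x) (lc x) \<noteq> 0" using nrm_lc_eq_0[OF assms(1)] assms(2) by auto
  hence "0 < a (lc x) (lc x)" using a_nonneg[OF V] by simp
  hence "0 < Cell * a (lc x) (lc x)" using Cell_pos by simp
  thus ?thesis using b_elliptic[OF V] B_form[OF assms(1) assms(1)] by simp
qed

text \<open>Existence comes from inverting the Galerkin matrix. Uniqueness means equality of
  functions, as the \<open>THE\<close> in \<open>galerkin\<close> requires, and rests on
  definiteness of \<open>nrm\<close> on \<open>X\<close>.\<close>

lemma galerkin_ex1: "\<exists>!u. u \<in> X \<and> (\<forall>v\<in>X. b u v = b us v)"
proof (rule ex_ex1I)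
  obtain C where C: "B * C = 1\<^sub>m N" "C \<in> carrier_mat N N"
    by (rule positive_definite_solvable[OF B_carrier B_positive])
  define x where "x = C *\<^sub>v d"
  have x: "x \<in> carrier_vec N" using C d_carrier by (simp add: x_def)
  have "B *\<^sub>v x = (B * C) *\<^sub>v d" using assoc_mult_mat_vec[OF B_carrier C(2) d_carrier] by (simp add: x_def)
  hence Bx: "B *\<^sub>v x = d" using C d_carrier by simp
  have "b (lc x) v = b us v" if v: "v \<in> X" for v
  proof -
    obtain y where y: "y \<in> carrier_vec N" "v = lc y" using lc_surj[OF v] by blast
    show ?thesis using B_form[OF x y(1)] d_form[OF y(1)] Bx y(2) by simp
  qed
  thus "\<exists>u. u \<in> X \<and> (\<forall>v\<in>X. b u v = b us v)" using lc_mem[OF x] by blast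
next
  fix u w assume u: "u \<in> X \<and> (\<forall>v\<in>X. b u v = b us v)" and w: "w \<in> X \<and> (\<forall>v\<in>X. b w v = b us v)"
  let ?e = "\<lambda>z. u z - w z"
  have e: "?e \<in> X" using u w X_diff by blast
  have "b ?e ?e = 0" using b_diff_left[OF X_V X_V X_V[OF e]] u w e by simp
  hence "nrm ?e \<le> 0" using elliptic_bound[OF X_V[OF e], of 0] by simp
  hence "nrm ?e = 0" using nrm_nonneg[OF X_V[OF e]] by (rule antisym)
  from fun_cong[OF nrm_eq_0[OF e this]] show "u = w" by (simp add: fun_eq_iff)
qed

lemma res_carrier: "x \<in> carrier_vec N \<Longrightarrow> res x \<in> carrier_vec N"
  using spd_carrier[OF spd] B_carrier d_carrier by (simp add: prec_residual_def)

text \<open>In the inner product of the inverse preconditioner, \<open>P * B\<close> represents the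
  form \<open>b\<close>. Ellipticity and boundedness of \<open>b\<close> thus become field-of-values
  and norm bounds for \<open>P * B\<close>.\<close>

lemma pinner_PB:
  assumes "x \<in> carrier_vec N" "y \<in> carrier_vec N"
  shows "pinner P ((P * B) *\<^sub>v x) y = b (lc x) (lc y)"
proof -
  have Bx: "B *\<^sub>v x \<in> carrier_vec N" using B_carrier assms by simp
  have "(P * B) *\<^sub>v x = P *\<^sub>v (B *\<^sub>v x)" by (rule assoc_mult_mat_vec[OF spd_carrier[OF spd] B_carrier assms(1)])
  thus ?thesis using pinner_left[OF spd Bx assms(2)] B_form[OF assms] by simp
qed

text \<open>The preconditioned residual is the representer of the functional b(u - lc x, .), where
  \<open>u\<close> is the Galerkin solution.\<close>

lemma pinner_res:
  assumes u: "u \<in> X" "\<And>v. v \<in> X \<Longrightarrow> b u v = b us v" and x: "x \<in> carrier_vec N" and y: "y \<in> carrier_vec N"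
  shows "pinner P (res x) y = b (\<lambda>z. u z - lc x z) (lc y)"
proof -
  have Bx: "B *\<^sub>v x \<in> carrier_vec N" "d - B *\<^sub>v x \<in> carrier_vec N"
    using B_carrier d_carrier x by auto
  have "pinner P (res x) y = scalar_prod (d - B *\<^sub>v x) y"
    unfolding prec_residual_def by (rule pinner_left[OF spd Bx(2) y])
  also have "\<dots> = scalar_prod d y - scalar_prod (B *\<^sub>v x) y"
    by (rule minus_scalar_prod_distrib[OF d_carrier Bx(1) y])
  also have "\<dots> = b u (lc y) - b (lc x) (lc y)"
    using u(2)[OF lc_mem[OF y]] by (simp add: d_form[OF y] B_form[OF x y])
  also have "\<dots> = b (\<lambda>z. u z - lc x z) (lc y)"
    by (rule b_diff_left[symmetric, OF X_V[OF u(1)] X_V[OF lc_mem[OF x]] X_V[OF lc_mem[OF y]]])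
  finally show ?thesis .
qed

text \<open>Test the representation \<open>pinner_res\<close> with the coefficients of the error
  itself; ellipticity then cancels one factor.\<close>

lemma error_le_residual:
  assumes u: "u \<in> X" "\<And>v. v \<in> X \<Longrightarrow> b u v = b us v" and x: "x \<in> carrier_vec N"
  shows "dst u (lc x) \<le> Cpre / Cell * pinv_norm P (res x)"
proof -
  let ?e = "\<lambda>z. u z - lc x z"
  have e: "?e \<in> X" by (rule X_diff[OF u(1) lc_mem[OF x]])
  then obtain z where z: "z \<in> carrier_vec N" "?e = lc z" using lc_surj by blast
  have r: "0 \<le> pinv_norm P (res x)" by (rule pinv_norm_nonneg[OF spd res_carrier[OF x]])
  have "b ?e ?e = pinner P (res x) z" using pinner_res[OF u x z(1)] z(2) by simp
  also have "\<dots> \<le> pinv_norm P (res x) * pinv_norm P z"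
    using pinner_Cauchy_Schwarz[OF spd res_carrier[OF x] z(1)] by simp
  also have "\<dots> \<le> pinv_norm P (res x) * (Cpre * nrm ?e)"
    using equiv_upper[OF z(1)] z(2) by (intro mult_left_mono r) simp
  finally have "b ?e ?e \<le> (pinv_norm P (res x) * Cpre) * nrm ?e" by (simp add: mult.assoc)
  hence "nrm ?e \<le> pinv_norm P (res x) * Cpre / Cell"
    using r Cpre_ge by (intro elliptic_bound[OF X_V[OF e]]) auto
  thus ?thesis by (simp add: mult.commute)
qed

text \<open>Test the same representation with the residual, use boundedness of \<open>b\<close>, and
  cancel one factor of the residual norm.\<close>

lemma residual_le_error:
  assumes u: "u \<in> X" "\<And>v. v \<in> X \<Longrightarrow> b u v = b us v" and x: "x \<in> carrier_vec N"
  shows "pinv_norm P (res x) \<le> Cbnd * Cpre * dst u (lc x)"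
proof -
  let ?e = "\<lambda>z. u z - lc x z" and ?r = "pinv_norm P (res x)"
  have e: "?e \<in> V" by (rule X_V[OF X_diff[OF u(1) lc_mem[OF x]]])
  have r: "0 \<le> ?r" by (rule pinv_norm_nonneg[OF spd res_carrier[OF x]])
  have "?r * ?r = pinner P (res x) (res x)"
    using pinv_norm_sq[OF spd res_carrier[OF x]] by (simp add: power2_eq_square)
  also have "\<dots> = b ?e (lc (res x))" by (rule pinner_res[OF u x res_carrier[OF x]])
  also have "\<dots> \<le> Cbnd * nrm ?e * nrm (lc (res x))"
    using b_bounded[OF e X_V[OF lc_mem[OF res_carrier[OF x]]]] by simp
  also have "\<dots> \<le> Cbnd * nrm ?e * (Cpre * ?r)"
    using Cbnd_pos nrm_nonneg[OF e] by (intro mult_left_mono nrm_lc_le res_carrier x) auto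
  finally have *: "?r * ?r \<le> (Cbnd * Cpre * nrm ?e) * ?r" by (simp add: mult_ac)
  have "0 \<le> Cbnd * Cpre * nrm ?e" using Cbnd_pos Cpre_ge nrm_nonneg[OF e] by simp
  thus ?thesis using * r by (cases "?r = 0") auto
qed

lemma res_add:
  assumes "x \<in> carrier_vec N" "z \<in> carrier_vec N"
  shows "res (x + t \<cdot>\<^sub>v z) = res x + (- t) \<cdot>\<^sub>v ((P * B) *\<^sub>v z)"
proof -
  have PB: "(P * B) *\<^sub>v z = P *\<^sub>v (B *\<^sub>v z)" by (rule assoc_mult_mat_vec[OF spd_carrier[OF spd] B_carrier assms(2)])
  have c: "B *\<^sub>v x \<in> carrier_vec N" "B *\<^sub>v z \<in> carrier_vec N" "d - B *\<^sub>v x \<in> carrier_vec N"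
    using B_carrier assms d_carrier by auto
  have "d - B *\<^sub>v (x + t \<cdot>\<^sub>v z) = (d - B *\<^sub>v x) + (- t) \<cdot>\<^sub>v (B *\<^sub>v z)"
    using c assms d_carrier B_carrier
    by (simp add: mult_add_distrib_mat_vec[of _ N N] mult_mat_vec[of _ N N]) (intro eq_vecI; simp)
  hence "res (x + t \<cdot>\<^sub>v z) = P *\<^sub>v ((d - B *\<^sub>v x) + (- t) \<cdot>\<^sub>v (B *\<^sub>v z))"
    by (simp add: prec_residual_def)
  also have "\<dots> = P *\<^sub>v (d - B *\<^sub>v x) + (- t) \<cdot>\<^sub>v (P *\<^sub>v (B *\<^sub>v z))"
    using c spd_carrier[OF spd] by (simp add: mult_add_distrib_mat_vec[of _ N N] mult_mat_vec[of _ N N])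
  finally show ?thesis by (simp add: prec_residual_def PB)
qed

lemma PB_norm_le:
  assumes "x \<in> carrier_vec N"
  shows "pinv_norm P ((P * B) *\<^sub>v x) \<le> Cbnd * Cpre\<^sup>2 * pinv_norm P x"
proof -
  let ?y = "(P * B) *\<^sub>v x" let ?r = "pinv_norm P ?y"
  have y: "?y \<in> carrier_vec N" using spd_carrier[OF spd] B_carrier assms by auto
  have r: "0 \<le> ?r" "0 \<le> pinv_norm P x" by (rule pinv_norm_nonneg[OF spd y] pinv_norm_nonneg[OF spd assms])+
  have "?r * ?r = pinner P ?y ?y" using pinv_norm_sq[OF spd y] by (simp add: power2_eq_square)
  also have "\<dots> = b (lc x) (lc ?y)" by (rule pinner_PB[OF assms y])
  also have "\<dots> \<le> Cbnd * nrm (lc x) * nrm (lc ?y)"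
    using b_bounded[OF X_V[OF lc_mem[OF assms]] X_V[OF lc_mem[OF y]]] by simp
  also have "\<dots> \<le> Cbnd * (Cpre * pinv_norm P x) * (Cpre * ?r)"
    using Cbnd_pos Cpre_ge r
    by (intro mult_mono mult_left_mono nrm_lc_le assms y mult_nonneg_nonneg nrm_nonneg X_V lc_mem) auto
  finally have *: "?r * ?r \<le> (Cbnd * Cpre\<^sup>2 * pinv_norm P x) * ?r" by (simp add: mult_ac power2_eq_square)
  have "0 \<le> Cbnd * Cpre\<^sup>2 * pinv_norm P x" using Cbnd_pos Cpre_ge r by simp
  thus ?thesis using * r by (cases "?r = 0") auto
qed

lemma PB_elliptic:
  assumes "x \<in> carrier_vec N"
  shows "Cell / Cpre\<^sup>2 * (pinv_norm P x)\<^sup>2 \<le> pinner P ((P * B) *\<^sub>v x) x"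
proof -
  have V: "lc x \<in> V" by (rule X_V[OF lc_mem[OF assms]])
  have "(pinv_norm P x)\<^sup>2 \<le> (Cpre * nrm (lc x))\<^sup>2"
    by (intro power_mono equiv_upper pinv_norm_nonneg[OF spd] assms)
  also have "\<dots> = Cpre\<^sup>2 * a (lc x) (lc x)" by (simp only: power_mult_distrib nrm_sq[OF V])
  finally have "Cell / Cpre\<^sup>2 * (pinv_norm P x)\<^sup>2 \<le> Cell / Cpre\<^sup>2 * (Cpre\<^sup>2 * a (lc x) (lc x))"
    using Cell_pos by (intro mult_left_mono) auto
  also have "\<dots> = Cell * a (lc x) (lc x)" using Cpre_ge by simp
  also have "\<dots> \<le> b (lc x) (lc x)" by (rule b_elliptic[OF V])
  finally show ?thesis by (simp add: pinner_PB assms)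
qed

lemma damped_step_contraction:
  assumes "x \<in> carrier_vec N"
  shows "\<exists>t. pinv_norm P (res (x + t \<cdot>\<^sub>v res x)) \<le> pgmres_rate Cell Cbnd Cpre * pinv_norm P (res x)"
proof -
  define c where "c = Cell / Cpre\<^sup>2"
  define C where "C = Cbnd * Cpre\<^sup>2"
  \<comment> \<open>The minimiser of 1 - 2 t c + t^2 C^2, with minimum 1 - c^2 / C^2.\<close>
  define t where "t = c / C\<^sup>2"
  let ?s = "res x" let ?y = "(P * B) *\<^sub>v res x"
  have s: "?s \<in> carrier_vec N" by (rule res_carrier[OF assms])
  have y: "?y \<in> carrier_vec N" using spd_carrier[OF spd] B_carrier s by auto
  have C: "0 < C" "0 < c" using Cbnd_pos Cell_pos Cpre_ge by (auto simp: C_def c_def)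
  have t: "0 < t" using C by (simp add: t_def)
  have r: "res (x + t \<cdot>\<^sub>v ?s) = ?s + (- t) \<cdot>\<^sub>v ?y" by (rule res_add[OF assms s])
  have c': "x + t \<cdot>\<^sub>v ?s \<in> carrier_vec N" using assms s by simp
  have "(pinv_norm P (res (x + t \<cdot>\<^sub>v ?s)))\<^sup>2 = pinner P ?s ?s - 2 * t * pinner P ?y ?s + t\<^sup>2 * pinner P ?y ?y"
    unfolding pinv_norm_sq[OF spd res_carrier[OF c']] unfolding r pinner_expand[OF spd s y]
    by (simp add: pinner_commute[OF spd s y])
  also have "\<dots> \<le> (pinv_norm P ?s)\<^sup>2 - 2 * t * (c * (pinv_norm P ?s)\<^sup>2) + t\<^sup>2 * (C * pinv_norm P ?s)\<^sup>2"
  proof -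
    have "2 * t * (c * (pinv_norm P ?s)\<^sup>2) \<le> 2 * t * pinner P ?y ?s"
      using PB_elliptic[OF s] t by (intro mult_left_mono) (auto simp: c_def)
    moreover have "t\<^sup>2 * pinner P ?y ?y \<le> t\<^sup>2 * (C * pinv_norm P ?s)\<^sup>2"
      unfolding pinv_norm_sq[OF spd y, symmetric]
      by (intro mult_left_mono power_mono PB_norm_le[OF s, folded C_def] pinv_norm_nonneg[OF spd y]) auto
    ultimately show ?thesis using pinv_norm_sq[OF spd s] by simp
  qed
  also have "\<dots> = (1 - c\<^sup>2 / C\<^sup>2) * (pinv_norm P ?s)\<^sup>2"
    using C by (simp add: t_def field_simps power2_eq_square)
  finally have "sqrt ((pinv_norm P (res (x + t \<cdot>\<^sub>v ?s)))\<^sup>2) \<le> sqrt ((1 - c\<^sup>2 / C\<^sup>2) * (pinv_norm P ?s)\<^sup>2)"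
    by (rule real_sqrt_le_mono)
  hence "pinv_norm P (res (x + t \<cdot>\<^sub>v ?s)) \<le> pgmres_rate Cell Cbnd Cpre * pinv_norm P ?s"
    using pinv_norm_nonneg[OF spd s] pinv_norm_nonneg[OF spd res_carrier[OF c']]
    by (simp add: real_sqrt_mult pgmres_rate_def c_def C_def)
  thus ?thesis by blast
qed

text \<open>
  Since the Krylov spaces of one restart cycle are nested and contain the current residual, every
  step is at least as good as a damped step in the direction of that residual.
\<close>

lemma pgmres_step_contraction:
  assumes kmax: "1 \<le> kmax" and carr: "\<And>j. j \<le> Suc k \<Longrightarrow> x j \<in> carrier_vec N"
    and it: "\<And>j. 1 \<le> j \<Longrightarrow> j \<le> Suc k \<Longrightarrow> pgmres_iterate kmax N P B d x j"
  shows "pinv_norm P (res (x (Suc k))) \<le> pgmres_rate Cell Cbnd Cpre * pinv_norm P (res (x k))"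
proof -
  \<comment> \<open>Step \<open>Suc k\<close> minimises over a Krylov space with r + 1 generators,
    started at the last restart index m = Suc k - (r + 1) = k - r.\<close>
  define r where "r = k mod kmax"
  define m where "m = k - r"
  have r: "r \<le> k" by (simp add: r_def)
  have xm: "x m \<in> carrier_vec N" by (rule carr) (simp add: m_def)
  have xk: "x k \<in> carrier_vec N" by (rule carr) simp
  let ?A = "P * B" let ?K = "krylov N ?A (res (x m))"
  have A: "?A \<in> carrier_mat N N" using spd_carrier[OF spd] B_carrier by simp
  note K = krylov_props[OF A res_carrier[OF xm]]
  \<comment> \<open>For r = 0 the iterate \<open>x k\<close> is the restart vector itself; otherwise
    step \<open>k\<close> belongs to the same cycle and uses r generators from the same
    start.\<close>
  have "\<exists>z\<in>?K r. x k = x m + z"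
  proof (cases "r = 0")
    case True
    thus ?thesis using K(5)[of 0] xk by (auto simp: m_def intro!: bexI[of _ "0\<^sub>v N"])
  next
    case False
    then obtain k' where k': "k = Suc k'" using r by (cases k) auto
    have "k' mod kmax + 1 = r"
      using False by (auto simp: r_def k' mod_Suc split: if_splits)
    hence "(k - 1) mod kmax + 1 = r" by (simp add: k')
    with it[of k] show ?thesis
      by (auto simp: pgmres_iterate_def is_arg_min_def Let_def m_def k')
  qed
  then obtain z where z: "z \<in> ?K r" "x k = x m + z" by blast
  have zc: "z \<in> carrier_vec N" using z(1) K(1) by blast
  have "res (x m + 1 \<cdot>\<^sub>v z) = res (x m) + (- 1) \<cdot>\<^sub>v (?A *\<^sub>v z)" by (rule res_add[OF xm zc])
  hence "res (x k) = res (x m) + (- 1) \<cdot>\<^sub>v (?A *\<^sub>v z)" using z(2) zc by simp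
  also have "\<dots> \<in> ?K (Suc r)" by (intro K(2,3,4,7) z)
  finally have s: "res (x k) \<in> ?K (Suc r)" .
  obtain t where t: "pinv_norm P (res (x k + t \<cdot>\<^sub>v res (x k))) \<le> pgmres_rate Cell Cbnd Cpre * pinv_norm P (res (x k))"
    using damped_step_contraction[OF xk] by blast
  have "z \<in> ?K (Suc r)" using K(6)[of r "Suc r"] z(1) by auto
  hence "z + t \<cdot>\<^sub>v res (x k) \<in> ?K (Suc r)" by (intro K(3,4) s)
  moreover have "x k + t \<cdot>\<^sub>v res (x k) = x m + (z + t \<cdot>\<^sub>v res (x k))"
    using xm zc res_carrier[OF xk] by (simp add: z(2) assoc_add_vec[of _ N])
  \<comment> \<open>The damped step from \<open>x k\<close> is a competitor in the minimisation that
    defines \<open>x (Suc k)\<close>.\<close>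
  ultimately have "\<not> pinv_norm P (res (x k + t \<cdot>\<^sub>v res (x k))) < pinv_norm P (res (x (Suc k)))"
    using it[of "Suc k"] unfolding pgmres_iterate_def is_arg_min_def Let_def
    by (auto simp: r_def m_def)
  thus ?thesis using t by simp
qed

end

lemma pgmres_rate_bounds:
  assumes "0 < Cell" "Cell \<le> Cbnd" "1 \<le> Cpre"
  shows "0 \<le> pgmres_rate Cell Cbnd Cpre" "pgmres_rate Cell Cbnd Cpre < 1"
proof -
  have "1 \<le> Cpre\<^sup>2" using assms(3) by simp
  hence "Cell / Cpre\<^sup>2 \<le> Cell" "Cbnd \<le> Cbnd * Cpre\<^sup>2"
    using assms by (auto simp: divide_le_eq mult_le_cancel_left1)
  hence le: "Cell / Cpre\<^sup>2 \<le> Cbnd * Cpre\<^sup>2" using assms(2) by argo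
  have "0 < Cpre\<^sup>2" "0 < Cbnd" using assms by auto
  hence pos: "0 < Cell / Cpre\<^sup>2" "0 < Cbnd * Cpre\<^sup>2" using assms(1) by auto
  have "(Cell / Cpre\<^sup>2)\<^sup>2 \<le> (Cbnd * Cpre\<^sup>2)\<^sup>2" using le pos by (intro power_mono) auto
  hence "(Cell / Cpre\<^sup>2)\<^sup>2 / (Cbnd * Cpre\<^sup>2)\<^sup>2 \<le> 1" using pos by (simp only: divide_le_eq_1) auto
  thus "0 \<le> pgmres_rate Cell Cbnd Cpre" unfolding pgmres_rate_def by simp
  have "0 < (Cell / Cpre\<^sup>2)\<^sup>2 / (Cbnd * Cpre\<^sup>2)\<^sup>2" 
    by (rule divide_pos_pos[OF zero_less_power[OF pos(1)] zero_less_power[OF pos(2)]])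
  thus "pgmres_rate Cell Cbnd Cpre < 1" unfolding pgmres_rate_def by simp
qed

section \<open>Convergence of the adaptive algorithm\<close>

text \<open>Once the perturbation is below (1 - r) \<epsilon>/2, the recursion has the fixed point
  \<epsilon>/2, and the excess over it decays like r^n.\<close>

lemma tendsto_0_if_perturbed_contraction:
  fixes e d :: "nat \<Rightarrow> real"
  assumes nonneg: "\<And>n. 0 \<le> e n" and r: "0 \<le> r" "r < 1" and d: "d \<longlonglongrightarrow> 0"
    and step: "\<forall>\<^sub>F n in sequentially. e (Suc n) \<le> r * e n + d n"
  shows "e \<longlonglongrightarrow> 0"
proof (rule LIMSEQ_I)
  fix \<epsilon> :: real assume \<epsilon>: "0 < \<epsilon>"
  have "\<forall>\<^sub>F n in sequentially. d n < (1 - r) * (\<epsilon> / 2)"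
    using r \<epsilon> by (intro order_tendstoD(2)[OF d]) simp
  with step have "\<forall>\<^sub>F n in sequentially. e (Suc n) \<le> r * e n + (1 - r) * (\<epsilon> / 2)"
    by eventually_elim argo
  then obtain m where m: "\<And>n. m \<le> n \<Longrightarrow> e (Suc n) \<le> r * e n + (1 - r) * (\<epsilon> / 2)"
    by (auto simp: eventually_sequentially)
  have le: "e (m + n) \<le> r ^ n * e m + \<epsilon> / 2" for n
  proof (induction n)
    case (Suc n)
    have "e (m + Suc n) \<le> r * e (m + n) + (1 - r) * (\<epsilon> / 2)" using m[of "m + n"] by simp
    also have "\<dots> \<le> r * (r ^ n * e m + \<epsilon> / 2) + (1 - r) * (\<epsilon> / 2)"
      by (intro add_right_mono mult_left_mono Suc r)
    also have "\<dots> = r ^ Suc n * e m + \<epsilon> / 2" by (simp add: field_simps)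
    finally show ?case .
  qed (use \<epsilon> in simp)
  have "(\<lambda>n. r ^ n * e m) \<longlonglongrightarrow> 0 * e m"
    by (intro tendsto_mult_right LIMSEQ_realpow_zero r)
  hence "\<forall>\<^sub>F n in sequentially. r ^ n * e m < \<epsilon> / 2" using \<epsilon> by (intro order_tendstoD(2)) auto
  then obtain j where j: "\<And>n. j \<le> n \<Longrightarrow> r ^ n * e m < \<epsilon> / 2" by (auto simp: eventually_sequentially)
  have "norm (e n - 0) < \<epsilon>" if "m + j \<le> n" for n
  proof -
    have "e n \<le> r ^ (n - m) * e m + \<epsilon> / 2" using le[of "n - m"] that by simp
    moreover have "r ^ (n - m) * e m < \<epsilon> / 2" by (rule j) (use that in simp)
    ultimately have "e n < \<epsilon>" by argo
    thus ?thesis using nonneg[of n] by simp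
  qed
  thus "\<exists>n0. \<forall>n\<ge>n0. norm (e n - 0) < \<epsilon>" by blast
qed

text \<open>A positive limit L would be undercut: eventually x is below 2 L, and the next halving
  falls below L.\<close>

lemma tendsto_0_if_halved_infinitely_often:
  fixes x :: "nat \<Rightarrow> real"
  assumes pos: "\<And>n. 0 < x n" and le: "\<And>n. x (Suc n) \<le> x n"
    and half: "\<And>m. \<exists>n\<ge>m. x (Suc n) = x n / 2"
  shows "x \<longlonglongrightarrow> 0"
proof -
  have dec: "decseq x" using le by (rule decseq_SucI)
  then obtain L where L: "x \<longlonglongrightarrow> L" "\<And>n. L \<le> x n"
    using decseq_convergent[OF dec, of 0] pos less_imp_le by metis
  have "0 \<le> L" using L(1) by (rule LIMSEQ_le_const) (use pos less_imp_le in blast)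
  moreover have "\<not> 0 < L"
  proof
    assume "0 < L"
    hence "\<forall>\<^sub>F n in sequentially. x n < 2 * L" by (intro order_tendstoD(2)[OF L(1)]) simp
    then obtain m where m: "\<And>n. m \<le> n \<Longrightarrow> x n < 2 * L" by (auto simp: eventually_sequentially)
    obtain n where "m \<le> n" "x (Suc n) = x n / 2" using half by blast
    thus False using m[of n] L(2)[of "Suc n"] by simp
  qed
  ultimately show ?thesis using L(1) by simp
qed

text \<open>The partial sums of the reciprocals grow at least linearly.\<close>

lemma tendsto_0_if_reciprocal_sums_bounded:
  fixes H :: "nat \<Rightarrow> real" and S :: "nat \<Rightarrow> ennreal"
  assumes H: "\<And>n. 0 \<le> H n" and C: "0 < C"
    and S0: "S 0 = 0" and S: "\<And>n. S (Suc n) = S n + inverse (ennreal (H n))"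
    and le: "\<And>n. m \<le> n \<Longrightarrow> S n \<le> ennreal C * inverse (ennreal (H n))"
  shows "H \<longlonglongrightarrow> 0"
proof (cases "\<exists>n. H n = 0")
  case True
  then obtain n where n: "H n = 0" by blast
  \<comment> \<open>By the convention 1/0 = \<infinity>, one vanishing value makes all later sums
    infinite, and the assumed bound then forces every later H to vanish.\<close>
  have top: "S k = top_class.top" if "Suc n \<le> k" for k
    using that
  proof (induction k rule: dec_induct)
    case base
    show ?case using S[of n] n by simp
  qed (simp add: S)
  have "H k = 0" if "max m (Suc n) \<le> k" for k
  proof -
    have "inverse (ennreal (H k)) = top_class.top"
      using top[of k] le[of k] that by (auto simp: top_unique ennreal_mult_eq_top_iff)
    thus ?thesis using H[of k] by (simp add: ennreal_inverse_eq_top_iff ennreal_eq_0_iff)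
  qed
  hence "\<forall>\<^sub>F k in sequentially. H k = 0" unfolding eventually_sequentially by blast
  thus ?thesis by (rule tendsto_eventually)
next
  case False
  hence pos: "0 < H n" for n using H[of n] by (simp add: less_le)
  define \<sigma> where "\<sigma> n = (\<Sum>i<n. inverse (H i))" for n
  have inv: "inverse (ennreal (H n)) = ennreal (inverse (H n))" for n
    using pos by (simp add: inverse_ennreal)
  have \<sigma>0: "0 \<le> \<sigma> n" for n unfolding \<sigma>_def using pos by (intro sum_nonneg) (simp add: less_imp_le)
  have "S n = ennreal (\<sigma> n)" for n
  proof (induction n)
    case (Suc n)
    thus ?case using pos[of n] \<sigma>0[of n] by (simp add: S inv \<sigma>_def less_imp_le flip: ennreal_plus)
  qed (simp add: S0 \<sigma>_def)
  hence bound: "\<sigma> n \<le> C * inverse (H n)" if "m \<le> n" for n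
    using le[OF that] C pos[of n]
    by (simp add: inv less_imp_le flip: ennreal_mult)
  \<comment> \<open>The shift by one keeps the sum up to \<open>M\<close> nonempty and therefore
    positive.\<close>
  define M where "M = Suc m"
  have mono: "\<sigma> M \<le> \<sigma> n" if "M \<le> n" for n
    unfolding \<sigma>_def using that pos by (intro sum_mono2) (auto simp: less_imp_le)
  have "inverse (H 0) \<le> \<sigma> M"
    unfolding \<sigma>_def M_def using pos by (intro member_le_sum) (auto simp: less_imp_le)
  hence M: "0 < \<sigma> M" using pos[of 0] by (meson less_le_trans positive_imp_inverse_positive)
  define h where "h = \<sigma> M / C"
  have h: "0 < h" using M C by (simp add: h_def)
  \<comment> \<open>From \<open>M\<close> on, the assumed bound gives 1/H at least \<sigma> M / C =
    h, so each further term adds at least h. Inserting this growth into the same bound once more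
    yields H of order 1/n.\<close>
  have lin: "real n * h \<le> \<sigma> (M + n)" for n
  proof (induction n)
    case (Suc n)
    have "\<sigma> M \<le> C * inverse (H (M + n))" using mono[of "M + n"] bound[of "M + n"] by (simp add: M_def)
    hence "h \<le> inverse (H (M + n))" using C by (simp add: h_def field_simps)
    moreover have "\<sigma> (M + Suc n) = \<sigma> (M + n) + inverse (H (M + n))" by (simp add: \<sigma>_def)
    ultimately show ?case using Suc by (simp add: algebra_simps)
  qed (use \<sigma>0 in simp)
  have H_le: "H (M + Suc n) \<le> (C / h) * (1 / real (Suc n))" for n
  proof -
    let ?H = "H (M + Suc n)"
    have "\<sigma> (M + Suc n) \<le> C * inverse ?H" by (rule bound) (simp add: M_def)
    with lin[of "Suc n"] have "real (Suc n) * h \<le> C * inverse ?H" by (rule order_trans)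
    hence "(real (Suc n) * h) * ?H \<le> C"
      using pos[of "M + Suc n"] by (simp add: field_simps del: of_nat_Suc)
    thus ?thesis using h by (simp add: field_simps del: of_nat_Suc)
  qed
  have lim: "(\<lambda>n. (C / h) * (1 / real (Suc n))) \<longlonglongrightarrow> (C / h) * 0"
    by (intro tendsto_intros LIMSEQ_Suc[OF lim_1_over_n])
  have "(\<lambda>n. H (M + Suc n)) \<longlonglongrightarrow> 0"
  proof (rule tendsto_sandwich)
    show "\<forall>\<^sub>F n in sequentially. 0 \<le> H (M + Suc n)" by (rule always_eventually) (simp add: H)
    show "\<forall>\<^sub>F n in sequentially. H (M + Suc n) \<le> (C / h) * (1 / real (Suc n))"
      by (rule always_eventually) (use H_le in blast)
    show "(\<lambda>n. (C / h) * (1 / real (Suc n))) \<longlonglongrightarrow> 0" using lim by simp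
  qed simp
  hence "(\<lambda>n. H (n + Suc M)) \<longlonglongrightarrow> 0" by (simp add: add.commute)
  thus ?thesis by (rule LIMSEQ_offset)
qed

text \<open>Finitely many exceptional indices have bounded step counts, so none of them is met
  beyond that bound.\<close>

lemma tendsto_along_step_count:
  fixes f :: "nat \<times> nat \<Rightarrow> real"
  assumes nonneg: "\<And>q. q \<in> Q \<Longrightarrow> 0 \<le> f q"
    and fin: "\<And>\<epsilon>. 0 < \<epsilon> \<Longrightarrow> finite {q \<in> Q. \<epsilon> \<le> f q}"
  shows "(f \<longlongrightarrow> 0) (inf (filtercomap (step_count Q) at_top) (principal Q))"
proof (rule tendstoI)
  fix \<epsilon> :: real assume "0 < \<epsilon>"
  define A where "A = {q \<in> Q. \<epsilon> \<le> f q}"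
  have "finite (step_count Q ` A)" using fin[OF \<open>0 < \<epsilon>\<close>] by (simp add: A_def)
  then obtain n where n: "\<And>j. j \<in> step_count Q ` A \<Longrightarrow> j < n"
    unfolding finite_nat_set_iff_bounded by auto
  have "dist (f q) 0 < \<epsilon>" if "n \<le> step_count Q q" "q \<in> Q" for q
  proof -
    have "q \<notin> A" using n[of "step_count Q q"] that(1) by fastforce
    thus ?thesis using nonneg[OF that(2)] that(2) by (simp add: A_def)
  qed
  thus "\<forall>\<^sub>F q in inf (filtercomap (step_count Q) at_top) (principal Q). dist (f q) 0 < \<epsilon>"
    unfolding eventually_inf_principal eventually_filtercomap
    by (intro exI[of _ "\<lambda>j. n \<le> j"] conjI eventually_ge_at_top) auto
qed

lemma stop_index_finite:
  assumes "stop_index D R \<mu> l = enat k"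
  shows "1 \<le> k" "res_norm D R l k \<le> \<mu> * eta_it D R l k"
proof -
  let ?A = "{k. 1 \<le> k \<and> res_norm D R l k \<le> \<mu> * eta_it D R l k}"
  have ne: "enat ` ?A \<noteq> {}"
  proof
    assume "enat ` ?A = {}"
    hence "stop_index D R \<mu> l = \<infinity>" by (simp only: stop_index_def Inf_enat_def) simp
    thus False using assms by simp
  qed
  \<comment> \<open>The infimum of a nonempty set in \<open>enat\<close> is attained, while the
    empty set has infimum \<infinity>.\<close>
  have "Inf (enat ` ?A) \<in> enat ` ?A"
    using ne LeastI_ex[of "\<lambda>x. x \<in> enat ` ?A"] unfolding Inf_enat_def by auto
  hence "enat k \<in> enat ` ?A" using assms by (simp add: stop_index_def)
  thus "1 \<le> k" "res_norm D R l k \<le> \<mu> * eta_it D R l k" by auto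
qed

lemma stop_index_infinite:
  assumes "stop_index D R \<mu> l = \<infinity>" "1 \<le> k"
  shows "\<mu> * eta_it D R l k < res_norm D R l k"
proof (rule ccontr)
  assume "\<not> \<mu> * eta_it D R l k < res_norm D R l k"
  hence "enat k \<in> enat ` {k. 1 \<le> k \<and> res_norm D R l k \<le> \<mu> * eta_it D R l k}"
    using assms(2) by simp
  hence "stop_index D R \<mu> l \<le> enat k" unfolding stop_index_def by (rule Inf_lower)
  thus False using assms(1) by simp
qed

section \<open>The hypotheses of the theorem and the estimates on a single level\<close>

locale afem_setting =
  fixes D :: "'d::finite pde"
    and ustar u\<^sub>0\<^sub>0 :: "real^'d \<Rightarrow> real"
    and \<T>\<^sub>0 :: "'d mesh"
    and R :: "'d run"
    and p kmax :: nat
    and Cell Cbnd Cstab qred Crel Cpre \<theta> Cmark Calg lam tau :: real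
  assumes model: "model_problem D"
    and Cell: "0 < Cell" and Cell_Cbnd: "Cell \<le> Cbnd"
    and bounded: "\<And>v w. v \<in> H10 (dom D) \<Longrightarrow> w \<in> H10 (dom D) \<Longrightarrow>
           \<bar>bform D v w\<bar> \<le> Cbnd * energy_norm D v * energy_norm D w"
    and elliptic: "\<And>v. v \<in> H10 (dom D) \<Longrightarrow> bform D v v \<ge> Cell * (energy_norm D v)\<^sup>2"
    and ustar: "ustar \<in> H10 (dom D)"
    and solution: "\<And>v. v \<in> H10 (dom D) \<Longrightarrow> bform D ustar v = rhs D v"
    and initial: "initial_triangulation (dom D) \<T>\<^sub>0"
    and Cstab: "0 < Cstab" and stability: "stability D p \<T>\<^sub>0 Cstab"
    and qred: "0 < qred" "qred < 1" and reduction: "reduction D p \<T>\<^sub>0 qred"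
    and Crel: "0 < Crel" and reliability: "reliability D p \<T>\<^sub>0 ustar Crel"
    and \<theta>: "0 < \<theta>" "\<theta> \<le> 1"
    and Calg: "0 < Calg" and lam: "0 < lam" and kmax: "1 \<le> kmax" and tau: "tau < 0"
    and run: "afem_pgmres D p \<T>\<^sub>0 \<theta> Cmark u\<^sub>0\<^sub>0 Calg lam kmax tau R"
    and Cpre: "1 \<le> Cpre"
    and equivalence: "\<And>l. reached D R Calg lam tau l \<Longrightarrow> norm_equivalence D R l Cpre"
begin

sublocale elliptic_form "H10 (dom D)" "aform D" "bform D" Cell Cbnd
  by (rule elliptic_form_model[OF model Cell Cell_Cbnd bounded elliptic])

abbreviation "reach \<equiv> reached D R Calg lam tau"
abbreviation "stop \<equiv> k_stop D R Calg lam"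
abbreviation "Q \<equiv> index_set D R Calg lam tau"
abbreviation "X l \<equiv> fe_space D p (mesh R l)"
abbreviation "ug l \<equiv> galerkin D p (mesh R l)"
abbreviation "\<eta> l \<equiv> eta D (mesh R l) (mesh R l)"

lemma energy_dist_eq: "energy_dist D v w = dst v w"
  by (simp add: energy_dist_def energy_norm_def)

lemma Q_iff: "(l, k) \<in> Q \<longleftrightarrow> reach l \<and> enat k \<le> stop l"
  by (simp add: index_set_def)

lemma run_step:
  assumes "reach (Suc l)"
  shows "marked R l \<in> doerfler_sets D (mesh R l) \<theta> (iterate R l (the_enat (stop l)))"
    and "is_refine (mesh R l) (marked R l) (mesh R (Suc l))"
    and "iterate R (Suc l) 0 = iterate R l (the_enat (stop l))"
proof -
  have "let u = iterate R l (the_enat (stop l)); \<D> = doerfler_sets D (mesh R l) \<theta> u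
    in marked R l \<in> \<D> \<and> real (card (marked R l)) \<le> Cmark * real (Min (card ` \<D>)) \<and>
       is_refine (mesh R l) (marked R l) (mesh R (Suc l)) \<and> iterate R (Suc l) 0 = u"
    using run assms unfolding afem_pgmres_def by blast
  thus "marked R l \<in> doerfler_sets D (mesh R l) \<theta> (iterate R l (the_enat (stop l)))"
    "is_refine (mesh R l) (marked R l) (mesh R (Suc l))"
    "iterate R (Suc l) 0 = iterate R l (the_enat (stop l))"
    by (auto simp: Let_def)
qed

lemma reach_pred: "reach (Suc l) \<Longrightarrow> reach l"
  by simp

lemma mesh_Suc: "reach (Suc l) \<Longrightarrow> mesh R (Suc l) \<in> refinements (mesh R l)"
  using run_step(2) by (simp add: is_refine_def)

lemma mesh_refinements: "reach l \<Longrightarrow> mesh R l \<in> refinements \<T>\<^sub>0"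
proof (induction l)
  case 0
  have "mesh R 0 = \<T>\<^sub>0" using run by (simp add: afem_pgmres_def)
  then show ?case using initial by (simp add: initial_triangulation_def refinements_refl)
next
  case (Suc l)
  then show ?case using mesh_Suc refinements_trans reach_pred by blast
qed

lemma subspace_X: "subspace_V (X l)"
  unfolding subspace_V_def using fe_space_subset fe_space_zero[OF model] fe_space_lincomb[OF model] by blast

lemma X_H10: "v \<in> X l \<Longrightarrow> v \<in> H10 (dom D)"
  using fe_space_subset by blast

lemma X_mono: "reach (Suc l) \<Longrightarrow> X l \<subseteq> X (Suc l)"
  using fe_space_mono[OF refinements_conforming[OF mesh_refinements[OF reach_pred]] mesh_Suc] by blast

lemma level:
  assumes "reach l"
  shows "pgmres_level (H10 (dom D)) (aform D) (bform D) Cell Cbnd (X l) ustar (ndof R l) (basis R l) (precond R l) Cpre"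
proof
  show "subspace_V (X l)" by (rule subspace_X)
  show "ustar \<in> H10 (dom D)" by (rule ustar)
  show "is_basis (ndof R l) (basis R l) (X l)" "spd (ndof R l) (precond R l)"
    using run assms unfolding afem_pgmres_def by blast+
  show "1 \<le> Cpre" by (rule Cpre)
  fix x :: "real Matrix.vec" assume "x \<in> carrier_vec (ndof R l)"
  thus "inverse Cpre * nrm (lincomb_fun (basis R l) x) \<le> pinv_norm (precond R l) x"
    "pinv_norm (precond R l) x \<le> Cpre * nrm (lincomb_fun (basis R l) x)"
    using equivalence[OF assms] by (auto simp: norm_equivalence_def Let_def energy_norm_def)
qed

text \<open>The right-hand sides coincide because \<open>ustar\<close> satisfies the variational
  equation for every basis function.\<close>

lemma system_eq:
  assumes "reach l"
  shows "pgmres_level.B (bform D) (ndof R l) (basis R l) = sys_mat D R l"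
    and "pgmres_level.d (bform D) ustar (ndof R l) (basis R l) = sys_rhs D R l"
proof -
  interpret L: pgmres_level "H10 (dom D)" "aform D" "bform D" Cell Cbnd "X l" ustar "ndof R l" "basis R l" "precond R l" Cpre
    by (rule level[OF assms])
  show "L.B = sys_mat D R l" by (simp add: L.B_def sys_mat_def galerkin_mat_def)
  show "L.d = sys_rhs D R l"
    unfolding L.d_def sys_rhs_def galerkin_rhs_def
    by (rule eq_vecI) (auto simp: solution X_H10[OF L.basis_mem])
qed

lemma coeffs_carrier: "(l, k) \<in> Q \<Longrightarrow> coeffs R l k \<in> carrier_vec (ndof R l)"
  using run unfolding afem_pgmres_def by blast

lemma iterate_mem:
  assumes "(l, k) \<in> Q"
  shows "iterate R l k \<in> X l"
proof -
  have "reach l" using assms by (simp add: Q_iff)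
  then interpret L: pgmres_level "H10 (dom D)" "aform D" "bform D" Cell Cbnd "X l" ustar "ndof R l" "basis R l" "precond R l" Cpre
    by (rule level)
  show ?thesis unfolding iterate_def by (rule L.lc_mem[OF coeffs_carrier[OF assms]])
qed

lemma galerkin_solution:
  assumes "reach l"
  shows "ug l \<in> X l" and "v \<in> X l \<Longrightarrow> bform D (ug l) v = bform D ustar v"
proof -
  interpret L: pgmres_level "H10 (dom D)" "aform D" "bform D" Cell Cbnd "X l" ustar "ndof R l" "basis R l" "precond R l" Cpre
    by (rule level[OF assms])
  have "(\<lambda>u. u \<in> X l \<and> (\<forall>v\<in>X l. bform D u v = bform D ustar v))
      = (\<lambda>u. u \<in> X l \<and> (\<forall>v\<in>X l. bform D u v = rhs D v))"
    using solution[OF X_H10] by auto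
  hence "ug l = (THE u. u \<in> X l \<and> (\<forall>v\<in>X l. bform D u v = bform D ustar v))"
    by (simp only: galerkin_def)
  hence "ug l \<in> X l \<and> (\<forall>v\<in>X l. bform D (ug l) v = bform D ustar v)"
    using theI'[OF L.galerkin_ex1] by simp
  thus "ug l \<in> X l" "v \<in> X l \<Longrightarrow> bform D (ug l) v = bform D ustar v" by auto
qed

definition Cerr :: real where "Cerr = Cpre / Cell"
definition Cres :: real where "Cres = Cbnd * Cpre"
definition rate :: real where "rate = pgmres_rate Cell Cbnd Cpre"

lemma constants_pos: "0 < Cerr" "0 < Cres"
  using Cell Cbnd_pos Cpre by (auto simp: Cerr_def Cres_def)

lemma level_estimates:
  assumes "(l, k) \<in> Q"
  shows res_norm_nonneg: "0 \<le> res_norm D R l k"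
    and algebraic_error_le: "dst (ug l) (iterate R l k) \<le> Cerr * res_norm D R l k"
    and res_norm_le: "res_norm D R l k \<le> Cres * dst (ug l) (iterate R l k)"
proof -
  have r: "reach l" using assms by (simp add: Q_iff)
  interpret L: pgmres_level "H10 (dom D)" "aform D" "bform D" Cell Cbnd "X l" ustar "ndof R l" "basis R l" "precond R l" Cpre
    by (rule level[OF r])
  note c = coeffs_carrier[OF assms]
  have res: "res_norm D R l k = pinv_norm (precond R l) (L.res (coeffs R l k))"
    by (simp add: res_norm_def system_eq[OF r])
  show "0 \<le> res_norm D R l k" unfolding res by (rule pinv_norm_nonneg[OF L.spd L.res_carrier[OF c]])
  show "dst (ug l) (iterate R l k) \<le> Cerr * res_norm D R l k"
    unfolding res iterate_def Cerr_def by (rule L.error_le_residual[OF galerkin_solution[OF r] c])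
  show "res_norm D R l k \<le> Cres * dst (ug l) (iterate R l k)"
    unfolding res iterate_def Cres_def by (rule L.residual_le_error[OF galerkin_solution[OF r] c])
qed

lemma rate_bounds: "0 \<le> rate" "rate < 1"
  unfolding rate_def by (rule pgmres_rate_bounds[OF Cell Cell_Cbnd Cpre])+

lemma Q_pred: "(l, Suc k) \<in> Q \<Longrightarrow> (l, k) \<in> Q"
  using order_trans[of "enat k" "enat (Suc k)" "stop l"] by (simp add: Q_iff)

lemma Q_le: "(l, k) \<in> Q \<Longrightarrow> j \<le> k \<Longrightarrow> (l, j) \<in> Q"
  using order_trans[of "enat j" "enat k" "stop l"] by (simp add: Q_iff)

lemma res_norm_contraction:
  assumes "(l, Suc k) \<in> Q"
  shows "res_norm D R l (Suc k) \<le> rate * res_norm D R l k"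
proof -
  have r: "reach l" using assms by (simp add: Q_iff)
  interpret L: pgmres_level "H10 (dom D)" "aform D" "bform D" Cell Cbnd "X l" ustar "ndof R l" "basis R l" "precond R l" Cpre
    by (rule level[OF r])
  have "pgmres_iterate kmax (ndof R l) (precond R l) L.B L.d (coeffs R l) j" if "1 \<le> j" "j \<le> Suc k" for j
    using run Q_le[OF assms that(2)] that(1) unfolding afem_pgmres_def system_eq[OF r] by blast
  from L.pgmres_step_contraction[OF kmax coeffs_carrier[OF Q_le[OF assms]] this]
  show ?thesis by (simp add: res_norm_def system_eq[OF r] rate_def)
qed

lemma res_norm_power: "(l, k) \<in> Q \<Longrightarrow> res_norm D R l k \<le> rate ^ k * res_norm D R l 0"
proof (induction k)
  case (Suc k)
  have "res_norm D R l (Suc k) \<le> rate * res_norm D R l k" by (rule res_norm_contraction[OF Suc.prems])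
  also have "\<dots> \<le> rate * (rate ^ k * res_norm D R l 0)"
    by (intro mult_left_mono Suc.IH Q_pred[OF Suc.prems] rate_bounds)
  finally show ?case by (simp add: mult.assoc)
qed simp

lemma res_norm_le_initial:
  assumes "(l, k) \<in> Q"
  shows "res_norm D R l k \<le> res_norm D R l 0"
proof -
  have "rate ^ k \<le> 1" using rate_bounds by (simp add: power_le_one)
  moreover have "0 \<le> res_norm D R l 0" by (rule res_norm_nonneg[OF Q_le[OF assms]]) simp
  ultimately have "rate ^ k * res_norm D R l 0 \<le> 1 * res_norm D R l 0" by (rule mult_right_mono)
  with res_norm_power[OF assms] show ?thesis by simp
qed

text \<open>This is (A1) with both meshes equal to the current one, which is a refinement of
  itself.\<close>

lemma eta_stable:
  assumes "reach l" "v \<in> X l" "w \<in> X l"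
  shows "\<eta> l v \<le> \<eta> l w + Cstab * dst v w"
proof -
  have "mesh R l \<in> refinements (mesh R l)"
    by (rule refinements_refl[OF refinements_conforming[OF mesh_refinements[OF assms(1)]]])
  hence "\<bar>eta D (mesh R l) (mesh R l \<inter> mesh R l) v - eta D (mesh R l) (mesh R l \<inter> mesh R l) w\<bar> \<le> Cstab * energy_dist D v w"
    using stability mesh_refinements[OF assms(1)] assms(2,3) unfolding stability_def by blast
  thus ?thesis by (simp add: energy_dist_eq)
qed

lemma reliable: "reach l \<Longrightarrow> dst ustar (ug l) \<le> Crel * \<eta> l (ug l)"
  using reliability mesh_refinements[of l] unfolding reliability_def energy_dist_eq[symmetric] by blast

definition Ceta :: real where "Ceta = 1 + Cstab * Cerr"

text \<open>The factors of the five terms of \<open>total\<close> added up: Crel Ceta + Cerr and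
  Crel Ceta for the errors against \<open>ustar\<close>, Cerr for the algebraic error, Ceta and 1
  for the estimators.\<close>

definition Ctot :: real where "Ctot = 2 * (Crel * Ceta + Cerr) + Ceta + 1"

lemma Ceta_Ctot: "1 \<le> Ceta" "1 \<le> Ctot"
  using Cstab constants_pos Crel by (simp_all add: Ceta_def Ctot_def)

definition total :: "nat \<Rightarrow> nat \<Rightarrow> real" where
  "total l k = energy_dist D ustar (iterate R l k) + energy_dist D ustar (ug l)
     + energy_dist D (ug l) (iterate R l k) + \<eta> l (ug l) + \<eta> l (iterate R l k)"

lemma quasi_error_parts:
  assumes "(l, k) \<in> Q"
  shows "0 \<le> eta_it D R l k" "0 \<le> res_norm D R l k" "0 \<le> quasi_error D R l k"
    "eta_it D R l k \<le> quasi_error D R l k" "res_norm D R l k \<le> quasi_error D R l k"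
  using res_norm_nonneg[OF assms] eta_nonneg[of D "mesh R l" "mesh R l" "iterate R l k"]
  by (auto simp: quasi_error_def eta_it_def)

lemma eta_galerkin_le:
  assumes "(l, k) \<in> Q"
  shows "\<eta> l (ug l) \<le> Ceta * quasi_error D R l k"
proof -
  have r: "reach l" using assms by (simp add: Q_iff)
  have "\<eta> l (ug l) \<le> eta_it D R l k + Cstab * dst (ug l) (iterate R l k)"
    unfolding eta_it_def by (rule eta_stable[OF r galerkin_solution(1)[OF r] iterate_mem[OF assms]])
  also have "\<dots> \<le> quasi_error D R l k + Cstab * (Cerr * quasi_error D R l k)"
    using algebraic_error_le[OF assms] quasi_error_parts[OF assms] constants_pos Cstab
    by (intro add_mono mult_left_mono order_trans[OF algebraic_error_le[OF assms]]) auto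
  finally show ?thesis by (simp add: Ceta_def algebra_simps)
qed

text \<open>Along a level the residual decreases but the estimator need not. This bound trades it
  for the estimator of the Galerkin solution, which does not depend on \<open>k\<close>, and a
  residual term.\<close>

lemma eta_it_le:
  assumes "(l, k) \<in> Q"
  shows "eta_it D R l k \<le> \<eta> l (ug l) + Cstab * Cerr * res_norm D R l k"
proof -
  have r: "reach l" using assms by (simp add: Q_iff)
  have "eta_it D R l k \<le> \<eta> l (ug l) + Cstab * dst (iterate R l k) (ug l)"
    unfolding eta_it_def by (rule eta_stable[OF r iterate_mem[OF assms] galerkin_solution(1)[OF r]])
  also have "dst (iterate R l k) (ug l) = dst (ug l) (iterate R l k)"
    by (intro dst_commute X_H10[OF iterate_mem[OF assms]] X_H10[OF galerkin_solution(1)[OF r]])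
  also have "Cstab * dst (ug l) (iterate R l k) \<le> Cstab * (Cerr * res_norm D R l k)"
    using algebraic_error_le[OF assms] Cstab by (intro mult_left_mono) auto
  finally show ?thesis by (simp add: mult.assoc)
qed

lemma total_le:
  assumes "(l, k) \<in> Q"
  shows "total l k \<le> Ctot * quasi_error D R l k" and "0 \<le> total l k"
    and "dst ustar (ug l) \<le> Ctot * quasi_error D R l k"
    and "dst ustar (iterate R l k) \<le> Ctot * quasi_error D R l k"
    and "\<eta> l (ug l) \<le> Ctot * quasi_error D R l k"
proof -
  have r: "reach l" using assms by (simp add: Q_iff)
  let ?H = "quasi_error D R l k"
  note mem = X_H10[OF iterate_mem[OF assms]] X_H10[OF galerkin_solution(1)[OF r]] ustar
  have 1: "dst (ug l) (iterate R l k) \<le> Cerr * ?H"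
    using quasi_error_parts[OF assms] constants_pos
    by (intro order_trans[OF algebraic_error_le[OF assms]] mult_left_mono) auto
  have 2: "dst ustar (ug l) \<le> Crel * Ceta * ?H"
    unfolding mult.assoc using Crel
    by (intro order_trans[OF reliable[OF r]] mult_left_mono eta_galerkin_le[OF assms]) auto
  have 3: "dst ustar (iterate R l k) \<le> Crel * Ceta * ?H + Cerr * ?H"
    using dst_triangle[OF mem(3,2,1)] 1 2 by argo
  have 4: "\<eta> l (iterate R l k) \<le> ?H" using quasi_error_parts[OF assms] by (simp add: eta_it_def)
  have n: "0 \<le> dst ustar (ug l)" "0 \<le> dst ustar (iterate R l k)" "0 \<le> dst (ug l) (iterate R l k)"
    "0 \<le> \<eta> l (ug l)" "0 \<le> \<eta> l (iterate R l k)"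
    by (intro dst_nonneg mem eta_nonneg)+
  have tot: "total l k = dst ustar (iterate R l k) + dst ustar (ug l) + dst (ug l) (iterate R l k)
      + \<eta> l (ug l) + \<eta> l (iterate R l k)"
    by (simp only: total_def energy_dist_eq)
  show t: "total l k \<le> Ctot * ?H"
    using 1 2 3 4 eta_galerkin_le[OF assms] unfolding tot Ctot_def by (simp add: algebra_simps)
  show "0 \<le> total l k" "dst ustar (ug l) \<le> Ctot * ?H" "dst ustar (iterate R l k) \<le> Ctot * ?H"
    "\<eta> l (ug l) \<le> Ctot * ?H"
    using t n unfolding tot by argo+
qed

end

context afem_setting
begin

lemma reach_0_Q: "reach l \<Longrightarrow> (l, 0) \<in> Q"
  by (simp add: Q_iff zero_enat_def[symmetric])

text \<open>Quasi-errors are nonnegative and \<open>tau\<close> is negative, so the tolerance test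
  always fails and a level is left exactly when its solver stops.\<close>

lemma reach_Suc_iff: "reach (Suc l) \<longleftrightarrow> reach l \<and> stop l \<noteq> \<infinity>"
proof -
  have "\<not> quasi_error D R l (the_enat (stop l)) \<le> tau" if l: "reach l" "stop l \<noteq> \<infinity>"
  proof -
    obtain j where "stop l = enat j" using l(2) by auto
    hence "(l, the_enat (stop l)) \<in> Q" using l(1) by (simp add: Q_iff)
    thus ?thesis using quasi_error_parts(3) tau by fastforce
  qed
  thus ?thesis by auto
qed

lemma reach_antimono: "reach n \<Longrightarrow> l \<le> n \<Longrightarrow> reach l"
  by (induction n) (auto simp: le_Suc_eq)

section \<open>Evolution of the parameters of the algorithm\<close>

definition Cval :: "nat \<Rightarrow> real" where "Cval l = fst (alg_state D R Calg lam l)"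
definition lamval :: "nat \<Rightarrow> real" where "lamval l = fst (snd (alg_state D R Calg lam l))"
definition Sval :: "nat \<Rightarrow> ennreal" where "Sval l = snd (snd (alg_state D R Calg lam l))"
definition Hval :: "nat \<Rightarrow> real" where "Hval l = quasi_error D R l (the_enat (stop l))"
text \<open>The tested sum \<open>Sval l\<close> contains the reciprocals of the levels below
  \<open>l\<close> only; that of level \<open>l\<close> itself enters at
  \<open>Suc l\<close>.\<close>

definition update :: "nat \<Rightarrow> bool" where
  "update l \<longleftrightarrow> 1 \<le> l \<and> ennreal (Cval l) * inverse (ennreal (Hval l)) < Sval l"

lemma stop_eq: "stop l = stop_index D R (lamval l) l"
  by (simp add: k_stop_def lamval_def)

lemma state_0: "Cval 0 = Calg" "lamval 0 = lam" "Sval 0 = 0"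
  by (simp_all add: Cval_def lamval_def Sval_def)

lemma state_Suc:
  "Cval (Suc l) = (if update l then 2 * Cval l else Cval l)"
  "lamval (Suc l) = (if update l then lamval l / 2 else lamval l)"
  "Sval (Suc l) = Sval l + inverse (ennreal (Hval l))"
proof -
  obtain C la S where st: "alg_state D R Calg lam l = (C, la, S)" by (cases "alg_state D R Calg lam l") auto
  have H: "Hval l = quasi_error D R l (the_enat (stop_index D R la l))"
    by (simp add: Hval_def k_stop_def st)
  have "update l \<longleftrightarrow> 1 \<le> l \<and> ennreal C * inverse (ennreal (Hval l)) < S"
    by (simp add: update_def Cval_def Sval_def st)
  thus "Cval (Suc l) = (if update l then 2 * Cval l else Cval l)"
    "lamval (Suc l) = (if update l then lamval l / 2 else lamval l)"
    "Sval (Suc l) = Sval l + inverse (ennreal (Hval l))"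
    by (simp_all add: Cval_def lamval_def Sval_def st Let_def H[symmetric])
qed

lemma state_pos: "0 < Cval l" "0 < lamval l"
  by (induction l) (simp_all add: state_0 state_Suc Calg lam)

section \<open>Runs that remain on one level forever\<close>

lemma finite_if_terminating:
  assumes "\<not> (\<forall>l. reach l)" "0 < \<epsilon>"
  shows "finite {(l, k) \<in> Q. \<epsilon> \<le> quasi_error D R l k}"
proof -
  define n where "n = (LEAST l. \<not> reach l)"
  have n: "\<not> reach n" "\<And>l. l < n \<Longrightarrow> reach l"
    using assms(1) LeastI_ex[of "\<lambda>l. \<not> reach l"] not_less_Least unfolding n_def by blast+
  obtain L where L: "n = Suc L" using n(1) by (cases n) auto
  have rL: "reach L" using n(2) L by simp
  have stopL: "stop L = \<infinity>" using n(1) rL reach_Suc_iff[of L] unfolding L by blast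
  have QL: "(L, k) \<in> Q" for k using rL stopL by (simp add: Q_iff)
  \<comment> \<open>The stopping test on level \<open>L\<close> always fails, so the estimator is
    below the residual divided by \<lambda>, and the quasi-error is at most 1 + 1/\<lambda> times
    the residual.\<close>
  define c where "c = (1 + 1 / lamval L) * res_norm D R L 0"
  \<comment> \<open>Stated for \<open>Suc k\<close> because the stopping test is first made after
    one step; step 0 falls into the finite exceptional set.\<close>
  have le: "quasi_error D R L (Suc k) \<le> rate ^ Suc k * c" for k
  proof -
    have "lamval L * eta_it D R L (Suc k) < res_norm D R L (Suc k)"
      using stopL by (intro stop_index_infinite) (auto simp: stop_eq)
    hence "eta_it D R L (Suc k) \<le> res_norm D R L (Suc k) / lamval L"
      using state_pos(2)[of L] by (simp add: field_simps)
    hence "quasi_error D R L (Suc k) \<le> (1 + 1 / lamval L) * res_norm D R L (Suc k)"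
      by (simp add: quasi_error_def algebra_simps)
    also have "\<dots> \<le> (1 + 1 / lamval L) * (rate ^ Suc k * res_norm D R L 0)"
      using state_pos(2)[of L] by (intro mult_left_mono res_norm_power QL) auto
    finally show ?thesis by (simp add: c_def mult_ac)
  qed
  have "(\<lambda>k. rate ^ k * c) \<longlonglongrightarrow> 0 * c"
    by (intro tendsto_mult_right LIMSEQ_realpow_zero rate_bounds)
  hence "\<forall>\<^sub>F k in sequentially. rate ^ k * c < \<epsilon>" using assms(2) by (intro order_tendstoD(2)) auto
  then obtain m where m: "\<And>k. m \<le> k \<Longrightarrow> rate ^ k * c < \<epsilon>" by (auto simp: eventually_sequentially)
  have small: "quasi_error D R L k < \<epsilon>" if "Suc m \<le> k" for k
    using le[of "k - 1"] m[of k] that by (cases k) auto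
  have "{(l, k) \<in> Q. \<epsilon> \<le> quasi_error D R l k}
      \<subseteq> (SIGMA l:{..<L}. {..the_enat (stop l)}) \<union> {L} \<times> {..m}"
  proof clarify
    fix l k assume lk: "(l, k) \<in> Q" and big: "\<epsilon> \<le> quasi_error D R l k"
      and out: "\<not> (l \<in> {L} \<and> k \<in> {..m})"
    have "reach l" using lk by (simp add: Q_iff)
    hence "\<not> n \<le> l" using n(1) reach_antimono by blast
    hence "l \<le> L" using L by simp
    moreover have "l \<noteq> L"
    proof
      assume "l = L"
      hence "Suc m \<le> k" using out by auto
      thus False using small[of k] big \<open>l = L\<close> by simp
    qed
    ultimately have l: "l < L" by simp
    hence "stop l \<noteq> \<infinity>" using n(2)[of "Suc l"] L reach_Suc_iff[of l] by auto
    then obtain j where "stop l = enat j" by auto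
    thus "l \<in> {..<L} \<and> k \<in> {..the_enat (stop l)}" using lk l by (simp add: Q_iff)
  qed
  thus ?thesis by (rule finite_subset) auto
qed

end

section \<open>Runs through infinitely many levels\<close>

locale afem_infinite = afem_setting +
  assumes infinite: "\<And>l. reached D R Calg lam tau l"
begin

definition kk :: "nat \<Rightarrow> nat" where "kk l = the_enat (stop l)"

lemma stop_kk: "stop l = enat (kk l)"
  using infinite[of "Suc l"] reach_Suc_iff[of l] by (auto simp: kk_def)

lemma Q_infinite: "(l, k) \<in> Q \<longleftrightarrow> k \<le> kk l"
  by (simp add: Q_iff infinite stop_kk)

lemma Hval_eq: "Hval l = quasi_error D R l (kk l)"
  by (simp add: Hval_def kk_def)

lemma Q_kk: "(l, kk l) \<in> Q"
  by (simp add: Q_infinite)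

lemma Hval_nonneg: "0 \<le> Hval l"
  unfolding Hval_eq by (rule quasi_error_parts(3)[OF Q_kk])

lemma stopping: "res_norm D R l (kk l) \<le> lamval l * eta_it D R l (kk l)"
  using stop_kk[of l] unfolding stop_eq by (rule stop_index_finite)

lemma iterate_Suc_0: "iterate R (Suc l) 0 = iterate R l (kk l)"
  using run_step(3)[OF infinite] by (simp add: kk_def)

lemma H10_mems: "ug l \<in> H10 (dom D)" "iterate R l (kk l) \<in> H10 (dom D)"
  using X_H10 galerkin_solution(1)[OF infinite] iterate_mem[OF Q_kk] by blast+

text \<open>Square root of the factor in \<open>estimator_reduction\<close>: the perturbed recursion
  is for the estimator, not for its square.\<close>

definition \<rho> :: real where "\<rho> = sqrt (1 - (1 - qred\<^sup>2) * \<theta>)"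

lemma \<rho>_bounds: "0 \<le> \<rho>" "\<rho> < 1"
proof -
  have q: "0 < 1 - qred\<^sup>2" "1 - qred\<^sup>2 \<le> 1" using qred by (auto simp: power_less_one_iff)
  have "(1 - qred\<^sup>2) * \<theta> \<le> 1 * 1" using q \<theta> by (intro mult_mono) auto
  moreover have "0 < (1 - qred\<^sup>2) * \<theta>" using q \<theta> by simp
  ultimately show "0 \<le> \<rho>" "\<rho> < 1" by (simp_all add: \<rho>_def)
qed

text \<open>Refinement contracts the estimator of the old iterate; stability on the new mesh then
  exchanges the old iterate for the new one.\<close>

lemma eta_it_Suc_le:
  "eta_it D R (Suc l) (kk (Suc l)) \<le> \<rho> * eta_it D R l (kk l)
    + Cstab * dst (iterate R (Suc l) (kk (Suc l))) (iterate R l (kk l))"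
proof -
  let ?v = "iterate R l (kk l)" and ?w = "iterate R (Suc l) (kk (Suc l))"
  have v: "?v \<in> X l" "?v \<in> X (Suc l)" and w: "?w \<in> X (Suc l)"
    using iterate_mem[OF Q_kk] X_mono[OF infinite] by blast+
  have M: "marked R l \<subseteq> mesh R l" "\<theta> * (\<eta> l ?v)\<^sup>2 \<le> (eta D (mesh R l) (marked R l) ?v)\<^sup>2"
    using run_step(1)[OF infinite] by (auto simp: doerfler_sets_def kk_def)
  have M': "marked R l \<inter> mesh R (Suc l) = {}"
    using run_step(2)[OF infinite] by (simp add: is_refine_def)
  have "(\<eta> (Suc l) ?v)\<^sup>2 \<le> (1 - (1 - qred\<^sup>2) * \<theta>) * (\<eta> l ?v)\<^sup>2"
    by (rule estimator_reduction[OF model stability reduction qred mesh_refinements[OF infinite]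
        mesh_Suc[OF infinite] v(1) M(1) M' M(2)])
  hence "sqrt ((\<eta> (Suc l) ?v)\<^sup>2) \<le> sqrt ((1 - (1 - qred\<^sup>2) * \<theta>) * (\<eta> l ?v)\<^sup>2)"
    by (rule real_sqrt_le_mono)
  hence "\<eta> (Suc l) ?v \<le> \<rho> * \<eta> l ?v" by (simp add: real_sqrt_mult \<rho>_def eta_nonneg)
  with eta_stable[OF infinite w v(2)] show ?thesis unfolding eta_it_def by argo
qed

lemma Hval_tendsto_0_if_updates:
  assumes upd: "\<And>m. \<exists>l\<ge>m. update l"
  shows "Hval \<longlonglongrightarrow> 0"
proof -
  have lam0: "lamval \<longlonglongrightarrow> 0"
  proof (rule tendsto_0_if_halved_infinitely_often)
    show "lamval (Suc l) \<le> lamval l" for l using state_pos(2)[of l] by (simp add: state_Suc)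
    show "\<exists>l\<ge>m. lamval (Suc l) = lamval l / 2" for m
      using upd[of m] by (auto simp: state_Suc)
  qed (rule state_pos)
  define e where "e l = eta_it D R l (kk l)" for l
  define \<delta> where "\<delta> l = dst (ug (Suc l)) (ug l)" for l
  have \<delta>0: "\<delta> \<longlonglongrightarrow> 0"
    unfolding \<delta>_def
    by (rule galerkin_increments_tendsto_0[where X = X and us = ustar])
      (use subspace_X X_mono[OF infinite] galerkin_solution[OF infinite] ustar in auto)
  have e0: "0 \<le> e l" for l unfolding e_def by (rule quasi_error_parts(1)[OF Q_kk])
  \<comment> \<open>The stopping criterion bounds the residual by \<lambda> times the estimator, so
    the algebraic error carries a factor \<lambda> that tends to zero.\<close>
  have alg: "dst (ug l) (iterate R l (kk l)) \<le> Cerr * lamval l * e l" for l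
  proof -
    have "Cerr * res_norm D R l (kk l) \<le> Cerr * (lamval l * e l)"
      unfolding e_def using constants_pos by (intro mult_left_mono stopping) auto
    thus ?thesis using algebraic_error_le[OF Q_kk[of l]] by (simp add: mult.assoc)
  qed
  \<comment> \<open>The distance of consecutive final iterates is split along the path through the
    two Galerkin solutions.\<close>
  have step: "e (Suc l) \<le> \<rho> * e l + Cstab * (Cerr * lamval (Suc l) * e (Suc l) + \<delta> l + Cerr * lamval l * e l)" for l
  proof -
    let ?v = "iterate R l (kk l)" and ?w = "iterate R (Suc l) (kk (Suc l))"
    have "dst ?w ?v \<le> dst ?w (ug (Suc l)) + dst (ug (Suc l)) ?v"
      by (rule dst_triangle[OF H10_mems(2) H10_mems(1) H10_mems(2)])
    moreover have "dst ?w (ug (Suc l)) = dst (ug (Suc l)) ?w" by (rule dst_commute[OF H10_mems(2,1)])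
    moreover have "dst (ug (Suc l)) ?v \<le> \<delta> l + dst (ug l) ?v"
      unfolding \<delta>_def by (rule dst_triangle[OF H10_mems(1) H10_mems(1) H10_mems(2)])
    ultimately have "dst ?w ?v \<le> Cerr * lamval (Suc l) * e (Suc l) + \<delta> l + Cerr * lamval l * e l"
      using alg[of l] alg[of "Suc l"] by argo
    hence "Cstab * dst ?w ?v \<le> Cstab * (Cerr * lamval (Suc l) * e (Suc l) + \<delta> l + Cerr * lamval l * e l)"
      using Cstab by (intro mult_left_mono) auto
    thus ?thesis using eta_it_Suc_le[of l] unfolding e_def by argo
  qed
  \<comment> \<open>Eventually both terms containing \<lambda> have factors below \<kappa>. Moving
    the one with \<open>e (Suc l)\<close> to the left costs the divisor 1 - \<kappa>, and \<kappa> =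
    (1 - \<rho>)/4 gives \<rho> + 2 \<kappa> < 1, so the resulting r is still below 1.\<close>
  define \<kappa> where "\<kappa> = (1 - \<rho>) / 4"
  define r where "r = (\<rho> + \<kappa>) / (1 - \<kappa>)"
  have \<kappa>: "0 < \<kappa>" "0 < 1 - \<kappa>" "\<rho> + \<kappa> < 1 - \<kappa>" using \<rho>_bounds unfolding \<kappa>_def by argo+
  have r: "0 \<le> r" "r < 1" using \<kappa> \<rho>_bounds by (auto simp: r_def)
  have "(\<lambda>l. Cstab * Cerr * lamval l) \<longlonglongrightarrow> Cstab * Cerr * 0" by (intro tendsto_intros lam0)
  hence sm: "\<forall>\<^sub>F l in sequentially. Cstab * Cerr * lamval l < \<kappa>"
    using \<kappa>(1) by (intro order_tendstoD(2)) auto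
  hence sm': "\<forall>\<^sub>F l in sequentially. Cstab * Cerr * lamval (Suc l) < \<kappa>"
    using eventually_sequentially_Suc[of "\<lambda>l. Cstab * Cerr * lamval l < \<kappa>"] by blast
  have "e \<longlonglongrightarrow> 0"
  proof (rule tendsto_0_if_perturbed_contraction[OF e0 r])
    have "(\<lambda>l. (Cstab / (1 - \<kappa>)) * \<delta> l) \<longlonglongrightarrow> (Cstab / (1 - \<kappa>)) * 0" by (intro tendsto_intros \<delta>0)
    thus "(\<lambda>l. (Cstab / (1 - \<kappa>)) * \<delta> l) \<longlonglongrightarrow> 0" by simp
    show "\<forall>\<^sub>F l in sequentially. e (Suc l) \<le> r * e l + (Cstab / (1 - \<kappa>)) * \<delta> l"
      using sm sm'
    proof eventually_elim
      case (elim l)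
      have "(Cstab * Cerr * lamval l) * e l \<le> \<kappa> * e l"
        "(Cstab * Cerr * lamval (Suc l)) * e (Suc l) \<le> \<kappa> * e (Suc l)"
        using elim e0 by (auto intro!: mult_right_mono)
      hence "e (Suc l) \<le> \<rho> * e l + \<kappa> * e (Suc l) + Cstab * \<delta> l + \<kappa> * e l"
        using step[of l] by (simp add: algebra_simps)
      hence "(1 - \<kappa>) * e (Suc l) \<le> (\<rho> + \<kappa>) * e l + Cstab * \<delta> l" by (simp add: algebra_simps)
      hence "e (Suc l) \<le> ((\<rho> + \<kappa>) * e l + Cstab * \<delta> l) / (1 - \<kappa>)"
        using \<kappa>(2) by (simp only: pos_le_divide_eq mult.commute)
      thus ?case by (simp add: r_def add_divide_distrib[of "(\<rho> + \<kappa>) * e l"])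
    qed
  qed
  hence "(\<lambda>l. (1 + lamval l) * e l) \<longlonglongrightarrow> (1 + 0) * 0" by (intro tendsto_intros lam0)
  hence lim: "(\<lambda>l. (1 + lamval l) * e l) \<longlonglongrightarrow> 0" by simp
  have "Hval l \<le> (1 + lamval l) * e l" for l
    using stopping[of l] by (simp add: Hval_eq quasi_error_def e_def algebra_simps)
  thus ?thesis
    by (intro tendsto_sandwich[OF always_eventually[OF allI[OF Hval_nonneg]] _ tendsto_const lim] always_eventually) blast
qed

lemma Hval_tendsto_0: "Hval \<longlonglongrightarrow> 0"
proof (cases "\<forall>m. \<exists>l\<ge>m. update l")
  case True
  then show ?thesis using Hval_tendsto_0_if_updates by blast
next
  case False
  then obtain m where m: "\<And>l. m \<le> l \<Longrightarrow> \<not> update l" by blast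
  \<comment> \<open>The update condition includes \<open>1 \<le> l\<close>, so only from level 1 on
    does a missing update mean that the bound on \<open>Sval l\<close> holds. From \<open>M\<close>
    on the constant in that bound no longer changes.\<close>
  define M where "M = max m 1"
  have const: "Cval l = Cval M" if "M \<le> l" for l
    using that by (induction l rule: dec_induct) (auto simp: state_Suc m M_def)
  show ?thesis
  proof (rule tendsto_0_if_reciprocal_sums_bounded[OF Hval_nonneg state_pos(1)[of M] state_0(3) state_Suc(3)])
    show "Sval l \<le> ennreal (Cval M) * inverse (ennreal (Hval l))" if "M \<le> l" for l
      using m[of l] that const[OF that] by (auto simp: update_def M_def not_less)
  qed
qed

text \<open>On level \<open>Suc l\<close> all residuals are bounded by the first one, hence by the
  distance from the new Galerkin solution to the old final iterate. Passing through
  \<open>ustar\<close> bounds this distance by the values of H at the ends of the two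
  levels.\<close>

lemma finite_if_infinite:
  assumes "0 < \<epsilon>"
  shows "finite {(l, k) \<in> Q. \<epsilon> \<le> quasi_error D R l k}"
proof -
  define c where "c = 1 + Cstab * Cerr"
  have c: "0 \<le> c" using Cstab constants_pos by (simp add: c_def)
  define \<beta> where "\<beta> l = Ctot * Hval (Suc l) + c * (Cres * (Ctot * Hval (Suc l) + Ctot * Hval l))" for l
  have bound: "quasi_error D R (Suc l) k \<le> \<beta> l" if lk: "(Suc l, k) \<in> Q" for l k
  proof -
    have "dst (ug (Suc l)) (iterate R (Suc l) 0) \<le> dst (ug (Suc l)) ustar + dst ustar (iterate R l (kk l))"
      unfolding iterate_Suc_0 by (rule dst_triangle[OF H10_mems(1) ustar H10_mems(2)])
    also have "dst (ug (Suc l)) ustar = dst ustar (ug (Suc l))" by (rule dst_commute[OF H10_mems(1) ustar])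
    finally have 0: "dst (ug (Suc l)) (iterate R (Suc l) 0) \<le> Ctot * Hval (Suc l) + Ctot * Hval l"
      using total_le(3)[OF Q_kk[of "Suc l"]] total_le(4)[OF Q_kk[of l]] unfolding Hval_eq by argo
    have "res_norm D R (Suc l) k \<le> res_norm D R (Suc l) 0" by (rule res_norm_le_initial[OF lk])
    also have "\<dots> \<le> Cres * dst (ug (Suc l)) (iterate R (Suc l) 0)"
      by (rule res_norm_le[OF reach_0_Q[OF infinite]])
    also have "\<dots> \<le> Cres * (Ctot * Hval (Suc l) + Ctot * Hval l)"
      using 0 constants_pos by (intro mult_left_mono) auto
    finally have res: "c * res_norm D R (Suc l) k \<le> c * (Cres * (Ctot * Hval (Suc l) + Ctot * Hval l))"
      using c by (rule mult_left_mono)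
    have "quasi_error D R (Suc l) k \<le> \<eta> (Suc l) (ug (Suc l)) + c * res_norm D R (Suc l) k"
      using eta_it_le[OF lk] by (simp add: quasi_error_def c_def algebra_simps)
    thus ?thesis using res total_le(5)[OF Q_kk[of "Suc l"]] unfolding \<beta>_def Hval_eq by argo
  qed
  have "\<beta> \<longlonglongrightarrow> Ctot * 0 + c * (Cres * (Ctot * 0 + Ctot * 0))"
    unfolding \<beta>_def by (intro tendsto_intros Hval_tendsto_0 LIMSEQ_Suc[OF Hval_tendsto_0])
  hence "\<forall>\<^sub>F l in sequentially. \<beta> l < \<epsilon>" using assms by (intro order_tendstoD(2)) auto
  then obtain m where m: "\<And>l. m \<le> l \<Longrightarrow> \<beta> l < \<epsilon>" by (auto simp: eventually_sequentially)
  \<comment> \<open>The bound \<open>\<beta> l\<close> concerns level \<open>Suc l\<close>, so it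
    leaves the levels up to and including \<open>m\<close>, each with finitely many steps.\<close>
  have "{(l, k) \<in> Q. \<epsilon> \<le> quasi_error D R l k} \<subseteq> (SIGMA l:{..m}. {..kk l})"
  proof clarify
    fix l k assume lk: "(l, k) \<in> Q" and big: "\<epsilon> \<le> quasi_error D R l k"
    have "l \<le> m"
    proof (rule ccontr)
      assume "\<not> l \<le> m"
      then obtain j where "l = Suc j" "m \<le> j" by (cases l) auto
      thus False using bound[of j k] m[of j] lk big by fastforce
    qed
    thus "l \<in> {..m} \<and> k \<in> {..kk l}" using lk by (simp add: Q_infinite)
  qed
  thus ?thesis by (rule finite_subset) auto
qed

end

section \<open>From finitely many large quasi-errors to convergence\<close>

context afem_setting
begin

lemma finite_large_quasi_error:
  assumes "0 < \<epsilon>"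
  shows "finite {(l, k) \<in> Q. \<epsilon> \<le> quasi_error D R l k}"
proof (cases "\<forall>l. reach l")
  case True
  then interpret afem_infinite D ustar u\<^sub>0\<^sub>0 \<T>\<^sub>0 R p kmax Cell Cbnd Cstab qred Crel Cpre \<theta> Cmark Calg lam tau
    by unfold_locales blast
  show ?thesis by (rule finite_if_infinite[OF assms])
qed (rule finite_if_terminating[OF _ assms])

lemma total_tendsto_0:
  "((\<lambda>(l, k). total l k) \<longlongrightarrow> 0) (inf (filtercomap (step_count Q) at_top) (principal Q))"
proof (rule tendsto_along_step_count)
  fix \<epsilon> :: real assume \<epsilon>: "0 < \<epsilon>"
  have "{q \<in> Q. \<epsilon> \<le> (case q of (l, k) \<Rightarrow> total l k)} \<subseteq> {(l, k) \<in> Q. \<epsilon> / Ctot \<le> quasi_error D R l k}"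
  proof clarify
    fix l k assume lk: "(l, k) \<in> Q" "\<epsilon> \<le> total l k"
    have "\<epsilon> \<le> Ctot * quasi_error D R l k" using total_le(1)[OF lk(1)] lk(2) by simp
    thus "\<epsilon> / Ctot \<le> quasi_error D R l k" using Ceta_Ctot by (simp add: field_simps)
  qed
  moreover have "finite {(l, k) \<in> Q. \<epsilon> / Ctot \<le> quasi_error D R l k}"
    using \<epsilon> Ceta_Ctot by (intro finite_large_quasi_error) simp
  ultimately show "finite {q \<in> Q. \<epsilon> \<le> (case q of (l, k) \<Rightarrow> total l k)}" by (rule finite_subset)
qed (use total_le(2) in auto)

end

theorem corollary21:
  fixes D :: "'d::finite pde"
    and ustar u\<^sub>0\<^sub>0 :: "real^'d \<Rightarrow> real"
    and \<T>\<^sub>0 :: "'d mesh"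
    and R :: "'d run"
    and p kmax :: nat
    and Cell Cbnd Cstab qred Crel Cpre \<theta> Cmark Calg lam tau :: real
  assumes "model_problem D"
    and "0 < Cell" and "Cell \<le> Cbnd"
    and "\<And>v w. v \<in> H10 (dom D) \<Longrightarrow> w \<in> H10 (dom D) \<Longrightarrow>
           \<bar>bform D v w\<bar> \<le> Cbnd * energy_norm D v * energy_norm D w"
    and "\<And>v. v \<in> H10 (dom D) \<Longrightarrow> bform D v v \<ge> Cell * (energy_norm D v)\<^sup>2"
    and "ustar \<in> H10 (dom D)"
    and "\<And>v. v \<in> H10 (dom D) \<Longrightarrow> bform D ustar v = rhs D v"
    and "initial_triangulation (dom D) \<T>\<^sub>0"
    and "data_regular D \<T>\<^sub>0"
    and "1 \<le> p"
    and "0 < Cstab" and "stability D p \<T>\<^sub>0 Cstab"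
    and "0 < qred" and "qred < 1" and "reduction D p \<T>\<^sub>0 qred"
    and "0 < Crel" and "reliability D p \<T>\<^sub>0 ustar Crel"
    and "0 < \<theta>" and "\<theta> \<le> 1" and "1 \<le> Cmark"
    and "u\<^sub>0\<^sub>0 \<in> fe_space D p \<T>\<^sub>0"
    and "0 < Calg" and "0 < lam" and "1 \<le> kmax"
    and "tau < 0"
    and "afem_pgmres D p \<T>\<^sub>0 \<theta> Cmark u\<^sub>0\<^sub>0 Calg lam kmax tau R"
    and "1 \<le> Cpre"
    and "\<And>l. reached D R Calg lam tau l \<Longrightarrow> norm_equivalence D R l Cpre"
  shows "((\<lambda>(l, k).
              energy_dist D ustar (iterate R l k)
            + energy_dist D ustar (galerkin D p (mesh R l))
            + energy_dist D (galerkin D p (mesh R l)) (iterate R l k)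
            + eta D (mesh R l) (mesh R l) (galerkin D p (mesh R l))
            + eta D (mesh R l) (mesh R l) (iterate R l k))
          \<longlongrightarrow> 0)
         (inf (filtercomap (step_count (index_set D R Calg lam tau)) at_top)
              (principal (index_set D R Calg lam tau)))"
proof -
  interpret afem_setting D ustar u\<^sub>0\<^sub>0 \<T>\<^sub>0 R p kmax Cell Cbnd Cstab qred Crel Cpre \<theta> Cmark Calg lam tau
    by unfold_locales (use assms in auto)
  show ?thesis using total_tendsto_0 unfolding total_def .
qed

end
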